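(* Under the standing assumptions below: (a) $\Gamma\text{-}\lim_{k\to\infty}S_k=S$ in $C_b(\mathbb{R}^{2d})'$ (weak-* topology) and in $\mathcal{P}(\mathbb{R}^{2d})$ (narrow topology); (b) $\Gamma\text{-}\lim_{k\to\infty}T_k=T$ in $C_b(\mathbb{R}^d)'$ and in $\mathcal{P}(\mathbb{R}^d)$; (c) consequently, for every $\nu\in\mathcal{P}(\mathbb{R}^d)$ there is a sequence $(\nu_k)$ in $\mathcal{P}(\mathbb{R}^d)$ with $\nu_k\to\nu$ narrowly and $\lim_{k\to\infty}T_k(\nu_k)=T(\nu)$ in $[0,\infty]$.
   Context: $\Gamma$-limit: for functions $f_k$ on a topological space, $\Gamma\text{-}\lim f_k(x)=\sup_{V\in\mathcal{N}(x)}\lim_k\inf_{y\in V}f_k(y)$ when this limit exists ($\mathcal{N}(x)$ the neighbourhoods of $x$). Standing assumptions: $\mu\in\mathcal{P}(\mathbb{R}^d)$; for each $z\in\mathbb{R}^d$, $\mathbb{R}^d$-valued random variables $\{U^k_z\}_{k\ge1}$; for each $k$, $(\mathrm{Law}(U^k_z))_{z}$ is a Feller system ($z\mapsto\mathbb{E}f(U^k_z)$ continuous for all bounded continuous $f$); for each $z$, $\{U^k_z\}_k$ obeys the $k$-LDP in $\mathbb{R}^d$ with good (compact level sets) rate function $c_z$; also there is a triangular array $z_{n,i}$ with $\frac1n\sum_{i\le n}\delta_{z_{n,i}}\to\mu$. $c(x_0,x_1)=c_{x_0}(x_1)$; $\pi^k(dx_0dx_1)=\mu(dx_0)\mathrm{Law}(U^k_{x_0})(dx_1)$;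 $H$ is relative entropy. Functions (defined on $C_b'$, with value $+\infty$ off probability measures): $S_k(\rho)=\frac1kH(\rho|\pi^k)$ if $\rho_0=\mu$, $+\infty$ otherwise; $S(\rho)=\int c\,d\rho$ if $\rho_0=\mu$, $+\infty$ otherwise; $T_k(\nu)=\inf_{\rho\in\Pi(\mu,\nu)}\frac1kH(\rho|\pi^k)$; $T(\nu)=\inf_{\rho\in\Pi(\mu,\nu)}\int c\,d\rho$, where $\Pi(\mu,\nu)$ is the set of probability measures on $\mathbb{R}^{2d}$ with marginals $\mu,\nu$. *)

theory Defs
  imports "HOL-Probability.Probability"
begin

definition prob_borel :: "'b::topological_space measure \<Rightarrow> bool" where
  "prob_borel \<rho> \<longleftrightarrow> prob_space \<rho> \<and> sets \<rho> = sets borel"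

text \<open>Narrow topology on P(X): the coarsest topology making all maps
  rho to the integral of f continuous, f bounded continuous.  Its topspace is P(X).\<close>
definition narrow_top :: "'b::topological_space measure topology" where
  "narrow_top = topology_generated_by
     {{\<rho>. prob_borel \<rho> \<and> (\<integral>x. apply_bcontfun f x \<partial>\<rho>) \<in> U} | f U. open (U :: real set)}"

definition weak_star_top :: "(('b::topological_space \<Rightarrow>\<^sub>C real) \<Rightarrow>\<^sub>L real) topology" where
  "weak_star_top = topology_generated_by
     {{l. blinfun_apply l f \<in> U} | f U. open (U :: real set)}"

text \<open>Extension of a functional on P(X) to C_b(X)': value at the functional
  induced by rho (integration against rho), +infinity elsewhere.  Since a Borel
  probability measure is determined by its integrals of bounded continuous functions,
  the infimum is over at most one element.\<close>
definition lift_dual :: "('b::topological_space measure \<Rightarrow> ereal)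
    \<Rightarrow> (('b \<Rightarrow>\<^sub>C real) \<Rightarrow>\<^sub>L real) \<Rightarrow> ereal" where
  "lift_dual G l = (INF \<rho> \<in> {\<rho>. prob_borel \<rho> \<and>
       (\<forall>f. blinfun_apply l f = (\<integral>x. apply_bcontfun f x \<partial>\<rho>))}. G \<rho>)"

definition gamma_liminf :: "'b topology \<Rightarrow> (nat \<Rightarrow> 'b \<Rightarrow> ereal) \<Rightarrow> 'b \<Rightarrow> ereal" where
  "gamma_liminf X F x = (SUP V \<in> {V. openin X V \<and> x \<in> V}. liminf (\<lambda>k. INF y \<in> V. F k y))"

definition gamma_limsup :: "'b topology \<Rightarrow> (nat \<Rightarrow> 'b \<Rightarrow> ereal) \<Rightarrow> 'b \<Rightarrow> ereal" where
  "gamma_limsup X F x = (SUP V \<in> {V. openin X V \<and> x \<in> V}. limsup (\<lambda>k. INF y \<in> V. F k y))"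

definition gamma_lim :: "'b topology \<Rightarrow> (nat \<Rightarrow> 'b \<Rightarrow> ereal) \<Rightarrow> ('b \<Rightarrow> ereal) \<Rightarrow> bool" where
  "gamma_lim X F G \<longleftrightarrow> (\<forall>x\<in>topspace X. gamma_liminf X F x = G x \<and> gamma_limsup X F x = G x)"

definition rel_entropy :: "'b measure \<Rightarrow> 'b measure \<Rightarrow> ereal" where
  "rel_entropy \<rho> \<pi> =
     (if sets \<rho> = sets \<pi> \<and> absolutely_continuous \<pi> \<rho> then
        (let g = (\<lambda>x. enn2real (RN_deriv \<pi> \<rho> x) * ln (enn2real (RN_deriv \<pi> \<rho> x)))
         in enn2ereal (\<integral>\<^sup>+x. ennreal (g x) \<partial>\<pi>) - enn2ereal (\<integral>\<^sup>+x. ennreal (- g x) \<partial>\<pi>))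
      else \<infinity>)"

definition eln :: "real \<Rightarrow> ereal" where
  "eln p = (if p \<le> 0 then -\<infinity> else ereal (ln p))"

definition good_rate :: "('b::topological_space \<Rightarrow> ennreal) \<Rightarrow> bool" where
  "good_rate I \<longleftrightarrow> (\<forall>a::real. compact {x. I x \<le> ennreal a})"

definition k_ldp :: "(nat \<Rightarrow> 'b::topological_space measure) \<Rightarrow> ('b \<Rightarrow> ennreal) \<Rightarrow> bool" where
  "k_ldp P I \<longleftrightarrow> good_rate I
     \<and> (\<forall>F. closed F \<longrightarrow>
          limsup (\<lambda>k. ereal (1 / real k) * eln (measure (P k) F)) \<le> - (INF x\<in>F. enn2ereal (I x)))
     \<and> (\<forall>G. open G \<longrightarrow>
          - (INF x\<in>G. enn2ereal (I x)) \<le> liminf (\<lambda>k. ereal (1 / real k) * eln (measure (P k) G)))"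

text \<open>pi^k(dx0 dx1) = mu(dx0) Law(U^k_x0)(dx1); L k z is Law(U^k_z).\<close>
definition ref_meas :: "'a::euclidean_space measure \<Rightarrow> (nat \<Rightarrow> 'a \<Rightarrow> 'a measure) \<Rightarrow> nat
    \<Rightarrow> ('a \<times> 'a) measure" where
  "ref_meas \<mu> L k = measure_of UNIV (sets (borel :: ('a \<times> 'a) measure))
     (\<lambda>A. \<integral>\<^sup>+x. emeasure (L k x) (Pair x -` A) \<partial>\<mu>)"

definition first_marg :: "('a::euclidean_space \<times> 'a) measure \<Rightarrow> 'a measure" where
  "first_marg \<rho> = distr \<rho> borel fst"

definition second_marg :: "('a::euclidean_space \<times> 'a) measure \<Rightarrow> 'a measure" where
  "second_marg \<rho> = distr \<rho> borel snd"

definition couplings :: "'a::euclidean_space measure \<Rightarrow> 'a measure \<Rightarrow> ('a \<times> 'a) measure set" where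
  "couplings \<mu> \<nu> = {\<rho>. prob_borel \<rho> \<and> first_marg \<rho> = \<mu> \<and> second_marg \<rho> = \<nu>}"

definition S_k :: "'a::euclidean_space measure \<Rightarrow> (nat \<Rightarrow> 'a \<Rightarrow> 'a measure) \<Rightarrow> nat
    \<Rightarrow> ('a \<times> 'a) measure \<Rightarrow> ereal" where
  "S_k \<mu> L k \<rho> = (if first_marg \<rho> = \<mu> then ereal (1 / real k) * rel_entropy \<rho> (ref_meas \<mu> L k) else \<infinity>)"

definition S_lim :: "'a::euclidean_space measure \<Rightarrow> ('a \<Rightarrow> 'a \<Rightarrow> ennreal)
    \<Rightarrow> ('a \<times> 'a) measure \<Rightarrow> ereal" where
  "S_lim \<mu> c \<rho> = (if first_marg \<rho> = \<mu> then enn2ereal (\<integral>\<^sup>+p. c (fst p) (snd p) \<partial>\<rho>) else \<infinity>)"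

definition T_k :: "'a::euclidean_space measure \<Rightarrow> (nat \<Rightarrow> 'a \<Rightarrow> 'a measure) \<Rightarrow> nat
    \<Rightarrow> 'a measure \<Rightarrow> ereal" where
  "T_k \<mu> L k \<nu> = (INF \<rho> \<in> couplings \<mu> \<nu>. ereal (1 / real k) * rel_entropy \<rho> (ref_meas \<mu> L k))"

definition T_lim :: "'a::euclidean_space measure \<Rightarrow> ('a \<Rightarrow> 'a \<Rightarrow> ennreal)
    \<Rightarrow> 'a measure \<Rightarrow> ereal" where
  "T_lim \<mu> c \<nu> = (INF \<rho> \<in> couplings \<mu> \<nu>. enn2ereal (\<integral>\<^sup>+p. c (fst p) (snd p) \<partial>\<rho>))"

end

theory Submission
  imports Defs
begin

text \<open>Lower bound. The variational formula for the entropy, applied to $k g(x,y)$ minus the log-Laplace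
  transform of $k g(x,\cdot)$ under the law at $x$, bounds $\int g\,d\rho$ by $S_k(\rho)$ up to $o(1)$,
  uniformly over all $\rho$ with first marginal $\mu$, whenever the scaled log-Laplace transforms of $g$ have
  nonpositive upper limit. The large deviation upper bound supplies such $g$: finite maxima of
  $t\,1_E(x)\,\varphi(y)$, where $E$ is the set of $x$ at which the closed set carrying $\varphi$ has rate
  at least $t$. Countably many of them have supremum at least $c$, which gives lower semicontinuity, and those
  supported far from the origin give tightness; tight families have cluster measures by a Riesz representation
  argument. Cluster measures also dispose of the functionals in the dual that are not measures, and of the
  infimum over couplings in $T_k$.

  Upper bound. Split the target space into finitely many small cells and replace $\rho$, conditionally on
  $x$ and on the cell, by the law at $x$ conditioned on a ball containing the cell, except where this
  conditioning costs more than the large deviation lower bound predicts; there the law at $x$ is left alone.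
  Convexity of $t \ln t$ bounds the entropy by the expected conditioning cost.\<close>

section \<open>Bounded continuous functions and narrow convergence\<close>

text \<open>All asymptotic information is pointwise in \<open>x\<close>: the large deviation bounds
  hold for each fixed \<open>x\<close> without uniformity, and no regularity of \<open>c\<close> in
  its first argument is assumed. What compensates is the fixed first marginal. A function of
  \<open>x\<close> alone has the same integral against every competitor, so Borel sets of
  \<open>x\<close> may be replaced by continuous functions, exceptional sets of small \<mu>-measure
  weigh the same for every \<rho>, and pointwise asymptotics become integrated ones by dominated
  convergence. The sets of \<open>x\<close> that occur are cut out by upper and lower limits of
  scaled log-probabilities of the laws, which are Borel in \<open>x\<close> once the laws form a
  measurable kernel.

  The weak star topology need not be first countable, so sequences may fail to detect a Gamma lower
  limit; filters on pairs of an index and a measure do. One compactness statement about such filters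
  then serves both topologies.\<close>

lemma bcontfunI:
  fixes f :: "'b::topological_space \<Rightarrow> real"
  assumes "continuous_on UNIV f" "\<And>x. \<bar>f x\<bar> \<le> B"
  shows "f \<in> bcontfun"
  using assms by (auto simp: bcontfun_def bounded_iff)

lemma bcontfun_bound:
  fixes f :: "'b::topological_space \<Rightarrow> real"
  assumes "f \<in> bcontfun"
  obtains B where "B > 0" "\<And>x. \<bar>f x\<bar> \<le> B"
proof -
  from assms obtain B where "\<And>x. \<bar>f x\<bar> \<le> B" by (auto simp: bcontfun_def bounded_iff)
  then show ?thesis by (intro that[of "max B 1"]) (auto simp: le_max_iff_disj)
qed

lemma bcontfun_continuous: "f \<in> bcontfun \<Longrightarrow> continuous_on UNIV f"
  by (simp add: bcontfun_def)

lemma bcontfun_measurable: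
  fixes f :: "'b::topological_space \<Rightarrow> real"
  shows "f \<in> bcontfun \<Longrightarrow> f \<in> borel_measurable borel"
  by (simp add: bcontfun_def borel_measurable_continuous_onI)

lemma prob_borelD:
  assumes "prob_borel \<rho>"
  shows "prob_space \<rho>" "sets \<rho> = sets borel" "space \<rho> = UNIV"
  using assms sets_eq_imp_space_eq[of \<rho> borel] by (auto simp: prob_borel_def)

lemma integrable_bounded_measurable:
  fixes f :: "'b::topological_space \<Rightarrow> real"
  assumes "prob_borel \<rho>" "f \<in> borel_measurable borel" "\<And>x. \<bar>f x\<bar> \<le> B"
  shows "integrable \<rho> f"
proof -
  interpret prob_space \<rho> using assms prob_borelD by auto
  show ?thesis
    using assms prob_borelD[OF assms(1)]
    by (intro integrable_const_bound[of _ B]) (auto simp: measurable_cong_sets[of \<rho> borel])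
qed

lemma integrable_bcontfun:
  fixes f :: "'b::topological_space \<Rightarrow> real"
  assumes "prob_borel \<rho>" "f \<in> bcontfun"
  shows "integrable \<rho> f"
  using assms bcontfun_bound integrable_bounded_measurable bcontfun_measurable by metis

lemma abs_integral_le:
  fixes f :: "'b::topological_space \<Rightarrow> real"
  assumes "prob_borel \<rho>" "f \<in> borel_measurable borel" "\<And>x. \<bar>f x\<bar> \<le> B"
  shows "\<bar>\<integral>x. f x \<partial>\<rho>\<bar> \<le> B"
proof -
  interpret prob_space \<rho> using assms prob_borelD by auto
  have "\<bar>\<integral>x. f x \<partial>\<rho>\<bar> \<le> (\<integral>x. \<bar>f x\<bar> \<partial>\<rho>)" by (rule integral_abs_bound)
  also have "\<dots> \<le> (\<integral>x. B \<partial>\<rho>)"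
    using integrable_bounded_measurable[OF assms] assms by (intro integral_mono) auto
  finally show ?thesis by (simp add: prob_space)
qed

text \<open>Stated along an arbitrary filter, so that it covers sequences as well as the filters on
  which cluster measures are found. Being a probability is kept as a separate condition.\<close>

definition narrow_lim :: "('i \<Rightarrow> 'b::topological_space measure) \<Rightarrow> 'b measure \<Rightarrow> 'i filter \<Rightarrow> bool" where
  "narrow_lim R \<rho> F \<longleftrightarrow>
     (\<forall>f::'b \<Rightarrow> real. f \<in> bcontfun \<longrightarrow> ((\<lambda>i. \<integral>x. f x \<partial>R i) \<longlongrightarrow> (\<integral>x. f x \<partial>\<rho>)) F)"

lemma closed_indicator_approx:
  fixes F :: "'b::metric_space set"
  assumes "closed F"
  obtains g :: "nat \<Rightarrow> 'b \<Rightarrow> real" where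
    "\<And>n. continuous_on UNIV (g n)" "\<And>n x. 0 \<le> g n x" "\<And>n x. g n x \<le> 1"
    "\<And>n x. g (Suc n) x \<le> g n x" "\<And>n x. x \<in> F \<Longrightarrow> g n x = 1"
    "\<And>x. (\<lambda>n. g n x) \<longlonglongrightarrow> indicator F x"
proof (cases "F = {}")
  case True
  \<comment> \<open>\<open>infdist x {}\<close> is 0 by convention, so the formula of the other case
    would give the constant 1 here.\<close>
  show ?thesis by (rule that[of "\<lambda>_ _. 0"]) (auto simp: True)
next
  case False
  define g where "g n x = max 0 (1 - real n * infdist x F)" for n x
  show ?thesis
  proof (rule that[of g])
    show "continuous_on UNIV (g n)" for n
      unfolding g_def by (intro continuous_intros)
    show "g (Suc n) x \<le> g n x" for n x
      using infdist_nonneg[of x F] unfolding g_def by (auto simp: algebra_simps max_def)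
    show one: "g n x = 1" if "x \<in> F" for n x
      using that by (simp add: g_def)
    show "(\<lambda>n. g n x) \<longlonglongrightarrow> indicator F x" for x
    proof (cases "x \<in> F")
      case True
      then show ?thesis by (simp add: one)
    next
      case x: False
      then have d: "infdist x F > 0"
        using assms False by (metis in_closed_iff_infdist_zero infdist_nonneg less_eq_real_def)
      obtain N where "1 / infdist x F < real N" using reals_Archimedean2 by blast
      then have N: "1 < real N * infdist x F" using d by (simp add: field_simps)
      have "g n x = 0" if "n \<ge> N" for n
      proof -
        have "real N * infdist x F \<le> real n * infdist x F"
          using that d by (intro mult_right_mono) auto
        with N show ?thesis by (simp add: g_def)
      qed
      then have "\<forall>\<^sub>F n in sequentially. g n x = 0"
        by (auto simp: eventually_sequentially)
      then show ?thesis using x by (simp add: tendsto_eventually)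
    qed
  qed (auto simp: g_def infdist_nonneg)
qed

lemma measure_closed_LIMSEQ:
  fixes g :: "nat \<Rightarrow> 'b::metric_space \<Rightarrow> real"
  assumes "prob_borel \<rho>" "closed F"
    and g: "\<And>n. continuous_on UNIV (g n)" "\<And>n x. 0 \<le> g n x" "\<And>n x. g n x \<le> 1"
      "\<And>x. (\<lambda>n. g n x) \<longlonglongrightarrow> indicator F x"
  shows "(\<lambda>n. \<integral>x. g n x \<partial>\<rho>) \<longlonglongrightarrow> measure \<rho> F"
proof -
  note p = prob_borelD[OF assms(1)]
  interpret prob_space \<rho> by fact
  have F: "F \<in> sets \<rho>" using assms p by auto
  have "(\<lambda>n. \<integral>x. g n x \<partial>\<rho>) \<longlonglongrightarrow> (\<integral>x. indicator F x \<partial>\<rho>)"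
  proof (rule integral_dominated_convergence[where w = "\<lambda>_. 1"])
    show "(indicator F :: 'b \<Rightarrow> real) \<in> borel_measurable \<rho>" using F by auto
    show "g n \<in> borel_measurable \<rho>" for n
      using borel_measurable_continuous_onI[OF g(1)] p by (simp add: measurable_cong_sets[of \<rho> borel])
  qed (use g in \<open>auto\<close>)
  then show ?thesis using F by simp
qed

text \<open>Closed sets are an intersection-stable generator of the Borel sets, and on them a
  probability is a limit of integrals of continuous functions with values in [0, 1].\<close>

lemma prob_borel_eqI:
  fixes \<rho> \<sigma> :: "'b::metric_space measure"
  assumes "prob_borel \<rho>" "prob_borel \<sigma>"
    and eq: "\<And>f::'b \<Rightarrow> real. f \<in> bcontfun \<Longrightarrow> (\<integral>x. f x \<partial>\<rho>) = (\<integral>x. f x \<partial>\<sigma>)"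
  shows "\<rho> = \<sigma>"
proof (rule measure_eqI_generator_eq[where E = "Collect closed" and \<Omega> = UNIV and A = "\<lambda>_. UNIV"])
  show "Int_stable (Collect closed :: 'b set set)" by (auto simp: Int_stable_def)
  show "sets \<rho> = sigma_sets UNIV (Collect closed)" "sets \<sigma> = sigma_sets UNIV (Collect closed)"
    using assms prob_borelD by (auto simp: borel_eq_closed)
  interpret R: prob_space \<rho> using assms prob_borelD by auto
  interpret S: prob_space \<sigma> using assms prob_borelD by auto
  fix F :: "'b set" assume "F \<in> Collect closed"
  then have F: "closed F" by simp
  obtain g :: "nat \<Rightarrow> 'b \<Rightarrow> real" where g: "\<And>n. continuous_on UNIV (g n)" "\<And>n x. 0 \<le> g n x"
    "\<And>n x. g n x \<le> 1" "\<And>x. (\<lambda>n. g n x) \<longlonglongrightarrow> indicator F x"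
    by (rule closed_indicator_approx[OF F]) blast
  have "g n \<in> bcontfun" for n using g by (intro bcontfunI[of _ 1]) auto
  then have "(\<integral>x. g n x \<partial>\<rho>) = (\<integral>x. g n x \<partial>\<sigma>)" for n by (rule eq)
  then have "measure \<rho> F = measure \<sigma> F"
    using measure_closed_LIMSEQ[OF assms(1) F g] measure_closed_LIMSEQ[OF assms(2) F g]
    by (simp add: LIMSEQ_unique)
  then show "emeasure \<rho> F = emeasure \<sigma> F" by (simp add: R.emeasure_eq_measure S.emeasure_eq_measure)
next
  show "emeasure \<rho> ((\<lambda>_. UNIV) (i::nat)) \<noteq> \<infinity>" for i
    using prob_borelD[OF assms(1)] by (simp add: prob_space.emeasure_space_1 flip: prob_borelD(3)[OF assms(1)])
qed auto

text \<open>The mass of a closed set is a pointwise limit of continuous functions of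
  \<open>x\<close>, hence Borel in \<open>x\<close>; the generator argument extends this to all
  Borel sets. This is how the Feller property enters.\<close>

lemma feller_kernel_measurable:
  fixes K :: "'a::metric_space \<Rightarrow> 'b::metric_space measure"
  assumes K: "\<And>x. prob_borel (K x)"
    and feller: "\<And>f::'b \<Rightarrow> real. f \<in> bcontfun \<Longrightarrow> continuous_on UNIV (\<lambda>x. \<integral>y. f y \<partial>K x)"
  shows "K \<in> borel \<rightarrow>\<^sub>M subprob_algebra borel"
proof (rule measurable_subprob_algebra_generated[where G = "Collect closed" and \<Omega> = UNIV])
  show "Int_stable (Collect closed :: 'b set set)" by (auto simp: Int_stable_def)
  show "subprob_space (K x)" for x
    using K prob_borelD by (metis prob_space_imp_subprob_space)
  show "sets (K x) = sets borel" for x using K prob_borelD by auto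
  show "sets borel = sigma_sets UNIV (Collect closed :: 'b set set)"
    by (auto simp: borel_eq_closed)
  show "(\<lambda>x. emeasure (K x) UNIV) \<in> borel_measurable borel"
  proof -
    have "emeasure (K x) UNIV = 1" for x
      using K[of x] prob_borelD by (metis prob_space.emeasure_space_1)
    then show ?thesis by simp
  qed
next
  fix F :: "'b set" assume "F \<in> Collect closed"
  then have F: "closed F" by simp
  obtain g :: "nat \<Rightarrow> 'b \<Rightarrow> real" where g: "\<And>n. continuous_on UNIV (g n)" "\<And>n x. 0 \<le> g n x"
    "\<And>n x. g n x \<le> 1" "\<And>x. (\<lambda>n. g n x) \<longlonglongrightarrow> indicator F x"
    by (rule closed_indicator_approx[OF F]) blast
  have "g n \<in> bcontfun" for n using g by (intro bcontfunI[of _ 1]) auto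
  then have "(\<lambda>x. \<integral>y. g n y \<partial>K x) \<in> borel_measurable borel" for n
    by (intro borel_measurable_continuous_onI feller)
  moreover have "(\<lambda>n. \<integral>y. g n y \<partial>K x) \<longlonglongrightarrow> measure (K x) F" for x
    by (rule measure_closed_LIMSEQ[OF K F g])
  ultimately have "(\<lambda>x. measure (K x) F) \<in> borel_measurable borel"
    by (rule borel_measurable_LIMSEQ_real[rotated]) 
  moreover have "emeasure (K x) F = ennreal (measure (K x) F)" for x
    using K[of x] prob_borelD by (metis finite_measure.emeasure_eq_measure prob_space.axioms(1))
  ultimately show "(\<lambda>x. emeasure (K x) F) \<in> borel_measurable borel" by simp
qed auto

text \<open>The approximants are the inf-convolutions $\inf_y (f(y) + m\,d(x,y))$.\<close>

lemma lipschitz_approx_below: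
  fixes f :: "'b::metric_space \<Rightarrow> real"
  assumes f: "f \<in> bcontfun"
  obtains g B where "B > 0" "\<And>m x. \<bar>g m x\<bar> \<le> B" "\<And>m x. g m x \<le> f x"
    "\<And>m x y. \<bar>g m x - g m y\<bar> \<le> real m * dist x y" "\<And>x. (\<lambda>m. g m x) \<longlonglongrightarrow> f x"
proof -
  obtain B where B: "B > 0" "\<And>x. \<bar>f x\<bar> \<le> B" using bcontfun_bound[OF f] by blast
  define g where "g m x = (INF y. f y + real m * dist x y)" for m x
  have low: "-B \<le> f y + real m * dist x y" for m x y
    using B(2)[of y] by (smt (verit) zero_le_dist mult_nonneg_nonneg of_nat_0_le_iff)
  have bdd: "bdd_below (range (\<lambda>y. f y + real m * dist x y))" for m x
    using low by (auto intro!: bdd_belowI)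
  have le: "g m x \<le> f y + real m * dist x y" for m x y
    unfolding g_def by (rule cINF_lower[OF bdd]) simp
  have ge: "-B \<le> g m x" for m x
    unfolding g_def by (rule cINF_greatest) (use low in auto)
  have lef: "g m x \<le> f x" for m x using le[of m x x] by simp
  have lip: "g m x \<le> g m y + real m * dist x y" for m x y
  proof -
    have "g m x - real m * dist x y \<le> g m y"
      unfolding g_def[of m y]
    proof (rule cINF_greatest)
      fix w
      have "g m x \<le> f w + real m * dist x w" by (rule le)
      also have "real m * dist x w \<le> real m * (dist x y + dist y w)"
        by (intro mult_left_mono dist_triangle) auto
      finally show "g m x - real m * dist x y \<le> f w + real m * dist y w"
        by (simp add: algebra_simps)
    qed auto
    then show ?thesis by simp
  qed
  show ?thesis
  proof (rule that[of B g])
    show "\<bar>g m x\<bar> \<le> B" for m x using ge[of m x] lef[of m x] B(2)[of x] by auto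
    show "\<bar>g m x - g m y\<bar> \<le> real m * dist x y" for m x y
      using lip[of m x y] lip[of m y x] by (auto simp: dist_commute)
    show "(\<lambda>m. g m x) \<longlonglongrightarrow> f x" for x
    proof (rule LIMSEQ_I)
      fix e :: real assume e: "e > 0"
      have "isCont f x" using f by (simp add: bcontfun_def continuous_on_eq_continuous_at)
      then obtain d where d: "d > 0" "\<And>y. dist y x < d \<Longrightarrow> dist (f y) (f x) < e/2"
        using e by (metis continuous_at_eps_delta half_gt_zero)
      \<comment> \<open>For \<open>m \<ge> N\<close> a point \<open>y\<close> at distance at least
        \<open>d\<close> pays a penalty of at least \<open>2 * B\<close>, which covers the
        oscillation of \<open>f\<close>; closer points are handled by continuity.\<close>
      obtain N where N: "2 * B / d < real N" using reals_Archimedean2 by blast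
      have low': "f x - e/2 \<le> g m x" if "m \<ge> N" for m
        unfolding g_def
      proof (rule cINF_greatest)
        fix y
        show "f x - e/2 \<le> f y + real m * dist x y"
        proof (cases "dist y x < d")
          case True
          have "0 \<le> real m * dist x y" by simp
          with d(2)[OF True] e show ?thesis unfolding dist_real_def by linarith
        next
          case False
          have "2 * B \<le> real N * d" using N d by (simp add: field_simps)
          also have "\<dots> \<le> real m * dist x y"
            using that False d by (intro mult_mono) (auto simp: dist_commute)
          finally show ?thesis using B(2)[of x] B(2)[of y] e by auto
        qed
      qed auto
      have "norm (g m x - f x) < e" if "m \<ge> N" for m
        using low'[OF that] lef[of m x] e unfolding real_norm_def by linarith
      then show "\<exists>no. \<forall>m\<ge>no. norm (g m x - f x) < e" by blast
    qed
  qed (use B lef in auto)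
qed

text \<open>A bounded continuous \<open>f\<close> is a pointwise limit of bounded Lipschitz
  functions below it, which bounds the integrals of \<open>f\<close> from below in the limit; the
  same for \<open>- f\<close> gives the other side. An error \<open>e k\<close> uniform in the test
  function is what the recovery construction delivers.\<close>

lemma narrow_lim_lipschitzI:
  fixes R :: "nat \<Rightarrow> 'b::metric_space measure"
  assumes R: "\<And>k. prob_borel (R k)" and \<rho>: "prob_borel \<rho>"
    and close: "\<forall>\<^sub>F k in sequentially. \<forall>f::'b \<Rightarrow> real. (\<forall>x. \<bar>f x\<bar> \<le> 1) \<longrightarrow> (\<forall>x y. \<bar>f x - f y\<bar> \<le> dist x y)
       \<longrightarrow> \<bar>(\<integral>x. f x \<partial>R k) - (\<integral>x. f x \<partial>\<rho>)\<bar> \<le> e k"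
    and e: "e \<longlonglongrightarrow> 0"
  shows "narrow_lim R \<rho> sequentially"
proof -
  have lip_cont: "continuous_on UNIV f" if "\<And>x y. \<bar>f x - f y\<bar> \<le> M * dist x y" for f :: "'b \<Rightarrow> real" and M
  proof -
    have "(max M 0)-lipschitz_on UNIV f"
    proof (rule lipschitz_onI)
      fix x y
      have "\<bar>f x - f y\<bar> \<le> M * dist x y" by (rule that)
      also have "\<dots> \<le> max M 0 * dist x y" by (intro mult_right_mono) auto
      finally show "dist (f x) (f y) \<le> max M 0 * dist x y" by (simp add: dist_real_def)
    qed auto
    then show ?thesis by (rule lipschitz_on_continuous_on)
  qed
  have lip: "(\<lambda>k. \<integral>x. f x \<partial>R k) \<longlonglongrightarrow> (\<integral>x. f x \<partial>\<rho>)"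
    if f: "\<And>x. \<bar>f x\<bar> \<le> M" "\<And>x y. \<bar>f x - f y\<bar> \<le> M * dist x y" and "M > 0" for f :: "'b \<Rightarrow> real" and M
  proof -
    have *: "\<forall>\<^sub>F k in sequentially. norm ((\<integral>x. f x \<partial>R k) - (\<integral>x. f x \<partial>\<rho>)) \<le> M * e k"
      using close
    proof eventually_elim
      case (elim k)
      have b: "\<bar>f x / M\<bar> \<le> 1" for x using f(1)[of x] \<open>M > 0\<close> by simp
      have l: "\<bar>f x / M - f y / M\<bar> \<le> dist x y" for x y
      proof -
        have "\<bar>f x / M - f y / M\<bar> = \<bar>f x - f y\<bar> / M"
          using \<open>M > 0\<close> by (simp only: diff_divide_distrib[symmetric] abs_divide abs_of_pos)
        then show ?thesis using f(2)[of x y] \<open>M > 0\<close> by (simp add: divide_le_eq mult.commute)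
      qed
      have "\<bar>(\<integral>x. f x / M \<partial>R k) - (\<integral>x. f x / M \<partial>\<rho>)\<bar> \<le> e k"
        using b l by (intro elim[THEN spec, of "\<lambda>x. f x / M", THEN mp, THEN mp] allI)
      moreover have "\<bar>(\<integral>x. f x / M \<partial>R k) - (\<integral>x. f x / M \<partial>\<rho>)\<bar> = \<bar>(\<integral>x. f x \<partial>R k) - (\<integral>x. f x \<partial>\<rho>)\<bar> / M"
        using \<open>M > 0\<close> by (simp only: integral_divide_zero diff_divide_distrib[symmetric] abs_divide abs_of_pos)
      ultimately have "\<bar>(\<integral>x. f x \<partial>R k) - (\<integral>x. f x \<partial>\<rho>)\<bar> / M \<le> e k" by simp
      then show ?case using \<open>M > 0\<close> by (simp add: field_simps)
    qed
    have "(\<lambda>k. (\<integral>x. f x \<partial>R k) - (\<integral>x. f x \<partial>\<rho>)) \<longlonglongrightarrow> 0"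
      by (rule Lim_null_comparison[OF *]) (use tendsto_mult_left[OF e, of M] in simp)
    then show ?thesis by (simp add: LIM_zero_iff)
  qed
  have lower: "\<forall>\<^sub>F k in sequentially. (\<integral>x. f x \<partial>\<rho>) - \<epsilon> < (\<integral>x. f x \<partial>R k)"
    if f: "f \<in> bcontfun" and "\<epsilon> > 0" for f :: "'b \<Rightarrow> real" and \<epsilon>
  proof -
    obtain g B where g: "B > 0" "\<And>m x. \<bar>g m x\<bar> \<le> B" "\<And>m x. g m x \<le> f x"
      "\<And>m x y. \<bar>g m x - g m y\<bar> \<le> real m * dist x y" "\<And>x. (\<lambda>m. g m x) \<longlonglongrightarrow> f x"
      by (rule lipschitz_approx_below[OF f]) (rule that)
    have gm: "g m \<in> borel_measurable borel" for m
      by (intro borel_measurable_continuous_onI lip_cont[OF g(4)])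
    have "(\<lambda>m. \<integral>x. g m x \<partial>\<rho>) \<longlonglongrightarrow> (\<integral>x. f x \<partial>\<rho>)"
    proof (rule integral_dominated_convergence[where w = "\<lambda>_. B"])
      show "integrable \<rho> (\<lambda>_. B)"
        using prob_borelD[OF \<rho>] by (intro integrable_bounded_measurable[OF \<rho>, of _ "\<bar>B\<bar>"]) auto
      show "f \<in> borel_measurable \<rho>" "g m \<in> borel_measurable \<rho>" for m
        using gm bcontfun_measurable[OF f] prob_borelD(2)[OF \<rho>] by (simp_all add: measurable_cong_sets[of \<rho> borel])
      show "AE x in \<rho>. (\<lambda>m. g m x) \<longlonglongrightarrow> f x" using g(5) by simp
      show "AE x in \<rho>. norm (g m x) \<le> B" for m using g(2) by simp
    qed
    then have "\<forall>\<^sub>F m in sequentially. (\<integral>x. f x \<partial>\<rho>) - \<epsilon>/2 < (\<integral>x. g m x \<partial>\<rho>)"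
      using \<open>\<epsilon> > 0\<close> by (intro order_tendstoD) auto
    from eventually_happens'[OF sequentially_bot this] obtain m where m: "(\<integral>x. f x \<partial>\<rho>) - \<epsilon>/2 < (\<integral>x. g m x \<partial>\<rho>)"
      by blast
    have "(\<lambda>k. \<integral>x. g m x \<partial>R k) \<longlonglongrightarrow> (\<integral>x. g m x \<partial>\<rho>)"
    proof (rule lip[where M = "max B (real m)"])
      show "\<bar>g m x\<bar> \<le> max B (real m)" for x using g(2)[of m x] by auto
      show "\<bar>g m x - g m y\<bar> \<le> max B (real m) * dist x y" for x y
        using g(4)[of m x y] by (rule order_trans) (intro mult_right_mono, auto)
    qed (use g(1) in simp)
    then have "\<forall>\<^sub>F k in sequentially. (\<integral>x. g m x \<partial>\<rho>) - \<epsilon>/2 < (\<integral>x. g m x \<partial>R k)"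
      using \<open>\<epsilon> > 0\<close> by (intro order_tendstoD) auto
    then show ?thesis
    proof eventually_elim
      case (elim k)
      have "(\<integral>x. g m x \<partial>R k) \<le> (\<integral>x. f x \<partial>R k)"
        using integrable_bounded_measurable[OF R gm g(2)] integrable_bcontfun[OF R f] g(3)
        by (intro integral_mono) auto
      with elim m show ?case by simp
    qed
  qed
  show ?thesis unfolding narrow_lim_def
  proof (intro allI impI)
    fix f :: "'b \<Rightarrow> real" assume f: "f \<in> bcontfun"
    obtain B where "\<And>x. \<bar>f x\<bar> \<le> B" by (rule bcontfun_bound[OF f]) (rule that)
    then have mf: "(\<lambda>x. - f x) \<in> bcontfun"
      using bcontfun_continuous[OF f] by (intro bcontfunI[of _ B] continuous_on_minus) auto
    show "(\<lambda>k. \<integral>x. f x \<partial>R k) \<longlonglongrightarrow> (\<integral>x. f x \<partial>\<rho>)"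
    proof (rule tendstoI)
      fix \<epsilon> :: real assume "\<epsilon> > 0"
      from lower[OF f this] lower[OF mf this]
      show "\<forall>\<^sub>F k in sequentially. dist (\<integral>x. f x \<partial>R k) (\<integral>x. f x \<partial>\<rho>) < \<epsilon>"
        by eventually_elim (simp add: dist_real_def abs_less_iff)
    qed
  qed
qed

section \<open>Tight functionals and cluster measures\<close>

lemma open_indicator_approx:
  fixes U :: "'b::metric_space set"
  assumes "open U"
  obtains u :: "nat \<Rightarrow> 'b \<Rightarrow> real" where
    "\<And>n. u n \<in> bcontfun" "\<And>n x. 0 \<le> u n x" "\<And>n x. u n x \<le> 1"
    "\<And>n x. u n x \<le> u (Suc n) x" "\<And>n x. x \<notin> U \<Longrightarrow> u n x = 0"
    "\<And>x. x \<in> U \<Longrightarrow> (\<lambda>n. u n x) \<longlonglongrightarrow> 1"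
proof -
  have "closed (-U)" using assms by auto
  then obtain g :: "nat \<Rightarrow> 'b \<Rightarrow> real" where
    g: "\<And>n. continuous_on UNIV (g n)" "\<And>n x. 0 \<le> g n x" "\<And>n x. g n x \<le> 1"
    "\<And>n x. g (Suc n) x \<le> g n x" "\<And>n x. x \<in> - U \<Longrightarrow> g n x = 1"
    "\<And>x. (\<lambda>n. g n x) \<longlonglongrightarrow> indicator (-U) x"
    by (rule closed_indicator_approx) (rule that)
  show ?thesis
  proof (rule that[of "\<lambda>n x. 1 - g n x"])
    show "(\<lambda>x. 1 - g n x) \<in> bcontfun" for n
      using g(2,3)[of n] g(1)[of n] by (intro bcontfunI[of _ 1] continuous_intros) auto
    show "(\<lambda>n. 1 - g n x) \<longlonglongrightarrow> 1" if "x \<in> U" for x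
      using tendsto_diff[OF tendsto_const g(6), of 1 x] that by simp
  qed (use g in auto)
qed

lemma bcontfun_add: "f \<in> bcontfun \<Longrightarrow> g \<in> bcontfun \<Longrightarrow> (\<lambda>x. f x + g x :: real) \<in> bcontfun"
  by (auto simp: bcontfun_def intro!: continuous_intros bounded_plus_comp)


lemma bcontfun_mult:
  assumes "f \<in> bcontfun" "g \<in> bcontfun"
  shows "(\<lambda>x. f x * g x :: real) \<in> bcontfun"
proof -
  obtain A B where "\<And>x. \<bar>f x\<bar> \<le> A" "\<And>x. \<bar>g x\<bar> \<le> B" "A > 0" by (meson bcontfun_bound assms)
  then have "\<bar>f x * g x\<bar> \<le> A * B" for x
    by (simp add: abs_mult mult_mono)
  moreover have "continuous_on UNIV (\<lambda>x. f x * g x)"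
    using assms by (intro continuous_intros bcontfun_continuous)
  ultimately show ?thesis by (rule bcontfunI[rotated])
qed

lemma bcontfun_const: "(\<lambda>x. c :: real) \<in> bcontfun"
  by (intro bcontfunI[of _ "\<bar>c\<bar>"]) auto

lemma bcontfun_cmult: "f \<in> bcontfun \<Longrightarrow> (\<lambda>x. c * f x :: real) \<in> bcontfun"
  by (rule bcontfun_mult[OF bcontfun_const])

lemma bcontfun_diff: "f \<in> bcontfun \<Longrightarrow> g \<in> bcontfun \<Longrightarrow> (\<lambda>x. f x - g x :: real) \<in> bcontfun"
  using bcontfun_add[of f "\<lambda>x. -1 * g x"] bcontfun_cmult[of g "-1"] by simp

lemma bcontfun_sum: "(\<And>i. i \<in> I \<Longrightarrow> f i \<in> bcontfun) \<Longrightarrow> (\<lambda>x. \<Sum>i\<in>I. f i x :: real) \<in> bcontfun"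
  by (induction I rule: infinite_finite_induct) (auto intro: bcontfun_const bcontfun_add)

section \<open>Riesz representation of tight functionals through Daniell's outer measure\<close>

lemma sum_clamp:
  fixes t :: real
  assumes "0 \<le> t"
  shows "(\<Sum>j<N. min 1 (max 0 (t - real j))) = min t (real N)"
  using assms by (induction N) auto

text \<open>The first four assumptions describe a normalised positive linear functional, which on a
  noncompact space may have mass at infinity. The last one forbids this: the complement of some ball
  is dominated by a bounded continuous function of small value.\<close>

locale tight_functional =
  fixes \<Lambda> :: "('b::euclidean_space \<Rightarrow> real) \<Rightarrow> real"
  assumes add: "\<And>f g. f \<in> bcontfun \<Longrightarrow> g \<in> bcontfun \<Longrightarrow> \<Lambda> (\<lambda>x. f x + g x) = \<Lambda> f + \<Lambda> g"
    and scale: "\<And>c f. f \<in> bcontfun \<Longrightarrow> \<Lambda> (\<lambda>x. c * f x) = c * \<Lambda> f"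
    and nonneg: "\<And>f. f \<in> bcontfun \<Longrightarrow> (\<And>x. 0 \<le> f x) \<Longrightarrow> 0 \<le> \<Lambda> f"
    and one: "\<Lambda> (\<lambda>_. 1) = 1"
    and tight: "\<And>e. e > 0 \<Longrightarrow> \<exists>f r. f \<in> bcontfun \<and> (\<forall>x. 0 \<le> f x) \<and> (\<forall>x. r < norm x \<longrightarrow> 1 \<le> f x) \<and> \<Lambda> f \<le> e"
begin

lemma diff:
  assumes "f \<in> bcontfun" "g \<in> bcontfun"
  shows "\<Lambda> (\<lambda>x. f x - g x) = \<Lambda> f - \<Lambda> g"
  using add[of f "\<lambda>x. -1 * g x"] scale[of g "-1"] bcontfun_cmult[of g "-1"] assms by simp

lemma mono:
  assumes "f \<in> bcontfun" "g \<in> bcontfun" "\<And>x. f x \<le> g x"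
  shows "\<Lambda> f \<le> \<Lambda> g"
  using nonneg[of "\<lambda>x. g x - f x"] diff[of g f] bcontfun_diff[of g f] assms by simp

lemma zero: "\<Lambda> (\<lambda>_. 0) = 0"
  using scale[of "\<lambda>_. 1" 0] by (simp add: bcontfun_const)

lemma sum:
  assumes "\<And>i. i \<in> I \<Longrightarrow> f i \<in> bcontfun"
  shows "\<Lambda> (\<lambda>x. \<Sum>i\<in>I. f i x) = (\<Sum>i\<in>I. \<Lambda> (f i))"
  using assms
proof (induction I rule: infinite_finite_induct)
  case (insert i I)
  then show ?case by (simp add: add bcontfun_sum)
qed (simp_all add: zero)

text \<open>Countable covers by functions take the place of covers by open sets, so that an outer
  measure can be computed from \<Lambda> directly. The sum is taken in \<open>ennreal\<close> and
  may diverge.\<close>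

definition covers :: "(nat \<Rightarrow> 'b \<Rightarrow> real) \<Rightarrow> 'b set \<Rightarrow> bool" where
  "covers f A \<longleftrightarrow> (\<forall>i. f i \<in> bcontfun) \<and> (\<forall>i x. 0 \<le> f i x) \<and> (\<forall>x\<in>A. 1 \<le> (\<Sum>i. ennreal (f i x)))"

definition om :: "'b set \<Rightarrow> ennreal" where
  "om A = (INF f\<in>{f. covers f A}. \<Sum>i. ennreal (\<Lambda> (f i)))"

lemma om_le: "covers f A \<Longrightarrow> om A \<le> (\<Sum>i. ennreal (\<Lambda> (f i)))"
  unfolding om_def by (rule INF_lower) simp

lemma om_mono: "A \<subseteq> B \<Longrightarrow> om A \<le> om B"
  unfolding om_def covers_def by (rule INF_superset_mono) auto

lemma om_single:
  assumes "f \<in> bcontfun" "\<And>x. 0 \<le> f x" "\<And>x. x \<in> A \<Longrightarrow> 1 \<le> f x"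
  shows "om A \<le> ennreal (\<Lambda> f)"
proof -
  define F where "F i = (if i = (0::nat) then f else (\<lambda>_. 0))" for i
  have s: "(\<Sum>i. g i) = g 0" if "\<And>i. i \<noteq> 0 \<Longrightarrow> g i = 0" for g :: "nat \<Rightarrow> ennreal"
    using suminf_finite[of "{0}" g] that by auto
  have "covers F A"
    unfolding covers_def
  proof (intro conjI allI ballI)
    fix x assume "x \<in> A"
    have "(\<Sum>i. ennreal (F i x)) = ennreal (F 0 x)" by (rule s) (simp add: F_def)
    then show "1 \<le> (\<Sum>i. ennreal (F i x))" using assms(3)[OF \<open>x \<in> A\<close>] by (simp add: F_def)
  qed (auto simp: F_def assms bcontfun_const)
  then have "om A \<le> (\<Sum>i. ennreal (\<Lambda> (F i)))" by (rule om_le)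
  also have "\<dots> = ennreal (\<Lambda> (F 0))" by (rule s) (simp add: F_def zero)
  finally show ?thesis by (simp add: F_def)
qed

lemma om_le_1: "om A \<le> 1"
  using om_single[of "\<lambda>_. 1" A] by (simp add: bcontfun_const one)

lemma om_empty: "om {} = 0"
  using om_single[of "\<lambda>_. 0" "{}"] by (simp add: bcontfun_const zero)

text \<open>A doubly indexed cover becomes a cover after enumerating pairs. It serves unions of sets
  and, later, the splitting of each function of a cover into countably many pieces.\<close>

lemma covers_pair:
  assumes "\<And>n i. f n i \<in> bcontfun" "\<And>n i x. 0 \<le> f n i x"
    and "\<And>x. x \<in> A \<Longrightarrow> 1 \<le> (\<Sum>n. \<Sum>i. ennreal (f n i x))"
  shows "om A \<le> (\<Sum>n. \<Sum>i. ennreal (\<Lambda> (f n i)))"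
proof -
  have eq: "(\<Sum>m. case_prod g (prod_decode m)) = (\<Sum>n. \<Sum>i. g n i)" for g :: "nat \<Rightarrow> nat \<Rightarrow> ennreal"
    using suminf_ennreal_2dimen[of "\<lambda>n. \<Sum>i. g n i" "case_prod g"] by (simp add: comp_def)
  have "covers (\<lambda>m. case_prod f (prod_decode m)) A"
    unfolding covers_def
  proof (intro conjI allI ballI)
    fix x assume "x \<in> A"
    then show "1 \<le> (\<Sum>m. ennreal ((case prod_decode m of (n, i) \<Rightarrow> f n i) x))"
      using assms(3)[of x] eq[of "\<lambda>n i. ennreal (f n i x)"] by (simp add: split_def)
  qed (auto simp: split_def assms)
  then show ?thesis
    using om_le[of "\<lambda>m. case_prod f (prod_decode m)" A] eq[of "\<lambda>n i. ennreal (\<Lambda> (f n i))"]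
    by (simp add: split_def)
qed

lemma om_countably_subadditive: "om (\<Union>n. A n) \<le> (\<Sum>n::nat. om (A n))"
proof (rule ennreal_le_epsilon)
  fix e :: real assume e: "0 < e"
  have "\<exists>f. covers f (A n) \<and> (\<Sum>i. ennreal (\<Lambda> (f i))) \<le> om (A n) + ennreal (e * (1/2)^Suc n)" for n
  proof -
    have c: "0 < e * (1/2)^Suc n" using e by simp
    \<comment> \<open>Finiteness makes adding a positive number a strict increase, so that a nearly
      optimal cover exists.\<close>
    obtain r where r: "om (A n) = ennreal r" "0 \<le> r"
      using om_le_1[of "A n"] by (cases "om (A n)") (auto simp: top_unique)
    have "om (A n) < om (A n) + ennreal (e * (1/2)^Suc n)"
      unfolding r(1) using r(2) c by (subst ennreal_plus[symmetric]) (auto intro!: ennreal_lessI)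
    then obtain f where "covers f (A n)" "(\<Sum>i. ennreal (\<Lambda> (f i))) < om (A n) + ennreal (e * (1/2)^Suc n)"
      unfolding om_def INF_less_iff by auto
    then show ?thesis by (auto intro: less_imp_le)
  qed
  then obtain f where f: "\<And>n. covers (f n) (A n)"
    "\<And>n. (\<Sum>i. ennreal (\<Lambda> (f n i))) \<le> om (A n) + ennreal (e * (1/2)^Suc n)" by metis
  have "om (\<Union>n. A n) \<le> (\<Sum>n. \<Sum>i. ennreal (\<Lambda> (f n i)))"
  proof (rule covers_pair)
    fix x assume "x \<in> (\<Union>n. A n)"
    then obtain n where "x \<in> A n" by auto
    then have "1 \<le> (\<Sum>i. ennreal (f n i x))" using f(1) by (auto simp: covers_def)
    also have "\<dots> = (\<Sum>n\<in>{n}. \<Sum>i. ennreal (f n i x))" by simp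
    also have "\<dots> \<le> (\<Sum>n. \<Sum>i. ennreal (f n i x))" by (rule sum_le_suminf) auto
    finally show "1 \<le> (\<Sum>n. \<Sum>i. ennreal (f n i x))" .
  qed (use f in \<open>auto simp: covers_def\<close>)
  also have "\<dots> \<le> (\<Sum>n. om (A n) + ennreal (e * (1/2)^Suc n))"
    by (intro suminf_le f) auto
  also have "\<dots> = (\<Sum>n. om (A n)) + (\<Sum>n. ennreal (e * (1/2)^Suc n))"
    by (rule suminf_add[symmetric]) auto
  also have "(\<Sum>n. ennreal (e * (1/2)^Suc n)) = ennreal e"
    using e sums_mult[OF power_half_series, of e] by (intro suminf_ennreal_eq) auto
  finally show "om (\<Union>n. A n) \<le> (\<Sum>n. om (A n)) + ennreal e" .
qed

lemma om_outer: "outer_measure_space (Pow UNIV) om"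
  unfolding outer_measure_space_def positive_def increasing_def countably_subadditive_def
  using om_empty om_mono om_countably_subadditive by auto

text \<open>The increments of functions increasing to the indicator of an open set form a countable
  partition of unity on that set.\<close>

lemma suminf_telescope:
  fixes u :: "nat \<Rightarrow> real"
  assumes "u \<longlonglongrightarrow> 1" "\<And>n. u n \<le> u (Suc n)" "0 \<le> u 0"
  defines "d \<equiv> \<lambda>n. case n of 0 \<Rightarrow> u 0 | Suc m \<Rightarrow> u (Suc m) - u m"
  shows "(\<Sum>n. ennreal (d n)) = 1"
proof -
  have s: "(\<Sum>i<Suc n. d i) = u n" for n by (induction n) (auto simp: d_def)
  have "(\<lambda>n. \<Sum>i<Suc n. d i) \<longlonglongrightarrow> 1" unfolding s by fact
  then have "d sums 1" unfolding sums_def by (rule LIMSEQ_imp_Suc)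
  moreover have "0 \<le> d n" for n using assms(2,3) by (cases n) (auto simp: d_def)
  ultimately have "(\<Sum>n. ennreal (d n)) = ennreal 1" by (intro suminf_ennreal_eq)
  then show ?thesis by simp
qed

text \<open>Each function of a cover of \<open>E\<close> splits as
  \<open>f i * u n + f i * (1 - u n)\<close>. The second parts cover \<open>E - U\<close> for every
  \<open>n\<close>, as \<open>u n\<close> vanishes off \<open>U\<close>. The first parts need not
  cover \<open>E \<inter> U\<close> for any single \<open>n\<close>, so the pieces
  \<open>f i * d n\<close> over all increments are used; those up to index \<open>n\<close> add up
  to \<open>a n\<close>. Since \<open>a n + b n\<close> does not depend on \<open>n\<close>, the
  supremum over \<open>n\<close> gives the Caratheodory inequality.\<close>

lemma open_in_lambda_system:
  assumes "open U"
  shows "om (E \<inter> U) + om (E - U) \<le> om E"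
  unfolding om_def[of E]
proof (rule INF_greatest)
  fix f assume "f \<in> {f. covers f E}"
  then have f: "\<And>i. f i \<in> bcontfun" "\<And>i x. 0 \<le> f i x" "\<And>x. x \<in> E \<Longrightarrow> 1 \<le> (\<Sum>i. ennreal (f i x))"
    by (auto simp: covers_def)
  obtain u :: "nat \<Rightarrow> 'b \<Rightarrow> real" where u:
    "\<And>n. u n \<in> bcontfun" "\<And>n x. 0 \<le> u n x" "\<And>n x. u n x \<le> 1"
    "\<And>n x. u n x \<le> u (Suc n) x" "\<And>n x. x \<notin> U \<Longrightarrow> u n x = 0"
    "\<And>x. x \<in> U \<Longrightarrow> (\<lambda>n. u n x) \<longlonglongrightarrow> 1"
    by (rule open_indicator_approx[OF assms]) (rule that)
  define d where "d n x = (case n of 0 \<Rightarrow> u 0 x | Suc m \<Rightarrow> u (Suc m) x - u m x)" for n x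
  have d: "d n \<in> bcontfun" "0 \<le> d n x" for n x
    unfolding d_def using u(1,2,4) by (cases n; simp add: bcontfun_diff)+
  have ds: "(\<Sum>i<Suc n. d i x) = u n x" for n x by (induction n) (auto simp: d_def)
  define s where "s = (\<Sum>i. ennreal (\<Lambda> (f i)))"
  define a where "a n = (\<Sum>i. ennreal (\<Lambda> (\<lambda>x. f i x * u n x)))" for n
  define b where "b n = (\<Sum>i. ennreal (\<Lambda> (\<lambda>x. f i x * (1 - u n x))))" for n
  have ab: "a n + b n = s" for n
  proof -
    have "ennreal (\<Lambda> (\<lambda>x. f i x * u n x)) + ennreal (\<Lambda> (\<lambda>x. f i x * (1 - u n x))) = ennreal (\<Lambda> (f i))" for i
    proof -
      have "\<Lambda> (\<lambda>x. f i x * u n x + f i x * (1 - u n x)) = \<Lambda> (\<lambda>x. f i x * u n x) + \<Lambda> (\<lambda>x. f i x * (1 - u n x))"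
        using f u by (intro add bcontfun_mult bcontfun_diff bcontfun_const) auto
      moreover have "(\<lambda>x. f i x * u n x + f i x * (1 - u n x)) = f i" by (auto simp: algebra_simps)
      moreover have "0 \<le> \<Lambda> (\<lambda>x. f i x * u n x)"
        by (rule nonneg[OF bcontfun_mult[OF f(1) u(1)]]) (simp add: f(2) u(2))
      moreover have "0 \<le> \<Lambda> (\<lambda>x. f i x * (1 - u n x))"
        by (rule nonneg[OF bcontfun_mult[OF f(1) bcontfun_diff[OF bcontfun_const u(1)]]]) (simp add: f(2) u(3))
      ultimately show ?thesis by (simp flip: ennreal_plus)
    qed
    then show ?thesis unfolding a_def b_def s_def by (subst suminf_add) auto
  qed
  have b: "om (E - U) \<le> b n" for n
    unfolding b_def
  proof (rule om_le)
    show "covers (\<lambda>i x. f i x * (1 - u n x)) (E - U)"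
      unfolding covers_def
    proof (intro conjI allI ballI)
      show "(\<lambda>x. f i x * (1 - u n x)) \<in> bcontfun" for i
        by (rule bcontfun_mult[OF f(1) bcontfun_diff[OF bcontfun_const u(1)]])
      show "0 \<le> f i x * (1 - u n x)" for i x using f(2) u(3) by simp
      show "1 \<le> (\<Sum>i. ennreal (f i x * (1 - u n x)))" if "x \<in> E - U" for x
        using f(3)[of x] u(5)[of x] that by simp
    qed
  qed
  have a: "om (E \<inter> U) \<le> (SUP n. a n)"
  proof -
    have "om (E \<inter> U) \<le> (\<Sum>n. \<Sum>i. ennreal (\<Lambda> (\<lambda>x. f i x * d n x)))"
    proof (rule covers_pair)
      fix x assume x: "x \<in> E \<inter> U"
      have "(\<Sum>n. ennreal (d n x)) = 1"
        unfolding d_def by (rule suminf_telescope) (use x u in auto)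
      then have "(\<Sum>i. ennreal (f i x)) = (\<Sum>i. ennreal (f i x)) * (\<Sum>n. ennreal (d n x))" by simp
      also have "\<dots> = (\<Sum>n. \<Sum>i. ennreal (f i x * d n x))"
        using f d by (simp add: ennreal_mult ennreal_suminf_multc flip: ennreal_suminf_cmult)
      finally show "1 \<le> (\<Sum>n. \<Sum>i. ennreal (f i x * d n x))" using f(3)[of x] x by simp
    qed (simp_all add: bcontfun_mult f(1,2) d)
    also have "\<dots> = (SUP N. \<Sum>n<N. \<Sum>i. ennreal (\<Lambda> (\<lambda>x. f i x * d n x)))"
      by (rule suminf_eq_SUP)
    also have "\<dots> \<le> (SUP n. a n)"
    proof (rule SUP_least)
      fix N
      have "(\<Sum>n<N. \<Sum>i. ennreal (\<Lambda> (\<lambda>x. f i x * d n x))) \<le> (\<Sum>n<Suc N. \<Sum>i. ennreal (\<Lambda> (\<lambda>x. f i x * d n x)))"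
        by (intro sum_mono2) auto
      also have "\<dots> = (\<Sum>i. \<Sum>n<Suc N. ennreal (\<Lambda> (\<lambda>x. f i x * d n x)))"
        by (rule suminf_sum[symmetric]) auto
      also have "\<dots> = a N"
        unfolding a_def
      proof (intro suminf_cong)
        fix i
        have nn: "0 \<le> \<Lambda> (\<lambda>x. f i x * d n x)" for n
          by (rule nonneg[OF bcontfun_mult[OF f(1) d(1)]]) (simp add: f(2) d(2))
        have "(\<Sum>n<Suc N. ennreal (\<Lambda> (\<lambda>x. f i x * d n x))) = ennreal (\<Sum>n<Suc N. \<Lambda> (\<lambda>x. f i x * d n x))"
          by (rule sum_ennreal) (rule nn)
        also have "(\<Sum>n<Suc N. \<Lambda> (\<lambda>x. f i x * d n x)) = \<Lambda> (\<lambda>x. \<Sum>n<Suc N. f i x * d n x)"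
          by (rule sum[symmetric]) (rule bcontfun_mult[OF f(1) d(1)])
        also have "(\<lambda>x. \<Sum>n<Suc N. f i x * d n x) = (\<lambda>x. f i x * u N x)"
          unfolding ds[symmetric] sum_distrib_left ..
        finally show "(\<Sum>n<Suc N. ennreal (\<Lambda> (\<lambda>x. f i x * d n x))) = ennreal (\<Lambda> (\<lambda>x. f i x * u N x))" .
      qed
      also have "\<dots> \<le> (SUP n. a n)" by (rule SUP_upper) simp
      finally show "(\<Sum>n<N. \<Sum>i. ennreal (\<Lambda> (\<lambda>x. f i x * d n x))) \<le> (SUP n. a n)" .
    qed
    finally show ?thesis .
  qed
  have "om (E \<inter> U) + om (E - U) \<le> (SUP n. a n) + om (E - U)" using a by (rule add_right_mono)
  also have "\<dots> = (SUP n. a n + om (E - U))" by (rule ennreal_SUP_add_left[symmetric]) simp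
  also have "\<dots> \<le> s"
  proof (rule SUP_least)
    fix n
    have "a n + om (E - U) \<le> a n + b n" by (intro add_left_mono b)
    then show "a n + om (E - U) \<le> s" by (simp add: ab)
  qed
  finally show "om (E \<inter> U) + om (E - U) \<le> (\<Sum>i. ennreal (\<Lambda> (f i)))" by (simp add: s_def)
qed

text \<open>Dini's theorem on a large ball together with tightness outside of it.\<close>

lemma om_UNIV: "om UNIV = 1"
proof (rule antisym[OF om_le_1])
  show "1 \<le> om UNIV"
    unfolding om_def[of UNIV]
  proof (rule INF_greatest)
    fix f assume "f \<in> {f. covers f UNIV}"
    then have f: "\<And>i. f i \<in> bcontfun" "\<And>i x. 0 \<le> f i x" "\<And>x. 1 \<le> (\<Sum>i. ennreal (f i x))"
      by (auto simp: covers_def)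
    have "ennreal (1 - 2 * e) \<le> (\<Sum>i. ennreal (\<Lambda> (f i)))" if e: "0 < e" "e < 1" for e
    proof -
      obtain h r where h: "h \<in> bcontfun" "\<And>x. 0 \<le> h x" "\<And>x. r < norm x \<Longrightarrow> 1 \<le> h x" "\<Lambda> h \<le> e"
        using tight[OF e(1)] by blast
      define U where "U n = {x. 1 - e < (\<Sum>i<n. f i x)}" for n
      have cov: "cball 0 r \<subseteq> (\<Union>n\<in>UNIV. U n)"
      proof
        fix x :: 'b
        have "ennreal (1 - e) < 1" using e by (simp add: ennreal_less_one_iff)
        also have "1 \<le> (\<Sum>i. ennreal (f i x))" by (rule f(3))
        finally have "ennreal (1 - e) < (\<Sum>i. ennreal (f i x))" .
        then obtain n where "ennreal (1 - e) < (\<Sum>i<n. ennreal (f i x))"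
          unfolding suminf_eq_SUP less_SUP_iff by auto
        then have "x \<in> U n" using f(2) e by (simp add: U_def ennreal_less_iff sum_ennreal)
        then show "x \<in> (\<Union>n\<in>UNIV. U n)" by blast
      qed
      have op: "open (U n)" for n
        unfolding U_def by (intro open_Collect_less continuous_intros bcontfun_continuous f(1))
      obtain I where I: "finite I" "cball 0 r \<subseteq> (\<Union>n\<in>I. U n)"
        by (rule compactE_image[OF compact_cball op cov]) (rule that)
      define N where "N = Max (insert 0 I)"
      have sub: "U n \<subseteq> U N" if "n \<in> I" for n
      proof -
        have "n \<le> N" using that I by (simp add: N_def)
        then have "(\<Sum>i<n. f i x) \<le> (\<Sum>i<N. f i x)" for x
          using f(2) by (intro sum_mono2) auto
        then show ?thesis unfolding U_def by (auto intro: less_le_trans)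
      qed
      \<comment> \<open>Inside the ball the finite sum exceeds \<open>1 - e\<close>, outside of it
        \<open>h\<close> is at least 1. The loss \<open>2 * e\<close> consists of this threshold and
        the value of \<open>h\<close>.\<close>
      have "\<Lambda> (\<lambda>x. 1 - e) \<le> \<Lambda> (\<lambda>x. (\<Sum>i<N. f i x) + h x)"
      proof (rule mono)
        fix x
        have s: "0 \<le> (\<Sum>i<N. f i x)" using f by (auto intro: sum_nonneg)
        show "1 - e \<le> (\<Sum>i<N. f i x) + h x"
        proof (cases "r < norm x")
          case True then show ?thesis using h(3)[of x] s e by auto
        next
          case False
          then have "x \<in> cball 0 r" by auto
          then have "x \<in> U N" using I sub by blast
          then show ?thesis using h(2)[of x] by (auto simp: U_def)
        qed
      qed (simp_all add: bcontfun_const bcontfun_add bcontfun_sum f(1) h(1))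
      also have "\<dots> = (\<Sum>i<N. \<Lambda> (f i)) + \<Lambda> h"
        by (simp add: add sum bcontfun_sum f(1) h(1))
      also have "\<Lambda> (\<lambda>x. 1 - e) = 1 - e"
        using scale[OF bcontfun_const, of "1 - e" 1] by (simp add: one)
      finally have "1 - 2 * e \<le> (\<Sum>i<N. \<Lambda> (f i))" using h by simp
      then have "ennreal (1 - 2 * e) \<le> ennreal (\<Sum>i<N. \<Lambda> (f i))" by (rule ennreal_leI)
      also have "\<dots> = (\<Sum>i<N. ennreal (\<Lambda> (f i)))"
        by (intro sum_ennreal[symmetric] nonneg[OF f(1) f(2)])
      also have "\<dots> \<le> (\<Sum>i. ennreal (\<Lambda> (f i)))" by (rule sum_le_suminf) auto
      finally show ?thesis .
    qed
    from this[of "1 / real (n+2)" for n] have *: "ennreal (1 - 2 / real (n+2)) \<le> (\<Sum>i. ennreal (\<Lambda> (f i)))" for n :: nat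
      by simp
    have "(\<lambda>n. ennreal (1 - 2 / real (n+2))) \<longlonglongrightarrow> ennreal (1 - 0)"
      by (intro tendsto_ennrealI tendsto_diff tendsto_const LIMSEQ_ignore_initial_segment[OF lim_const_over_n])
    then show "1 \<le> (\<Sum>i. ennreal (\<Lambda> (f i)))"
      using * by (intro LIMSEQ_le_const2[of _ 1]) auto
  qed
qed

text \<open>Open sets are Caratheodory measurable, so \<open>om\<close> restricts to a Borel
  measure, of total mass 1 by \<open>om_UNIV\<close>. For \<open>f\<close> with values in [0, 1],
  cutting into \<open>N\<close> layers compares the integral with \<Lambda> from one side; the
  one-sided bound for \<open>1 - f\<close> reverses it.\<close>

theorem represented_by_measure:
  obtains \<rho> :: "'b measure" where "prob_borel \<rho>" "\<And>f. f \<in> bcontfun \<Longrightarrow> \<Lambda> f = (\<integral>x. f x \<partial>\<rho>)"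
proof -
  interpret P: sigma_algebra "UNIV :: 'b set" "Pow UNIV" by (rule sigma_algebra_Pow)
  let ?LS = "lambda_system UNIV (Pow UNIV) om"
  have ms: "measure_space UNIV ?LS om"
    by (rule P.caratheodory_lemma[OF om_outer])
  then have sig: "sigma_algebra UNIV ?LS" by (simp add: measure_space_def)
  have op: "U \<in> ?LS" if "open U" for U
    unfolding P.lambda_system_eq
  proof safe
    fix E :: "'b set"
    have "om (E \<inter> U \<union> (E - U)) \<le> om (E \<inter> U) + om (E - U)"
    proof -
      have "subadditive (Pow UNIV) om"
        using om_outer P.countably_subadditive_subadditive by (auto simp: outer_measure_space_def)
      then show ?thesis by (rule subadditiveD) auto
    qed
    moreover have "E \<inter> U \<union> (E - U) = E" by auto
    ultimately show "om (E \<inter> U) + om (E - U) = om E"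
      using open_in_lambda_system[OF that, of E] by simp
  qed auto
  have "sets (borel :: 'b measure) = sigma_sets UNIV {S. open S}"
    unfolding borel_def by (rule sets_measure_of) simp
  also have "\<dots> \<subseteq> ?LS"
    by (rule sigma_algebra.sigma_sets_subset[OF sig]) (use op in blast)
  finally have ms': "measure_space UNIV (sets (borel :: 'b measure)) om"
    using sets.sigma_algebra_axioms[of "borel :: 'b measure"] by (intro measure_down[OF ms]) auto
  define \<rho> where "\<rho> = measure_of UNIV (sets (borel :: 'b measure)) om"
  have sets: "sets \<rho> = sets borel"
    unfolding \<rho>_def using sets.sigma_sets_eq[of "borel :: 'b measure"] by (simp add: sets_measure_of)
  have em: "emeasure \<rho> A = om A" if "A \<in> sets borel" for A
    unfolding \<rho>_def using ms' that sets.sigma_algebra_axioms[of "borel :: 'b measure"]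
    by (intro emeasure_measure_of_sigma) (auto simp: measure_space_def)
  have sp: "space \<rho> = UNIV" using sets sets_eq_imp_space_eq[of \<rho> borel] by simp
  have "prob_space \<rho>" by (rule prob_spaceI) (simp add: sp em om_UNIV)
  then have pb: "prob_borel \<rho>" by (simp add: prob_borel_def sets)
  interpret prob_space \<rho> by fact
  have le: "(\<integral>x. f x \<partial>\<rho>) \<le> \<Lambda> f" if f: "f \<in> bcontfun" "\<And>x. 0 \<le> f x" "\<And>x. f x \<le> 1" for f
  proof -
    have *: "(\<integral>x. f x \<partial>\<rho>) \<le> \<Lambda> f + 1 / real N" if "N > 0" for N
    proof -
      \<comment> \<open>The slice \<open>c j\<close> equals 1 on the superlevel set
        \<open>A j\<close>, so this single function covers it. The slices of
        \<open>real N * f x - 1\<close> in turn lie below the indicators of the \<open>A j\<close>,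
        which costs the error \<open>1 / real N\<close>.\<close>
      define c where "c j x = min 1 (max 0 (real N * f x - real j))" for j x
      have cb: "c j \<in> bcontfun" for j
      proof (rule bcontfunI)
        show "continuous_on UNIV (c j)"
          unfolding c_def using f(1) by (intro continuous_intros bcontfun_continuous)
        show "\<bar>c j x\<bar> \<le> 1" for x by (auto simp: c_def)
      qed
      define A where "A j = {x. real N * f x \<ge> real j + 1}" for j
      have Am: "A j \<in> sets borel" for j
        unfolding A_def using bcontfun_measurable[OF f(1)] by measurable
      have A: "measure \<rho> (A j) \<le> \<Lambda> (c j)" for j
      proof -
        have "emeasure \<rho> (A j) \<le> ennreal (\<Lambda> (c j))"
          unfolding em[OF Am] by (rule om_single[OF cb]) (auto simp: c_def A_def)
        moreover have "0 \<le> \<Lambda> (c j)" by (rule nonneg[OF cb]) (simp add: c_def)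
        ultimately show ?thesis by (simp add: emeasure_eq_measure)
      qed
      have "real N * f x \<le> 1 + (\<Sum>j<N. indicator (A j) x)" for x
      proof -
        have "real N * f x - 1 \<le> (\<Sum>j<N. indicator (A j) x)"
        proof (cases "real N * f x \<ge> 1")
          case True
          have "real N * f x - 1 = (\<Sum>j<N. min 1 (max 0 ((real N * f x - 1) - real j)))"
            using True mult_left_le[of "f x" "real N"] f(3)[of x] by (subst sum_clamp) (auto simp: min_def)
          also have "\<dots> \<le> (\<Sum>j<N. indicator (A j) x)"
            by (intro sum_mono) (auto simp: A_def indicator_def)
          finally show ?thesis .
        next
          case False
          have "0 \<le> (\<Sum>j<N. indicator (A j) x :: real)" by (simp add: sum_nonneg)
          with False show ?thesis by linarith
        qed
        then show ?thesis by simp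
      qed
      then have "(\<integral>x. real N * f x \<partial>\<rho>) \<le> (\<integral>x. 1 + (\<Sum>j<N. indicator (A j) x) \<partial>\<rho>)"
        using Am sets integrable_bcontfun[OF pb f(1)]
        by (intro integral_mono) (auto intro!: Bochner_Integration.integrable_add Bochner_Integration.integrable_sum simp: emeasure_eq_measure)
      also have "\<dots> = 1 + (\<Sum>j<N. measure \<rho> (A j))"
        using Am sets by (subst Bochner_Integration.integral_add) (auto simp: emeasure_eq_measure prob_space)
      also have "\<dots> \<le> 1 + (\<Sum>j<N. \<Lambda> (c j))" by (intro add_left_mono sum_mono A)
      also have "(\<Sum>j<N. \<Lambda> (c j)) = \<Lambda> (\<lambda>x. \<Sum>j<N. c j x)"
        by (rule sum[symmetric]) (rule cb)
      also have "(\<lambda>x. \<Sum>j<N. c j x) = (\<lambda>x. real N * f x)"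
      proof
        fix x
        have "real N * f x \<le> real N" using f(3)[of x] by (simp add: mult_left_le)
        then show "(\<Sum>j<N. c j x) = real N * f x"
          unfolding c_def using f(2)[of x] by (subst sum_clamp) (auto simp: min_def)
      qed
      also have "\<Lambda> (\<lambda>x. real N * f x) = real N * \<Lambda> f" by (rule scale[OF f(1)])
      finally have "real N * (\<integral>x. f x \<partial>\<rho>) \<le> 1 + real N * \<Lambda> f" by simp
      then show ?thesis using that by (simp add: field_simps)
    qed
    have "(\<integral>x. f x \<partial>\<rho>) \<le> \<Lambda> f + 0"
    proof (rule LIMSEQ_le_const)
      show "(\<lambda>n. \<Lambda> f + 1 / real n) \<longlonglongrightarrow> \<Lambda> f + 0" by (intro tendsto_intros lim_1_over_n)
      show "\<exists>N. \<forall>n\<ge>N. integral\<^sup>L \<rho> f \<le> \<Lambda> f + 1 / real n" using * by (intro exI[of _ 1]) auto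
    qed
    then show ?thesis by simp
  qed
  have eq01: "(\<integral>x. f x \<partial>\<rho>) = \<Lambda> f" if f: "f \<in> bcontfun" "\<And>x. 0 \<le> f x" "\<And>x. f x \<le> 1" for f
  proof (rule antisym[OF le[OF f]])
    have "(\<integral>x. 1 - f x \<partial>\<rho>) \<le> \<Lambda> (\<lambda>x. 1 - f x)"
      using f by (intro le bcontfun_diff bcontfun_const) auto
    moreover have "(\<integral>x. 1 - f x \<partial>\<rho>) = 1 - (\<integral>x. f x \<partial>\<rho>)"
      using integrable_bcontfun[OF pb f(1)] by (simp add: prob_space)
    moreover have "\<Lambda> (\<lambda>x. 1 - f x) = 1 - \<Lambda> f" using f by (simp add: diff bcontfun_const one)
    ultimately show "\<Lambda> f \<le> (\<integral>x. f x \<partial>\<rho>)" by simp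
  qed
  have "\<Lambda> f = (\<integral>x. f x \<partial>\<rho>)" if f: "f \<in> bcontfun" for f
  proof -
    obtain B where B: "B > 0" "\<And>x. \<bar>f x\<bar> \<le> B" using bcontfun_bound[OF f] by blast
    define g where "g x = 1/2 + (1 / (2 * B)) * f x" for x
    have g: "g \<in> bcontfun" unfolding g_def using f by (intro bcontfun_add bcontfun_cmult bcontfun_const)
    have fB: "-B \<le> f x" "f x \<le> B" for x using B(2)[of x] by auto
    have "(\<integral>x. g x \<partial>\<rho>) = \<Lambda> g"
    proof (rule eq01[OF g])
      fix x
      have "-1/2 \<le> 1 / (2 * B) * f x" "1 / (2 * B) * f x \<le> 1/2"
        using fB[of x] B(1) by (simp_all add: field_simps)
      then show "0 \<le> g x" "g x \<le> 1" by (simp_all add: g_def)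
    qed
    moreover have "(\<integral>x. g x \<partial>\<rho>) = 1/2 + (1 / (2 * B)) * (\<integral>x. f x \<partial>\<rho>)"
      unfolding g_def using integrable_bcontfun[OF pb f] by (simp add: prob_space)
    moreover have "\<Lambda> g = 1/2 + (1 / (2 * B)) * \<Lambda> f"
      unfolding g_def using f scale[OF bcontfun_const, of "1/2" 1]
      by (simp add: add bcontfun_const bcontfun_cmult scale one del: times_divide_eq_left)
    ultimately show ?thesis using B(1) by simp
  qed
  with pb show ?thesis by (rule that)
qed

end


text \<open>Prokhorov's theorem in filter form: integration against the $R_i$ gives points in a
  product of compact intervals, and a cluster point there is a tight functional.\<close>

theorem tight_cluster_measure:
  fixes R :: "'i \<Rightarrow> 'b::euclidean_space measure"
  assumes F: "F \<noteq> bot" and R: "\<And>i. prob_borel (R i)"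
    and tight: "\<And>e. e > 0 \<Longrightarrow> \<exists>r. \<forall>\<^sub>F i in F. measure (R i) {x. r < norm x} \<le> e"
  obtains G \<rho> where "G \<noteq> bot" "G \<le> F" "prob_borel \<rho>" "narrow_lim R \<rho> G"
proof -
  \<comment> \<open>Coordinates range over all functions, so that the product is the ordinary
    function space; those outside \<open>bcontfun\<close> get the trivial coordinate 0.\<close>
  define \<Phi> where "\<Phi> i f = (if f \<in> bcontfun then \<integral>x. f x \<partial>R i else 0)" for i and f :: "'b \<Rightarrow> real"
  define b where "b f = (if f \<in> bcontfun then SOME B. \<forall>x. \<bar>f x\<bar> \<le> B else 0)" for f :: "'b \<Rightarrow> real"
  define K where "K = (\<Pi>\<^sub>E f\<in>(UNIV :: ('b \<Rightarrow> real) set). cball (0::real) (b f))"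
  have b: "\<bar>f x\<bar> \<le> b f" if f: "f \<in> bcontfun" for f x
  proof -
    obtain B where "\<And>x. \<bar>f x\<bar> \<le> B" by (rule bcontfun_bound[OF f]) (rule that)
    then have "\<forall>x. \<bar>f x\<bar> \<le> B" by blast
    then have "\<forall>x. \<bar>f x\<bar> \<le> (SOME B. \<forall>x. \<bar>f x\<bar> \<le> B)" by (rule someI)
    then show ?thesis using that by (simp add: b_def)
  qed
  have "\<Phi> i f \<in> cball 0 (b f)" for i f
    using abs_integral_le[OF R[of i] bcontfun_measurable b, of f] by (simp add: \<Phi>_def b_def)
  then have \<Phi>K: "\<Phi> i \<in> K" for i by (simp add: K_def PiE_def)
  have "compactin (product_topology (\<lambda>_. euclidean) UNIV) K"
    unfolding K_def by (simp add: compactin_PiE)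
  then have "compact K" by (simp add: euclidean_product_topology)
  moreover have "filtermap \<Phi> F \<noteq> bot" using F by (simp add: filtermap_bot_iff)
  moreover have "eventually (\<lambda>y. y \<in> K) (filtermap \<Phi> F)" by (simp add: eventually_filtermap \<Phi>K)
  ultimately obtain \<Lambda> where \<Lambda>: "inf (nhds \<Lambda>) (filtermap \<Phi> F) \<noteq> bot"
    unfolding compact_filter by blast
  \<comment> \<open>The refinement of \<open>F\<close> along which \<Phi> converges to the cluster
    point. It is proper because each neighbourhood of that point is visited frequently.\<close>
  define G where "G = inf F (filtercomap \<Phi> (nhds \<Lambda>))"
  have G: "G \<noteq> bot"
  proof
    assume "G = bot"
    then have "eventually (\<lambda>_. False) (inf F (filtercomap \<Phi> (nhds \<Lambda>)))" by (simp add: G_def)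
    then obtain P Q where PQ: "eventually P F" "eventually Q (nhds \<Lambda>)" "\<And>i. P i \<Longrightarrow> Q (\<Phi> i) \<Longrightarrow> False"
      unfolding eventually_inf eventually_filtercomap by blast
    have "eventually (\<lambda>i. \<not> Q (\<Phi> i)) F" using PQ(1) by eventually_elim (use PQ(3) in blast)
    then have "eventually (\<lambda>y. \<not> Q y) (filtermap \<Phi> F)" by (simp add: eventually_filtermap)
    with PQ(2) have "eventually (\<lambda>_. False) (inf (nhds \<Lambda>) (filtermap \<Phi> F))"
      unfolding eventually_inf by blast
    with \<Lambda> show False by (simp add: trivial_limit_def)
  qed
  have "G \<le> filtercomap \<Phi> (nhds \<Lambda>)" by (simp add: G_def)
  then have "filterlim \<Phi> (nhds \<Lambda>) G" by (simp add: filterlim_iff_le_filtercomap)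
  then have lim\<Phi>: "((\<lambda>i. \<Phi> i f) \<longlongrightarrow> \<Lambda> f) G" for f
    using continuous_on_tendsto_compose[OF continuous_on_product_coordinates[of f]] by simp
  have lim: "((\<lambda>i. \<integral>x. f x \<partial>R i) \<longlongrightarrow> \<Lambda> f) G" if "f \<in> bcontfun" for f
    using lim\<Phi>[of f] that by (simp add: \<Phi>_def)
  have GF: "G \<le> F" by (simp add: G_def)
  interpret tight_functional \<Lambda>
  proof
    fix f g :: "'b \<Rightarrow> real" assume fg: "f \<in> bcontfun" "g \<in> bcontfun"
    have "((\<lambda>i. \<integral>x. f x + g x \<partial>R i) \<longlongrightarrow> \<Lambda> f + \<Lambda> g) G"
      using tendsto_add[OF lim[OF fg(1)] lim[OF fg(2)]] integrable_bcontfun[OF R] fg by simp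
    then show "\<Lambda> (\<lambda>x. f x + g x) = \<Lambda> f + \<Lambda> g"
      by (rule tendsto_unique[OF G lim[OF bcontfun_add[OF fg]]])
  next
    fix c and f :: "'b \<Rightarrow> real" assume f: "f \<in> bcontfun"
    have "((\<lambda>i. \<integral>x. c * f x \<partial>R i) \<longlongrightarrow> c * \<Lambda> f) G"
      using tendsto_mult_left[OF lim[OF f], of c] by simp
    then show "\<Lambda> (\<lambda>x. c * f x) = c * \<Lambda> f"
      by (rule tendsto_unique[OF G lim[OF bcontfun_cmult[OF f]]])
  next
    fix f :: "'b \<Rightarrow> real" assume f: "f \<in> bcontfun" "\<And>x. 0 \<le> f x"
    show "0 \<le> \<Lambda> f"
      by (rule tendsto_lowerbound[OF lim[OF f(1)] _ G]) (simp add: f(2))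
  next
    have "(\<integral>x. 1 \<partial>R i) = (1::real)" for i
      using prob_borelD(1)[OF R[of i]] by (simp add: prob_space.prob_space)
    then have "((\<lambda>i. \<integral>x. (1::real) \<partial>R i) \<longlongrightarrow> 1) G" by simp
    then show "\<Lambda> (\<lambda>_. 1) = 1"
      by (rule tendsto_unique[OF G lim[OF bcontfun_const]])
  next
    fix e :: real assume "e > 0"
    then obtain r where r: "\<forall>\<^sub>F i in F. measure (R i) {x. r < norm x} \<le> e" using tight by blast
    \<comment> \<open>Zero on the ball of radius \<open>r\<close> and 1 beyond \<open>r + 1\<close>,
      hence the radius \<open>r + 1\<close> in the witness; its integral is at most the mass beyond
      \<open>r\<close>.\<close>
    define f where "f x = min 1 (max 0 (norm x - r))" for x :: 'b
    have f: "f \<in> bcontfun"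
    proof (rule bcontfunI)
      show "continuous_on UNIV f" unfolding f_def by (intro continuous_intros)
      show "\<bar>f x\<bar> \<le> 1" for x by (auto simp: f_def)
    qed
    have ev: "\<forall>\<^sub>F i in G. (\<integral>x. f x \<partial>R i) \<le> e"
      using filter_leD[OF GF r]
    proof eventually_elim
      case (elim i)
      interpret prob_space "R i" using prob_borelD(1)[OF R] .
      have s: "{x. r < norm x} \<in> sets (R i)" unfolding prob_borelD(2)[OF R] by measurable
      have "(\<integral>x. f x \<partial>R i) \<le> (\<integral>x. indicator {x. r < norm x} x \<partial>R i)"
      proof (rule integral_mono[OF integrable_bcontfun[OF R f]])
        show "integrable (R i) (indicat_real {x. r < norm x})"
          using s by (simp add: emeasure_eq_measure)
        show "f x \<le> indicat_real {x. r < norm x} x" for x by (auto simp: f_def indicator_def)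
      qed
      with elim s show ?case by simp
    qed
    have "\<Lambda> f \<le> e" by (rule tendsto_upperbound[OF lim[OF f] ev G])
    then show "\<exists>f r. f \<in> bcontfun \<and> (\<forall>x. 0 \<le> f x) \<and> (\<forall>x. r < norm x \<longrightarrow> 1 \<le> f x) \<and> \<Lambda> f \<le> e"
      using f by (intro exI[of _ f] exI[of _ "r + 1"]) (auto simp: f_def)
  qed
  obtain \<rho> where \<rho>: "prob_borel \<rho>" "\<And>f. f \<in> bcontfun \<Longrightarrow> \<Lambda> f = (\<integral>x. f x \<partial>\<rho>)"
    by (rule represented_by_measure) (rule that)
  have "narrow_lim R \<rho> G" unfolding narrow_lim_def using lim \<rho>(2) by simp
  with G GF \<rho>(1) show ?thesis by (rule that)
qed

section \<open>Relative entropy with respect to a measure with kernel\<close>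

text \<open>For a measurable kernel this is the measure of \<open>ref_meas\<close>, written
  monadically so that iterated integration applies.\<close>

definition kernel_prod :: "'a::euclidean_space measure \<Rightarrow> ('a \<Rightarrow> 'a measure) \<Rightarrow> ('a \<times> 'a) measure" where
  "kernel_prod \<mu> K = \<mu> \<bind> (\<lambda>x. distr (K x) borel (Pair x))"

lemma measurable_Pair_kernel:
  fixes K :: "'a::euclidean_space \<Rightarrow> 'a measure"
  assumes [measurable]: "K \<in> borel \<rightarrow>\<^sub>M subprob_algebra borel"
  shows "(\<lambda>x. distr (K x) borel (Pair x)) \<in> borel \<rightarrow>\<^sub>M subprob_algebra (borel :: ('a \<times> 'a) measure)"
  by (rule measurable_distr2[where M = borel]) (auto simp: borel_prod)

lemma kernel_sets: "K \<in> borel \<rightarrow>\<^sub>M subprob_algebra borel \<Longrightarrow> sets (K x) = sets borel"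
  using subprob_measurableD(2)[of K borel borel x] by simp

lemma nn_integral_kernel_prod:
  fixes f :: "'a::euclidean_space \<times> 'a \<Rightarrow> ennreal"
  assumes mu: "prob_borel \<mu>" and K: "K \<in> borel \<rightarrow>\<^sub>M subprob_algebra borel"
    and f: "f \<in> borel_measurable borel"
  shows "(\<integral>\<^sup>+p. f p \<partial>kernel_prod \<mu> K) = (\<integral>\<^sup>+x. \<integral>\<^sup>+y. f (x, y) \<partial>K x \<partial>\<mu>)"
proof -
  have K': "(\<lambda>x. distr (K x) borel (Pair x)) \<in> \<mu> \<rightarrow>\<^sub>M subprob_algebra (borel :: ('a \<times> 'a) measure)"
    using measurable_Pair_kernel[OF K] prob_borelD(2)[OF mu] by (simp add: measurable_cong_sets[of \<mu> borel])
  have "(\<integral>\<^sup>+p. f p \<partial>kernel_prod \<mu> K) = (\<integral>\<^sup>+x. \<integral>\<^sup>+p. f p \<partial>distr (K x) borel (Pair x) \<partial>\<mu>)"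
    unfolding kernel_prod_def by (rule nn_integral_bind[OF f K'])
  also have "\<dots> = (\<integral>\<^sup>+x. \<integral>\<^sup>+y. f (x, y) \<partial>K x \<partial>\<mu>)"
  proof (rule nn_integral_cong, rule nn_integral_distr)
    show "Pair x \<in> K x \<rightarrow>\<^sub>M borel" for x
      unfolding measurable_cong_sets[OF kernel_sets[OF K] refl] by (auto simp flip: borel_prod)
  qed (use f in simp)
  finally show ?thesis .
qed

lemma sets_kernel_prod:
  assumes mu: "prob_borel \<mu>"
  shows "sets (kernel_prod \<mu> K) = sets borel"
  unfolding kernel_prod_def by (rule sets_bind) (auto simp: prob_borelD[OF mu])

lemma emeasure_kernel_prod:
  fixes \<mu> :: "'a::euclidean_space measure"
  assumes mu: "prob_borel \<mu>" and K: "K \<in> borel \<rightarrow>\<^sub>M subprob_algebra borel" and A: "A \<in> sets borel"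
  shows "emeasure (kernel_prod \<mu> K) A = (\<integral>\<^sup>+x. emeasure (K x) (Pair x -` A) \<partial>\<mu>)"
proof -
  have "emeasure (kernel_prod \<mu> K) A = (\<integral>\<^sup>+p. indicator A p \<partial>kernel_prod \<mu> K)"
    using A by (simp add: sets_kernel_prod[OF mu])
  also have "\<dots> = (\<integral>\<^sup>+x. \<integral>\<^sup>+y. indicator A (x, y) \<partial>K x \<partial>\<mu>)"
    by (rule nn_integral_kernel_prod[OF mu K]) (use A in auto)
  also have "\<dots> = (\<integral>\<^sup>+x. emeasure (K x) (Pair x -` A) \<partial>\<mu>)"
  proof (rule nn_integral_cong)
    fix x
    have "Pair x -` A \<in> sets (K x)"
      unfolding kernel_sets[OF K] using A measurable_sets[of "Pair x" borel "borel :: ('a \<times> 'a) measure" A]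
      by (auto simp flip: borel_prod)
    then have "(\<integral>\<^sup>+y. indicator (Pair x -` A) y \<partial>K x) = emeasure (K x) (Pair x -` A)" by simp
    then show "(\<integral>\<^sup>+y. indicator A (x, y) \<partial>K x) = emeasure (K x) (Pair x -` A)"
      by (simp add: indicator_def)
  qed
  finally show ?thesis .
qed

text \<open>\<open>measure_of\<close> reads its set function only on the sigma-algebra, and there
  the two formulas agree.\<close>

lemma ref_meas_eq_kernel_prod:
  assumes mu: "prob_borel \<mu>" and K: "L k \<in> borel \<rightarrow>\<^sub>M subprob_algebra borel"
  shows "ref_meas \<mu> L k = kernel_prod \<mu> (L k)"
proof -
  have sp: "space (kernel_prod \<mu> (L k)) = UNIV"
    using sets_eq_imp_space_eq[OF sets_kernel_prod[OF mu]] by simp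
  have "kernel_prod \<mu> (L k) = measure_of UNIV (sets borel) (emeasure (kernel_prod \<mu> (L k)))"
    using measure_of_of_measure[of "kernel_prod \<mu> (L k)"] sp sets_kernel_prod[OF mu, of "L k"] by simp
  also have "\<dots> = ref_meas \<mu> L k"
    unfolding ref_meas_def
  proof (rule measure_of_eq)
    fix A :: "('a \<times> 'a) set" assume "A \<in> sigma_sets UNIV (sets borel)"
    then have "A \<in> sets borel" using sets.sigma_sets_eq[of "borel :: ('a \<times> 'a) measure"] by simp
    then show "emeasure (kernel_prod \<mu> (L k)) A = (\<integral>\<^sup>+ x. emeasure (L k x) (Pair x -` A) \<partial>\<mu>)"
      by (rule emeasure_kernel_prod[OF mu K])
  qed auto
  finally show ?thesis by simp
qed

lemma prob_borel_kernel_prod: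
  assumes mu: "prob_borel \<mu>" and K: "K \<in> borel \<rightarrow>\<^sub>M subprob_algebra borel"
    and P: "\<And>x. prob_borel (K x)"
  shows "prob_borel (kernel_prod \<mu> K)"
proof -
  have sp: "space (kernel_prod \<mu> K) = UNIV"
    using sets_eq_imp_space_eq[OF sets_kernel_prod[OF mu]] by simp
  have "emeasure (K x) UNIV = 1" for x
    using prob_space.emeasure_space_1[OF prob_borelD(1)[OF P[of x]]] prob_borelD(3)[OF P[of x]] by simp
  moreover have "emeasure \<mu> UNIV = 1"
    using prob_space.emeasure_space_1[OF prob_borelD(1)[OF mu]] prob_borelD(3)[OF mu] by simp
  ultimately have "prob_space (kernel_prod \<mu> K)"
    by (intro prob_spaceI) (simp add: sp emeasure_kernel_prod[OF mu K] prob_borelD(3)[OF mu])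
  then show ?thesis by (simp add: prob_borel_def sets_kernel_prod[OF mu])
qed

lemma measurable_integral_kernel:
  fixes F :: "'a::euclidean_space \<times> 'a \<Rightarrow> real"
  assumes K: "K \<in> borel \<rightarrow>\<^sub>M subprob_algebra borel" and P: "\<And>x. prob_borel (K x)"
    and F: "F \<in> borel_measurable borel" "\<And>p. 0 \<le> F p" "\<And>p. F p \<le> B"
  shows "(\<lambda>x. \<integral>y. F (x, y) \<partial>K x) \<in> borel_measurable borel"
proof -
  have Fx: "(\<lambda>y. F (x, y)) \<in> borel_measurable borel" for x
    using F(1) by (simp flip: borel_prod)
  have "(\<lambda>x. \<integral>\<^sup>+y. ennreal (F (x, y)) \<partial>K x) \<in> borel_measurable borel"
  proof (rule nn_integral_measurable_subprob_algebra2[OF _ K])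
    show "(\<lambda>(x, y). ennreal (F (x, y))) \<in> borel_measurable (borel \<Otimes>\<^sub>M borel)"
      using F(1) by (simp add: borel_prod split_def)
  qed
  moreover have "(\<integral>y. F (x, y) \<partial>K x) = enn2real (\<integral>\<^sup>+y. ennreal (F (x, y)) \<partial>K x)" for x
    using F(2,3) Fx[of x] by (intro integral_eq_nn_integral) (auto simp: measurable_cong_sets[OF kernel_sets[OF K]])
  ultimately show ?thesis by (subst measurable_cong) auto
qed

text \<open>Fenchel-Young inequality for the conjugate pair \<open>t * ln t - t\<close> and
  \<open>exp\<close>, that is, \<open>1 + s \<le> exp s\<close> at \<open>s = b - ln t\<close>. At
  \<open>t = 0\<close> the product \<open>t * ln t\<close> is 0. The variational bound, the lower
  bound of \<open>t * ln t\<close> and the later Jensen inequality all rest on it.\<close>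

lemma young_ln_exp:
  fixes t b :: real
  assumes "0 \<le> t"
  shows "t * b + t - exp b \<le> t * ln t"
proof (cases "t = 0")
  case False
  then have t: "t > 0" using assms by simp
  have "t * (1 + (b - ln t)) \<le> t * exp (b - ln t)"
    using t exp_ge_add_one_self[of "b - ln t"] by (intro mult_left_mono) auto
  also have "t * exp (b - ln t) = exp b" using t by (simp add: exp_diff)
  finally show ?thesis by (simp add: algebra_simps)
qed simp

lemma mult_ln_ge:
  fixes t :: real
  assumes "0 \<le> t"
  shows "- 1 \<le> t * ln t"
  using young_ln_exp[OF assms, of 0] assms by simp

text \<open>One half of the Gibbs (Donsker-Varadhan) principle: integrate the Fenchel-Young
  inequality with \<open>t\<close> the density of \<rho> and \<open>b = g x\<close>. The hypothesis
  on the exponential integral makes the leftover, 1 minus that integral, nonnegative.\<close>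

lemma rel_entropy_variational:
  assumes \<pi>: "prob_space \<pi>" and \<rho>: "prob_space \<rho>"
    and g: "g \<in> borel_measurable \<pi>" "\<And>x. \<bar>g x\<bar> \<le> B"
    and exp_le: "(\<integral>\<^sup>+x. ennreal (exp (g x)) \<partial>\<pi>) \<le> 1"
  shows "ereal (\<integral>x. g x \<partial>\<rho>) \<le> rel_entropy \<rho> \<pi>"
proof (cases "sets \<rho> = sets \<pi> \<and> absolutely_continuous \<pi> \<rho>")
  case False
  then have "rel_entropy \<rho> \<pi> = \<infinity>" unfolding rel_entropy_def by (rule if_not_P)
  then show ?thesis by simp
next
  case True
  interpret P: prob_space \<pi> by fact
  interpret R: prob_space \<rho> by fact
  have sets: "sets \<rho> = sets \<pi>" and ac: "absolutely_continuous \<pi> \<rho>" using True by auto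
  obtain D where D: "D \<in> borel_measurable \<pi>" "AE x in \<pi>. RN_deriv \<pi> \<rho> x = ennreal (D x)" "\<And>x. 0 \<le> D x"
    by (rule P.real_RN_deriv[OF R.finite_measure_axioms ac sets]) (rule that)
  define h where "h x = D x * ln (D x)" for x
  define Po where "Po = (\<integral>\<^sup>+x. ennreal (h x) \<partial>\<pi>)"
  define Ne where "Ne = (\<integral>\<^sup>+x. ennreal (- h x) \<partial>\<pi>)"
  have hm: "h \<in> borel_measurable \<pi>" unfolding h_def using D(1) by measurable
  have rn: "AE x in \<pi>. enn2real (RN_deriv \<pi> \<rho> x) = D x"
    using D(2) by eventually_elim (simp add: D(3))
  have "rel_entropy \<rho> \<pi> = enn2ereal (\<integral>\<^sup>+x. ennreal (enn2real (RN_deriv \<pi> \<rho> x) * ln (enn2real (RN_deriv \<pi> \<rho> x))) \<partial>\<pi>)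
      - enn2ereal (\<integral>\<^sup>+x. ennreal (- (enn2real (RN_deriv \<pi> \<rho> x) * ln (enn2real (RN_deriv \<pi> \<rho> x)))) \<partial>\<pi>)"
    unfolding rel_entropy_def Let_def using True by (rule if_P)
  also have "(\<integral>\<^sup>+x. ennreal (enn2real (RN_deriv \<pi> \<rho> x) * ln (enn2real (RN_deriv \<pi> \<rho> x))) \<partial>\<pi>) = Po"
    unfolding Po_def h_def by (rule nn_integral_cong_AE) (use rn in eventually_elim, simp)
  also have "(\<integral>\<^sup>+x. ennreal (- (enn2real (RN_deriv \<pi> \<rho> x) * ln (enn2real (RN_deriv \<pi> \<rho> x)))) \<partial>\<pi>) = Ne"
    unfolding Ne_def h_def by (rule nn_integral_cong_AE) (use rn in eventually_elim, simp)
  finally have re: "rel_entropy \<rho> \<pi> = enn2ereal Po - enn2ereal Ne" .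
  \<comment> \<open>A finite negative part means that the difference defining the entropy is never
    infinity minus infinity; if the positive part is infinite, the entropy is infinite and the claim
    is immediate.\<close>
  have "Ne \<le> (\<integral>\<^sup>+x. 1 \<partial>\<pi>)"
    unfolding Ne_def
  proof (rule nn_integral_mono)
    fix x
    have "ennreal (- h x) \<le> ennreal 1"
      using mult_ln_ge[OF D(3), of x] unfolding h_def by (intro ennreal_leI) simp
    then show "ennreal (- h x) \<le> 1" by simp
  qed
  then have Ne1: "Ne \<le> 1" by (simp add: P.emeasure_space_1)
  then obtain n where n: "Ne = ennreal n" "0 \<le> n" by (cases Ne) (auto simp: top_unique)
  show ?thesis
  proof (cases Po)
    case top
    then show ?thesis unfolding re n by simp
  next
    case (real p)
    have ih: "integrable \<pi> h"
      using real n hm unfolding Po_def Ne_def by (intro real_integrable_def[THEN iffD2]) auto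
    have re': "rel_entropy \<rho> \<pi> = ereal (\<integral>x. h x \<partial>\<pi>)"
      unfolding re real_lebesgue_integral_def[OF ih] using real n by (simp flip: Po_def Ne_def)
    have dens: "density \<pi> (\<lambda>x. ennreal (D x)) = \<rho>"
    proof -
      have "density \<pi> (\<lambda>x. ennreal (D x)) = density \<pi> (RN_deriv \<pi> \<rho>)"
        using D by (intro density_cong) auto
      then show ?thesis using P.density_RN_deriv[OF ac sets] by simp
    qed
    have AE0: "AE x in \<pi>. 0 \<le> D x" by (simp add: D(3))
    have gR: "g \<in> borel_measurable \<rho>" using g(1) sets by (simp add: measurable_cong_sets[OF sets refl])
    have ig: "integrable \<rho> g" using g gR by (intro R.integrable_const_bound[of _ B]) auto
    have iDg: "integrable \<pi> (\<lambda>x. D x * g x)" "(\<integral>x. D x * g x \<partial>\<pi>) = (\<integral>x. g x \<partial>\<rho>)"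
      using ig integrable_real_density[OF D(1) AE0 g(1)] integral_real_density[OF D(1) AE0 g(1)]
      by (simp_all add: dens)
    have iD: "integrable \<pi> D" "(\<integral>x. D x \<partial>\<pi>) = 1"
      using integrable_real_density[OF D(1) AE0 borel_measurable_const, of 1]
        integral_real_density[OF D(1) AE0 borel_measurable_const, of 1]
      by (simp_all add: dens R.prob_space)
    have ie: "integrable \<pi> (\<lambda>x. exp (g x))"
    proof (rule integrableI_nonneg)
      show "(\<integral>\<^sup>+x. ennreal (exp (g x)) \<partial>\<pi>) < \<infinity>" using exp_le by (simp add: le_less_trans)
    qed (use g in auto)
    have ie1: "(\<integral>x. exp (g x) \<partial>\<pi>) \<le> 1"
      using exp_le nn_integral_eq_integral[OF ie] by simp
    have "(\<integral>x. g x \<partial>\<rho>) \<le> (\<integral>x. D x * g x \<partial>\<pi>) + (\<integral>x. D x \<partial>\<pi>) - (\<integral>x. exp (g x) \<partial>\<pi>)"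
      using iDg(2) iD(2) ie1 by simp
    also have "\<dots> = (\<integral>x. D x * g x + D x - exp (g x) \<partial>\<pi>)"
      using iDg(1) iD(1) ie by simp
    also have "\<dots> \<le> (\<integral>x. h x \<partial>\<pi>)"
      using iDg(1) iD(1) ie ih young_ln_exp[OF D(3)] unfolding h_def
      by (intro integral_mono) auto
    finally show ?thesis by (simp add: re')
  qed
qed

text \<open>Discarding the negative part of the integrand leaves a nonnegative integral, into which
  any pointwise bound \<open>U\<close> may be inserted without integrability conditions.\<close>

lemma rel_entropy_density_le:
  assumes \<pi>: "prob_space \<pi>" and D: "D \<in> borel_measurable \<pi>" "\<And>x. 0 \<le> D x"
    and prob: "prob_space (density \<pi> (\<lambda>x. ennreal (D x)))"
    and U: "\<And>x. D x * ln (D x) \<le> U x"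
  shows "rel_entropy (density \<pi> (\<lambda>x. ennreal (D x))) \<pi> \<le> enn2ereal (\<integral>\<^sup>+x. ennreal (U x) \<partial>\<pi>)"
proof -
  interpret P: prob_space \<pi> by fact
  let ?\<rho> = "density \<pi> (\<lambda>x. ennreal (D x))"
  have ac: "absolutely_continuous \<pi> ?\<rho>" using D by (intro absolutely_continuousI_density) auto
  have "AE x in \<pi>. ennreal (D x) = RN_deriv \<pi> ?\<rho> x"
    using D by (intro P.RN_deriv_unique) auto
  then have rn: "AE x in \<pi>. enn2real (RN_deriv \<pi> ?\<rho> x) = D x"
    by eventually_elim (metis D(2) enn2real_ennreal)
  let ?g = "\<lambda>x. enn2real (RN_deriv \<pi> ?\<rho> x) * ln (enn2real (RN_deriv \<pi> ?\<rho> x))"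
  have "rel_entropy ?\<rho> \<pi> = enn2ereal (\<integral>\<^sup>+x. ennreal (?g x) \<partial>\<pi>) - enn2ereal (\<integral>\<^sup>+x. ennreal (- ?g x) \<partial>\<pi>)"
    unfolding rel_entropy_def Let_def using ac by simp
  also have "\<dots> \<le> enn2ereal (\<integral>\<^sup>+x. ennreal (?g x) \<partial>\<pi>) - 0"
    by (intro ereal_minus_mono) auto
  also have "\<dots> = enn2ereal (\<integral>\<^sup>+x. ennreal (?g x) \<partial>\<pi>)" by simp
  also have "\<dots> \<le> enn2ereal (\<integral>\<^sup>+x. ennreal (U x) \<partial>\<pi>)"
    unfolding less_eq_ennreal.rep_eq[symmetric]
    by (intro nn_integral_mono_AE) (use rn in eventually_elim, auto intro!: ennreal_leI U)
  finally show ?thesis .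
qed

text \<open>The normalised exponential of $k F$ with respect to each $K_x$ has $\pi$-integral one, so
  the variational inequality applies without disintegrating $\rho$.\<close>

lemma rel_entropy_kernel_variational:
  fixes F :: "'a::euclidean_space \<times> 'a \<Rightarrow> real"
  assumes mu: "prob_borel \<mu>" and K: "K \<in> borel \<rightarrow>\<^sub>M subprob_algebra borel"
    and P: "\<And>x. prob_borel (K x)" and \<rho>: "prob_borel \<rho>" "first_marg \<rho> = \<mu>"
    and F: "F \<in> borel_measurable borel" "\<And>p. \<bar>F p\<bar> \<le> B"
  shows "ereal ((\<integral>p. F p \<partial>\<rho>) - (\<integral>x. ln (\<integral>y. exp (F (x, y)) \<partial>K x) \<partial>\<mu>)) \<le> rel_entropy \<rho> (kernel_prod \<mu> K)"
proof -
  define \<pi> where "\<pi> = kernel_prod \<mu> K"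
  have \<pi>: "prob_borel \<pi>" unfolding \<pi>_def by (rule prob_borel_kernel_prod[OF mu K P])
  have Fx: "(\<lambda>y. F (x, y)) \<in> borel_measurable borel" for x
    using F(1) by (simp flip: borel_prod)
  define Z where "Z x = (\<integral>y. exp (F (x, y)) \<partial>K x)" for x
  have Fb: "-B \<le> F p" "F p \<le> B" for p using F(2)[of p] by auto
  have ie: "integrable (K x) (\<lambda>y. exp (F (x, y)))" for x
    using Fx[of x] Fb by (intro integrable_bounded_measurable[OF P, of _ "exp B"]) auto
  have ec: "(\<integral>y. c \<partial>K x) = c" "integrable (K x) (\<lambda>y. c)" for x and c :: real
  proof -
    interpret prob_space "K x" using prob_borelD(1)[OF P] .
    show "(\<integral>y. c \<partial>K x) = c" "integrable (K x) (\<lambda>y. c)" by (simp_all add: prob_space)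
  qed
  \<comment> \<open>These bounds keep \<open>ln (Z x)\<close> bounded, so the normalised function
    \<open>g\<close> below is a legitimate bounded test function.\<close>
  have Zb: "exp (-B) \<le> Z x" "Z x \<le> exp B" for x
  proof -
    have "(\<integral>y. exp (-B) \<partial>K x) \<le> Z x"
      unfolding Z_def using Fb by (intro integral_mono ie ec) auto
    then show "exp (-B) \<le> Z x" by (simp only: ec)
    have "Z x \<le> (\<integral>y. exp B \<partial>K x)"
      unfolding Z_def using Fb by (intro integral_mono ie ec) auto
    then show "Z x \<le> exp B" by (simp only: ec)
  qed
  have Z0: "0 < Z x" for x using Zb(1)[of x] exp_gt_zero[of "-B"] by linarith
  have Zm: "Z \<in> borel_measurable borel"
    unfolding Z_def using F(1) Fb by (intro measurable_integral_kernel[OF K P, of "\<lambda>p. exp (F p)" "exp B"]) auto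
  have lnZ: "\<bar>ln (Z x)\<bar> \<le> B" for x
    using Zb[of x] Z0[of x] by (auto simp: abs_le_iff ln_le_cancel_iff[of _ "exp B", symmetric] ln_le_cancel_iff[of "exp (-B)", symmetric] simp del: ln_le_cancel_iff)
  define g where "g p = F p - ln (Z (fst p))" for p
  have gm: "g \<in> borel_measurable borel"
    unfolding g_def using F(1) Zm by (simp flip: borel_prod)
  have gb: "\<bar>g p\<bar> \<le> 2 * B" for p using F(2)[of p] lnZ[of "fst p"] by (simp add: g_def)
  have "(\<integral>\<^sup>+p. ennreal (exp (g p)) \<partial>\<pi>) = (\<integral>\<^sup>+x. \<integral>\<^sup>+y. ennreal (exp (g (x, y))) \<partial>K x \<partial>\<mu>)"
    unfolding \<pi>_def using gm by (intro nn_integral_kernel_prod[OF mu K]) auto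
  also have "\<dots> = (\<integral>\<^sup>+x. 1 \<partial>\<mu>)"
  proof (rule nn_integral_cong)
    fix x
    have eq: "exp (g (x, y)) = exp (F (x, y)) / Z x" for y
      using Z0[of x] by (simp add: g_def exp_diff)
    have "(\<integral>\<^sup>+y. ennreal (exp (g (x, y))) \<partial>K x) = ennreal (\<integral>y. exp (F (x, y)) / Z x \<partial>K x)"
      unfolding eq using Z0[of x] ie[of x] by (intro nn_integral_eq_integral) auto
    also have "\<dots> = 1" using Z0[of x] by (simp flip: Z_def)
    finally show "(\<integral>\<^sup>+y. ennreal (exp (g (x, y))) \<partial>K x) = 1" .
  qed
  also have "\<dots> = 1" using prob_space.emeasure_space_1[OF prob_borelD(1)[OF mu]] by simp
  finally have eg: "(\<integral>\<^sup>+p. ennreal (exp (g p)) \<partial>\<pi>) \<le> 1" by simp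
  have "ereal (\<integral>p. g p \<partial>\<rho>) \<le> rel_entropy \<rho> \<pi>"
    using gm prob_borelD(2)[OF \<pi>]
    by (intro rel_entropy_variational[OF prob_borelD(1)[OF \<pi>] prob_borelD(1)[OF \<rho>(1)] _ gb eg])
      (simp add: measurable_cong_sets[of \<pi> borel])
  \<comment> \<open>The normalisation depends on \<open>x\<close> only, so the prescribed first
    marginal turns its \<rho>-integral into a \<mu>-integral.\<close>
  moreover have "(\<integral>p. g p \<partial>\<rho>) = (\<integral>p. F p \<partial>\<rho>) - (\<integral>x. ln (Z x) \<partial>\<mu>)"
  proof -
    have m1: "(\<lambda>p. ln (Z (fst p))) \<in> borel_measurable (borel :: ('a \<times> 'a) measure)"
      using Zm by (simp flip: borel_prod)
    have i1: "integrable \<rho> (\<lambda>p. ln (Z (fst p)))"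
      by (rule integrable_bounded_measurable[OF \<rho>(1) m1, of B]) (rule lnZ)
    have i2: "integrable \<rho> F" by (rule integrable_bounded_measurable[OF \<rho>(1) F])
    have "(\<integral>x. ln (Z x) \<partial>\<mu>) = (\<integral>x. ln (Z x) \<partial>distr \<rho> borel fst)"
      using \<rho>(2) by (simp add: first_marg_def)
    also have "\<dots> = (\<integral>p. ln (Z (fst p)) \<partial>\<rho>)"
    proof (rule integral_distr)
      show "fst \<in> \<rho> \<rightarrow>\<^sub>M borel"
        unfolding measurable_cong_sets[OF prob_borelD(2)[OF \<rho>(1)] refl] by (simp flip: borel_prod)
    qed (use Zm in simp)
    finally show ?thesis unfolding g_def using i1 i2 by simp
  qed
  ultimately show ?thesis by (simp add: \<pi>_def Z_def)
qed

section \<open>Admissible test functions\<close>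

lemma measurable_fst_borel:
  fixes \<rho> :: "('a::euclidean_space \<times> 'a) measure"
  assumes "prob_borel \<rho>"
  shows "fst \<in> \<rho> \<rightarrow>\<^sub>M borel" "snd \<in> \<rho> \<rightarrow>\<^sub>M borel"
  unfolding measurable_cong_sets[OF prob_borelD(2)[OF assms] refl] by (simp_all flip: borel_prod)

lemma integral_first_marg:
  fixes f :: "'a::euclidean_space \<Rightarrow> real"
  assumes "prob_borel \<rho>" "f \<in> borel_measurable borel"
  shows "(\<integral>x. f x \<partial>first_marg \<rho>) = (\<integral>p. f (fst p) \<partial>\<rho>)"
  unfolding first_marg_def using assms by (intro integral_distr measurable_fst_borel) auto

lemma integral_second_marg:
  fixes f :: "'a::euclidean_space \<Rightarrow> real"
  assumes "prob_borel \<rho>" "f \<in> borel_measurable borel"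
  shows "(\<integral>x. f x \<partial>second_marg \<rho>) = (\<integral>p. f (snd p) \<partial>\<rho>)"
  unfolding second_marg_def using assms by (intro integral_distr measurable_fst_borel) auto

lemma prob_borel_marg:
  assumes "prob_borel \<rho>"
  shows "prob_borel (first_marg \<rho>)" "prob_borel (second_marg \<rho>)"
  using prob_space.prob_space_distr[OF prob_borelD(1)[OF assms] measurable_fst_borel(1)[OF assms]]
    prob_space.prob_space_distr[OF prob_borelD(1)[OF assms] measurable_fst_borel(2)[OF assms]]
  by (auto simp: prob_borel_def first_marg_def second_marg_def)

lemma bcontfun_compose:
  fixes f :: "'b::topological_space \<Rightarrow> real" and h :: "'c::topological_space \<Rightarrow> 'b"
  assumes "f \<in> bcontfun" "continuous_on UNIV h"
  shows "(\<lambda>x. f (h x)) \<in> bcontfun"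
proof -
  obtain B where "\<And>x. \<bar>f x\<bar> \<le> B" by (rule bcontfun_bound[OF assms(1)]) (rule that)
  moreover have "continuous_on UNIV (\<lambda>x. f (h x))"
    by (rule continuous_on_compose2[OF bcontfun_continuous[OF assms(1)] assms(2)]) simp
  ultimately show ?thesis by (intro bcontfunI[of _ B]) auto
qed

lemma narrow_lim_marg:
  assumes "narrow_lim R \<rho> G" "\<And>i. prob_borel (R i)" "prob_borel \<rho>"
  shows "narrow_lim (\<lambda>i. first_marg (R i)) (first_marg \<rho>) G"
    "narrow_lim (\<lambda>i. second_marg (R i)) (second_marg \<rho>) G"
  using assms unfolding narrow_lim_def
  by (simp_all add: integral_first_marg integral_second_marg bcontfun_measurable
      bcontfun_compose continuous_on_fst continuous_on_snd)

lemma narrow_lim_unique: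
  fixes \<rho> :: "'b::metric_space measure"
  assumes "G \<noteq> bot" "narrow_lim R \<rho> G" "narrow_lim R \<sigma> G" "prob_borel \<rho>" "prob_borel \<sigma>"
  shows "\<rho> = \<sigma>"
  using assms tendsto_unique[OF assms(1)] unfolding narrow_lim_def
  by (intro prob_borel_eqI) blast+

lemma narrow_lim_const: "narrow_lim (\<lambda>_. \<rho>) \<rho> G"
  by (simp add: narrow_lim_def)

text \<open>Regularity of \<mu>: a compact \<open>K\<close> inside \<open>E\<close> loses at most
  half of \<epsilon>, and a continuous function above the indicator of \<open>K\<close> gains at
  most the other half.\<close>

lemma indicator_approx_continuous:
  fixes \<mu> :: "'a::euclidean_space measure"
  assumes mu: "prob_borel \<mu>" and E: "E \<in> sets borel" and "(\<epsilon>::real) > 0"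
  obtains u :: "'a \<Rightarrow> real" where "u \<in> bcontfun" "\<And>x. 0 \<le> u x" "\<And>x. u x \<le> 1"
    "(\<integral>x. \<bar>indicator E x - u x\<bar> \<partial>\<mu>) \<le> \<epsilon>"
proof -
  interpret prob_space \<mu> using prob_borelD(1)[OF mu] .
  note s = prob_borelD(2)[OF mu]
  obtain K where K: "K \<subseteq> E" "compact K" "measure \<mu> E - \<epsilon>/2 \<le> measure \<mu> K"
  proof (cases "measure \<mu> E \<le> \<epsilon>/2")
    case True
    \<comment> \<open>A separate case because \<open>ennreal\<close> truncates
      \<open>measure \<mu> E - \<epsilon>/2\<close> at 0 here, and
      \<open>0 < emeasure \<mu> E\<close> can fail.\<close>
    then show ?thesis by (intro that[of "{}"]) auto
  next
    case False
    have "ennreal (measure \<mu> E - \<epsilon>/2) < emeasure \<mu> E"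
      using False \<open>\<epsilon> > 0\<close> by (simp add: emeasure_eq_measure ennreal_less_iff)
    also have "emeasure \<mu> E = (SUP K\<in>{K. K \<subseteq> E \<and> compact K}. emeasure \<mu> K)"
      by (rule inner_regular[OF s _ E]) simp
    finally obtain K where "K \<subseteq> E" "compact K" "ennreal (measure \<mu> E - \<epsilon>/2) < emeasure \<mu> K"
      unfolding less_SUP_iff by auto
    moreover from this have "measure \<mu> E - \<epsilon>/2 < measure \<mu> K"
      using False by (simp add: emeasure_eq_measure ennreal_less_iff)
    ultimately show ?thesis by (intro that) auto
  qed
  have cK: "closed K" using K(2) by (rule compact_imp_closed)
  then have Ks: "K \<in> sets borel" by simp
  obtain g :: "nat \<Rightarrow> 'a \<Rightarrow> real" where g: "\<And>n. continuous_on UNIV (g n)" "\<And>n x. 0 \<le> g n x" "\<And>n x. g n x \<le> 1"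
    "\<And>n x. g (Suc n) x \<le> g n x" "\<And>n x. x \<in> K \<Longrightarrow> g n x = 1" "\<And>x. (\<lambda>n. g n x) \<longlonglongrightarrow> indicator K x"
    by (rule closed_indicator_approx[OF cK]) (rule that)
  have gb: "g n \<in> bcontfun" for n using g(1,2,3)[of n] by (intro bcontfunI[of _ 1]) auto
  have "(\<lambda>n. \<integral>x. g n x \<partial>\<mu>) \<longlonglongrightarrow> measure \<mu> K"
    by (rule measure_closed_LIMSEQ[OF mu cK g(1) g(2) g(3) g(6)])
  then have "\<forall>\<^sub>F n in sequentially. (\<integral>x. g n x \<partial>\<mu>) < measure \<mu> K + \<epsilon>/2"
    using \<open>\<epsilon> > 0\<close> by (intro order_tendstoD) auto
  from eventually_happens'[OF sequentially_bot this]
  obtain n where n: "(\<integral>x. g n x \<partial>\<mu>) < measure \<mu> K + \<epsilon>/2" by blast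
  have ig: "integrable \<mu> (g n)" by (rule integrable_bcontfun[OF mu gb])
  have iE: "integrable \<mu> (indicat_real E)" "(\<integral>x. indicat_real E x \<partial>\<mu>) = measure \<mu> E"
    using E s by (auto simp: emeasure_eq_measure)
  have iK: "integrable \<mu> (indicat_real K)" "(\<integral>x. indicat_real K x \<partial>\<mu>) = measure \<mu> K"
    using Ks s by (auto simp: emeasure_eq_measure)
  have "(\<integral>x. \<bar>indicator E x - g n x\<bar> \<partial>\<mu>) \<le> (\<integral>x. (indicat_real E x - indicat_real K x) + (g n x - indicat_real K x) \<partial>\<mu>)"
  proof (rule integral_mono)
    show "\<bar>indicator E x - g n x\<bar> \<le> (indicat_real E x - indicat_real K x) + (g n x - indicat_real K x)" for x
      using g(2)[of n x] g(3)[of n x] g(5)[of x n] K(1) by (auto simp: indicator_def)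
  qed (use ig iE iK in auto)
  also have "\<dots> = (measure \<mu> E - measure \<mu> K) + ((\<integral>x. g n x \<partial>\<mu>) - measure \<mu> K)"
    using ig iE iK by simp
  also have "\<dots> \<le> \<epsilon>" using n K(3) by simp
  finally show ?thesis using gb g(2,3) by (intro that)
qed

text \<open>Narrow convergence alone does not pass to integrands discontinuous in \<open>x\<close>.
  Here the error of a continuous approximation is dominated by a function of the first coordinate,
  whose integral is the same for all measures with first marginal \<mu>.\<close>

definition marginally_approximable :: "'a::euclidean_space measure \<Rightarrow> ('a \<times> 'a \<Rightarrow> real) \<Rightarrow> bool" where
  "marginally_approximable \<mu> g \<longleftrightarrow> g \<in> borel_measurable borel \<and> (\<exists>B. \<forall>p. \<bar>g p\<bar> \<le> B) \<and>
     (\<forall>\<epsilon>>0. \<exists>g' e C. g' \<in> bcontfun \<and> e \<in> borel_measurable borel \<and> (\<forall>x. \<bar>e x\<bar> \<le> C)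
        \<and> (\<forall>p. \<bar>g p - g' p\<bar> \<le> e (fst p)) \<and> (\<integral>x. e x \<partial>\<mu>) \<le> \<epsilon>)"

lemma marginally_approximable_atom:
  fixes \<mu> :: "'a::euclidean_space measure"
  assumes mu: "prob_borel \<mu>" and E: "E \<in> sets borel" and "0 \<le> t"
    and \<phi>: "\<phi> \<in> bcontfun" "\<And>y. 0 \<le> \<phi> y" "\<And>y. \<phi> y \<le> 1"
  shows "marginally_approximable \<mu> (\<lambda>p. t * indicator E (fst p) * \<phi> (snd p))"
  unfolding marginally_approximable_def
proof (intro conjI allI impI)
  have [measurable]: "\<phi> \<in> borel_measurable borel" by (rule bcontfun_measurable[OF \<phi>(1)])
  have [measurable]: "E \<in> sets borel" by (rule E)
  show "(\<lambda>p. t * indicator E (fst p) * \<phi> (snd p)) \<in> borel_measurable borel"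
    unfolding borel_prod[symmetric] by measurable
  show "\<exists>B. \<forall>p. \<bar>t * indicator E (fst p) * \<phi> (snd p)\<bar> \<le> B"
    using \<phi>(2,3) \<open>0 \<le> t\<close> by (intro exI[of _ t] allI) (auto simp: abs_mult indicator_def mult_left_le)
  fix \<epsilon> :: real assume "\<epsilon> > 0"
  \<comment> \<open>The \<open>+ 1\<close> keeps the tolerance positive for
    \<open>t = 0\<close>.\<close>
  have "\<epsilon> / (t + 1) > 0" using \<open>\<epsilon> > 0\<close> \<open>0 \<le> t\<close> by simp
  then obtain u where u: "u \<in> bcontfun" "\<And>x. 0 \<le> u x" "\<And>x. u x \<le> 1"
    "(\<integral>x. \<bar>indicator E x - u x\<bar> \<partial>\<mu>) \<le> \<epsilon> / (t + 1)"
    by (rule indicator_approx_continuous[OF mu E]) (rule that)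
  have [measurable]: "u \<in> borel_measurable borel" by (rule bcontfun_measurable[OF u(1)])
  show "\<exists>g' e C. g' \<in> bcontfun \<and> e \<in> borel_measurable borel \<and> (\<forall>x. \<bar>e x\<bar> \<le> C)
        \<and> (\<forall>p. \<bar>t * indicator E (fst p) * \<phi> (snd p) - g' p\<bar> \<le> e (fst p)) \<and> (\<integral>x. e x \<partial>\<mu>) \<le> \<epsilon>"
  proof (intro exI conjI allI)
    show "(\<lambda>p. t * (u (fst p) * \<phi> (snd p))) \<in> bcontfun"
      by (intro bcontfun_cmult bcontfun_mult bcontfun_compose[OF u(1)] bcontfun_compose[OF \<phi>(1)]
          continuous_on_fst continuous_on_snd continuous_on_id)
    show "(\<lambda>x. t * \<bar>indicator E x - u x\<bar>) \<in> borel_measurable borel" by measurable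
    show "\<bar>t * \<bar>indicator E x - u x\<bar>\<bar> \<le> t" for x
      using u(2)[of x] u(3)[of x] \<open>0 \<le> t\<close> by (auto simp: abs_mult indicator_def mult_left_le)
    show "\<bar>t * indicator E (fst p) * \<phi> (snd p) - t * (u (fst p) * \<phi> (snd p))\<bar> \<le> t * \<bar>indicator E (fst p) - u (fst p)\<bar>" for p
    proof -
      have "t * indicator E (fst p) * \<phi> (snd p) - t * (u (fst p) * \<phi> (snd p)) = (t * (indicator E (fst p) - u (fst p))) * \<phi> (snd p)"
        by (simp add: algebra_simps)
      then have "\<bar>t * indicator E (fst p) * \<phi> (snd p) - t * (u (fst p) * \<phi> (snd p))\<bar> = (t * \<bar>indicator E (fst p) - u (fst p)\<bar>) * \<phi> (snd p)"
        using \<open>0 \<le> t\<close> \<phi>(2) by (simp add: abs_mult)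
      also have "\<dots> \<le> t * \<bar>indicator E (fst p) - u (fst p)\<bar>"
        using \<phi>(2,3) \<open>0 \<le> t\<close> by (intro mult_left_le) auto
      finally show ?thesis .
    qed
    have "(\<integral>x. t * \<bar>indicator E x - u x\<bar> \<partial>\<mu>) \<le> t * (\<epsilon> / (t + 1))"
      unfolding integral_mult_right_zero by (rule mult_left_mono[OF u(4) \<open>0 \<le> t\<close>])
    also have "\<dots> \<le> \<epsilon>" using \<open>0 \<le> t\<close> \<open>\<epsilon> > 0\<close> by (simp add: field_simps)
    finally show "(\<integral>x. t * \<bar>indicator E x - u x\<bar> \<partial>\<mu>) \<le> \<epsilon>" .
  qed
qed

lemma marginally_approximable_max:
  fixes \<mu> :: "'a::euclidean_space measure"
  assumes mu: "prob_borel \<mu>" and "marginally_approximable \<mu> g" "marginally_approximable \<mu> h"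
  shows "marginally_approximable \<mu> (\<lambda>p. max (g p) (h p))"
  unfolding marginally_approximable_def
proof (intro conjI allI impI)
  show "(\<lambda>p. max (g p) (h p)) \<in> borel_measurable borel"
    using assms unfolding marginally_approximable_def by (intro borel_measurable_max) auto
  obtain A B where A: "\<And>p. \<bar>g p\<bar> \<le> A" and B: "\<And>p. \<bar>h p\<bar> \<le> B"
    using assms unfolding marginally_approximable_def by blast
  have "\<bar>max (g p) (h p)\<bar> \<le> max A B" for p
    using A[of p] B[of p] by linarith
  then show "\<exists>B. \<forall>p. \<bar>max (g p) (h p)\<bar> \<le> B" by blast
  fix \<epsilon> :: real assume "\<epsilon> > 0"
  then have e2: "\<epsilon>/2 > 0" by simp
  obtain g' e C where g: "g' \<in> bcontfun" "e \<in> borel_measurable borel" "\<And>x. \<bar>e x\<bar> \<le> C"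
    "\<And>p. \<bar>g p - g' p\<bar> \<le> e (fst p)" "(\<integral>x. e x \<partial>\<mu>) \<le> \<epsilon>/2"
    using assms(2) e2 unfolding marginally_approximable_def by blast
  obtain h' e' C' where h: "h' \<in> bcontfun" "e' \<in> borel_measurable borel" "\<And>x. \<bar>e' x\<bar> \<le> C'"
    "\<And>p. \<bar>h p - h' p\<bar> \<le> e' (fst p)" "(\<integral>x. e' x \<partial>\<mu>) \<le> \<epsilon>/2"
    using assms(3) e2 unfolding marginally_approximable_def by blast
  show "\<exists>g' e C. g' \<in> bcontfun \<and> e \<in> borel_measurable borel \<and> (\<forall>x. \<bar>e x\<bar> \<le> C)
        \<and> (\<forall>p. \<bar>max (g p) (h p) - g' p\<bar> \<le> e (fst p)) \<and> (\<integral>x. e x \<partial>\<mu>) \<le> \<epsilon>"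
  proof (intro exI conjI allI)
    obtain A where A: "\<And>p. \<bar>g' p\<bar> \<le> A" by (rule bcontfun_bound[OF g(1)]) (rule that)
    obtain B where B: "\<And>p. \<bar>h' p\<bar> \<le> B" by (rule bcontfun_bound[OF h(1)]) (rule that)
    show "(\<lambda>p. max (g' p) (h' p)) \<in> bcontfun"
    proof (rule bcontfunI)
      show "continuous_on UNIV (\<lambda>p. max (g' p) (h' p))"
        by (intro continuous_on_max bcontfun_continuous g(1) h(1))
      show "\<bar>max (g' p) (h' p)\<bar> \<le> max A B" for p
        using A[of p] B[of p] by linarith
    qed
    show "(\<lambda>x. e x + e' x) \<in> borel_measurable borel" using g(2) h(2) by simp
    show "\<bar>e x + e' x\<bar> \<le> C + C'" for x using g(3)[of x] h(3)[of x] by linarith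
    show "\<bar>max (g p) (h p) - max (g' p) (h' p)\<bar> \<le> e (fst p) + e' (fst p)" for p
      using g(4)[of p] h(4)[of p] by linarith
    have "integrable \<mu> e" "integrable \<mu> e'"
      by (rule integrable_bounded_measurable[OF mu g(2) g(3)], rule integrable_bounded_measurable[OF mu h(2) h(3)])
    then show "(\<integral>x. e x + e' x \<partial>\<mu>) \<le> \<epsilon>" using g(5) h(5) by simp
  qed
qed

text \<open>The bounded continuous approximation converges along the filter; replacing it by
  \<open>g\<close> costs at most \<epsilon>/3 for every \<open>R i\<close> and for \<rho> alike,
  because they share the first marginal.\<close>

lemma narrow_lim_marginally_approximable:
  fixes \<mu> :: "'a::euclidean_space measure"
  assumes mu: "prob_borel \<mu>" and g: "marginally_approximable \<mu> g"
    and R: "\<And>i. prob_borel (R i)" "\<And>i. first_marg (R i) = \<mu>"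
    and \<rho>: "prob_borel \<rho>" "first_marg \<rho> = \<mu>" and lim: "narrow_lim R \<rho> G"
  shows "((\<lambda>i. \<integral>p. g p \<partial>R i) \<longlongrightarrow> (\<integral>p. g p \<partial>\<rho>)) G"
proof (rule tendstoI)
  fix \<epsilon> :: real assume "\<epsilon> > 0"
  then have e3: "\<epsilon>/3 > 0" by simp
  obtain B where gm: "g \<in> borel_measurable borel" and B: "\<And>p. \<bar>g p\<bar> \<le> B"
    using g unfolding marginally_approximable_def by blast
  obtain g' e C where g': "g' \<in> bcontfun" "e \<in> borel_measurable borel" "\<And>x. \<bar>e x\<bar> \<le> C"
    "\<And>p. \<bar>g p - g' p\<bar> \<le> e (fst p)" "(\<integral>x. e x \<partial>\<mu>) \<le> \<epsilon>/3"
    using g e3 unfolding marginally_approximable_def by blast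
  have close: "\<bar>(\<integral>p. g p \<partial>\<sigma>) - (\<integral>p. g' p \<partial>\<sigma>)\<bar> \<le> \<epsilon>/3" if \<sigma>: "prob_borel \<sigma>" "first_marg \<sigma> = \<mu>" for \<sigma>
  proof -
    have ig: "integrable \<sigma> g" by (rule integrable_bounded_measurable[OF \<sigma>(1) gm B])
    have ig': "integrable \<sigma> g'" by (rule integrable_bcontfun[OF \<sigma>(1) g'(1)])
    have em: "(\<lambda>p. e (fst p)) \<in> borel_measurable (borel :: ('a \<times> 'a) measure)"
      using g'(2) by (simp flip: borel_prod)
    have ie: "integrable \<sigma> (\<lambda>p. e (fst p))"
      by (rule integrable_bounded_measurable[OF \<sigma>(1) em]) (rule g'(3))
    have "\<bar>(\<integral>p. g p \<partial>\<sigma>) - (\<integral>p. g' p \<partial>\<sigma>)\<bar> = \<bar>\<integral>p. g p - g' p \<partial>\<sigma>\<bar>" using ig ig' by simp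
    also have "\<dots> \<le> (\<integral>p. \<bar>g p - g' p\<bar> \<partial>\<sigma>)" by (rule integral_abs_bound)
    also have "\<dots> \<le> (\<integral>p. e (fst p) \<partial>\<sigma>)"
      using ig ig' ie g'(4) by (intro integral_mono) auto
    also have "\<dots> = (\<integral>x. e x \<partial>\<mu>)" using integral_first_marg[OF \<sigma>(1) g'(2)] \<sigma>(2) by simp
    finally show ?thesis using g'(5) by simp
  qed
  have "((\<lambda>i. \<integral>p. g' p \<partial>R i) \<longlongrightarrow> (\<integral>p. g' p \<partial>\<rho>)) G" using lim g'(1) by (simp add: narrow_lim_def)
  from tendstoD[OF this e3] show "\<forall>\<^sub>F i in G. dist (\<integral>p. g p \<partial>R i) (\<integral>p. g p \<partial>\<rho>) < \<epsilon>"
  proof eventually_elim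
    case (elim i)
    then show ?case using close[OF R(1) R(2), of i] close[OF \<rho>] unfolding dist_real_def by linarith
  qed
qed

section \<open>Large deviation rates and admissible test functions\<close>

lemma eln_measurable [measurable]: "eln \<in> borel_measurable borel"
  unfolding eln_def[abs_def] by measurable

lemma eln_mono: "p \<le> q \<Longrightarrow> eln p \<le> eln q"
  by (auto simp: eln_def)

text \<open>The setting of both bounds, with the Feller property in the form of measurability of the
  kernels.\<close>

locale ldp_family =
  fixes \<mu> :: "'a::euclidean_space measure" and L :: "nat \<Rightarrow> 'a \<Rightarrow> 'a measure" and c :: "'a \<Rightarrow> 'a \<Rightarrow> ennreal"
  assumes mu: "prob_borel \<mu>" and laws: "\<And>k x. prob_borel (L k x)"
    and kernel: "\<And>k. L k \<in> borel \<rightarrow>\<^sub>M subprob_algebra borel"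
    and ldp: "\<And>x. k_ldp (\<lambda>k. L k x) (c x)"
begin

lemma measurable_law: "F \<in> sets borel \<Longrightarrow> (\<lambda>x. measure (L k x) F) \<in> borel_measurable borel"
  using measurable_compose[OF kernel measurable_measure_subprob_algebra] by simp

lemma ref_meas_eq: "ref_meas \<mu> L k = kernel_prod \<mu> (L k)"
  by (rule ref_meas_eq_kernel_prod[OF mu kernel])

text \<open>A substitute, Borel in \<open>x\<close>, for minus the infimum of \<open>c x\<close>
  over \<open>F\<close>; for closed \<open>F\<close> it is at most that quantity, by the large
  deviation upper bound.\<close>

definition upper_rate :: "'a set \<Rightarrow> 'a \<Rightarrow> ereal" where
  "upper_rate F x = limsup (\<lambda>k. ereal (1 / real k) * eln (measure (L k x) F))"

lemma upper_rate_measurable: "F \<in> sets borel \<Longrightarrow> upper_rate F \<in> borel_measurable borel"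
  unfolding upper_rate_def[abs_def] using measurable_law[of F]
  by (intro borel_measurable_limsup borel_measurable_ereal_times measurable_compose[OF _ eln_measurable]) auto

lemma upper_rate_mono:
  assumes "F \<subseteq> F'" "F' \<in> sets borel"
  shows "upper_rate F x \<le> upper_rate F' x"
  unfolding upper_rate_def
proof (intro Limsup_mono always_eventually allI ereal_mult_left_mono eln_mono)
  interpret prob_space "L k x" for k using prob_borelD(1)[OF laws] .
  show "measure (L k x) F \<le> measure (L k x) F'" for k
    using assms prob_borelD(2)[OF laws] by (intro finite_measure_mono) auto
qed simp

lemma upper_rate_le:
  assumes "closed F" "\<And>y. y \<in> F \<Longrightarrow> ennreal t \<le> c x y" "0 \<le> t"
  shows "upper_rate F x \<le> - ereal t"
proof -
  have "upper_rate F x \<le> - (INF y\<in>F. enn2ereal (c x y))"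
    using ldp[of x] assms(1) unfolding k_ldp_def upper_rate_def by blast
  also have "ereal t \<le> (INF y\<in>F. enn2ereal (c x y))"
  proof (rule INF_greatest)
    fix y assume "y \<in> F"
    then have "enn2ereal (ennreal t) \<le> enn2ereal (c x y)"
      using assms(2) by (simp flip: less_eq_ennreal.rep_eq)
    then show "ereal t \<le> enn2ereal (c x y)" using assms(3) by simp
  qed
  then have "- (INF y\<in>F. enn2ereal (c x y)) \<le> - ereal t" by (simp only: ereal_minus_le_minus)
  finally show ?thesis .
qed

text \<open>The scaled log-Laplace transforms have upper limit at most 0 at every \<open>x\<close>,
  written without logarithms. Nonnegativity and boundedness of \<open>g\<close> confine these
  transforms to a fixed bounded interval, which provides the domination when they are integrated
  over \<open>x\<close>.\<close>

definition admissible :: "('a \<times> 'a \<Rightarrow> real) \<Rightarrow> bool" where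
  "admissible g \<longleftrightarrow> g \<in> borel_measurable borel \<and> (\<forall>p. 0 \<le> g p) \<and> (\<exists>B. \<forall>p. g p \<le> B) \<and>
     (\<forall>x. \<forall>\<epsilon>>0. \<forall>\<^sub>F k in sequentially. (\<integral>y. exp (real k * g (x, y)) \<partial>L k x) \<le> exp (real k * \<epsilon>))"

lemma integrable_exp:
  assumes "g \<in> borel_measurable borel" "\<And>p. 0 \<le> g p" "\<And>p. g p \<le> B"
  shows "integrable (L k x) (\<lambda>y. exp (real k * g (x, y)))"
proof (rule integrable_bounded_measurable[OF laws])
  have "(\<lambda>y. g (x, y)) \<in> borel_measurable borel" using assms(1) by (simp flip: borel_prod)
  then show "(\<lambda>y. exp (real k * g (x, y))) \<in> borel_measurable borel" by simp
  show "\<bar>exp (real k * g (x, y))\<bar> \<le> exp (real k * B)" for y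
    using assms(3)[of "(x, y)"] by (simp add: mult_left_mono)
qed

lemma admissible_mono:
  assumes g: "admissible g" and h: "h \<in> borel_measurable borel" "\<And>p. 0 \<le> h p" "\<And>p. h p \<le> g p"
  shows "admissible h"
  unfolding admissible_def
proof (intro conjI allI impI)
  obtain B where gB: "g \<in> borel_measurable borel" "\<And>p. 0 \<le> g p" "\<And>p. g p \<le> B"
    using g unfolding admissible_def by blast
  have hB: "h p \<le> B" for p using h(3)[of p] gB(3)[of p] by simp
  then show "\<exists>B. \<forall>p. h p \<le> B" by blast
  fix x and \<epsilon> :: real assume "\<epsilon> > 0"
  then have "\<forall>\<^sub>F k in sequentially. (\<integral>y. exp (real k * g (x, y)) \<partial>L k x) \<le> exp (real k * \<epsilon>)"
    using g unfolding admissible_def by blast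
  then show "\<forall>\<^sub>F k in sequentially. (\<integral>y. exp (real k * h (x, y)) \<partial>L k x) \<le> exp (real k * \<epsilon>)"
  proof eventually_elim
    case (elim k)
    have "(\<integral>y. exp (real k * h (x, y)) \<partial>L k x) \<le> (\<integral>y. exp (real k * g (x, y)) \<partial>L k x)"
      using h(3) by (intro integral_mono integrable_exp[OF gB] integrable_exp[OF h(1,2) hB])
        (auto intro: mult_left_mono)
    with elim show ?case by simp
  qed
qed (use h in auto)

text \<open>A factor 2 is invisible at exponential scale: once
  \<open>1 \<le> real k * (\<epsilon>/2)\<close>, the number
  \<open>exp (real k * (\<epsilon>/2))\<close> is at least 2.\<close>

lemma eventually_two_exp:
  fixes \<epsilon> :: real
  assumes "\<epsilon> > 0"
  shows "\<forall>\<^sub>F k in sequentially. 2 * exp (real k * (\<epsilon>/2)) \<le> exp (real k * \<epsilon>)"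
proof -
  obtain N where N: "2 / \<epsilon> < real N" using reals_Archimedean2 by blast
  have "2 * exp (real k * (\<epsilon>/2)) \<le> exp (real k * \<epsilon>)" if "k \<ge> N" for k
  proof -
    have "2 / \<epsilon> \<le> real k" using N that by linarith
    then have "1 \<le> real k * (\<epsilon>/2)" using assms by (simp add: field_simps)
    then have "2 \<le> exp (real k * (\<epsilon>/2))" using exp_ge_add_one_self[of "real k * (\<epsilon>/2)"] by linarith
    then have "2 * exp (real k * (\<epsilon>/2)) \<le> exp (real k * (\<epsilon>/2)) * exp (real k * (\<epsilon>/2))"
      by (intro mult_right_mono) auto
    also have "\<dots> = exp (real k * \<epsilon>)" by (simp flip: exp_add)
    finally show ?thesis .
  qed
  then show ?thesis unfolding eventually_sequentially by blast
qed

text \<open>The exponential of a maximum is at most the sum of the exponentials, and the resulting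
  factor 2 is absorbed. Sums of admissible functions are in general not admissible, which is why
  suprema are later built from maxima.\<close>

lemma admissible_max:
  assumes g: "admissible g" and h: "admissible h"
  shows "admissible (\<lambda>p. max (g p) (h p))"
  unfolding admissible_def
proof (intro conjI allI impI)
  obtain B where gB: "g \<in> borel_measurable borel" "\<And>p. 0 \<le> g p" "\<And>p. g p \<le> B"
    using g unfolding admissible_def by blast
  obtain B' where hB: "h \<in> borel_measurable borel" "\<And>p. 0 \<le> h p" "\<And>p. h p \<le> B'"
    using h unfolding admissible_def by blast
  show m: "(\<lambda>p. max (g p) (h p)) \<in> borel_measurable borel" using gB(1) hB(1) by simp
  show nn: "0 \<le> max (g p) (h p)" for p using gB(2)[of p] by simp
  have b: "max (g p) (h p) \<le> max B B'" for p using gB(3)[of p] hB(3)[of p] by linarith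
  then show "\<exists>B. \<forall>p. max (g p) (h p) \<le> B" by blast
  fix x and \<epsilon> :: real assume "\<epsilon> > 0"
  then have e2: "\<epsilon>/2 > 0" by simp
  have "\<forall>\<^sub>F k in sequentially. (\<integral>y. exp (real k * g (x, y)) \<partial>L k x) \<le> exp (real k * (\<epsilon>/2))"
    using g e2 unfolding admissible_def by blast
  moreover have "\<forall>\<^sub>F k in sequentially. (\<integral>y. exp (real k * h (x, y)) \<partial>L k x) \<le> exp (real k * (\<epsilon>/2))"
    using h e2 unfolding admissible_def by blast
  ultimately show "\<forall>\<^sub>F k in sequentially. (\<integral>y. exp (real k * max (g (x, y)) (h (x, y))) \<partial>L k x) \<le> exp (real k * \<epsilon>)"
    using eventually_two_exp[OF \<open>\<epsilon> > 0\<close>]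
  proof eventually_elim
    case (elim k)
    have "(\<integral>y. exp (real k * max (g (x, y)) (h (x, y))) \<partial>L k x)
        \<le> (\<integral>y. exp (real k * g (x, y)) + exp (real k * h (x, y)) \<partial>L k x)"
    proof (intro integral_mono Bochner_Integration.integrable_add integrable_exp[OF gB] integrable_exp[OF hB])
      show "integrable (L k x) (\<lambda>y. exp (real k * max (g (x, y)) (h (x, y))))"
        by (rule integrable_exp[OF m nn b])
      show "exp (real k * max (g (x, y)) (h (x, y))) \<le> exp (real k * g (x, y)) + exp (real k * h (x, y))" for y
        by (auto simp: max_def)
    qed
    also have "\<dots> = (\<integral>y. exp (real k * g (x, y)) \<partial>L k x) + (\<integral>y. exp (real k * h (x, y)) \<partial>L k x)"
      by (intro Bochner_Integration.integral_add integrable_exp[OF gB] integrable_exp[OF hB])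
    finally show ?case using elim by linarith
  qed
qed

lemma admissible_zero: "admissible (\<lambda>_. 0)"
proof -
  have "(\<integral>y. 1 \<partial>L k x) = (1 :: real)" for k x
    using prob_space.prob_space[OF prob_borelD(1)[OF laws[of k x]]] by simp
  then show ?thesis unfolding admissible_def by auto
qed

text \<open>Where the rate condition fails the function vanishes and the integral is 1. Elsewhere
  the integral is at most 1 plus \<open>exp (real k * t)\<close> times the probability of
  \<open>F\<close>, which is eventually at most
  \<open>exp (- (real k * (t - \<epsilon>/2)))\<close>: the height \<open>t\<close> is what the rate
  pays for.\<close>

lemma admissible_atom:
  assumes F: "F \<in> sets borel" and t: "0 \<le> t"
  shows "admissible (\<lambda>p. t * indicator {x. upper_rate F x \<le> - ereal t} (fst p) * indicator F (snd p))"
    (is "admissible ?g")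
  unfolding admissible_def
proof (intro conjI allI impI)
  have [measurable]: "F \<in> sets borel" by fact
  have [measurable]: "upper_rate F \<in> borel_measurable borel" by (rule upper_rate_measurable[OF F])
  have [measurable]: "{x. upper_rate F x \<le> - ereal t} \<in> sets borel" by measurable
  show "?g \<in> borel_measurable borel"
    unfolding borel_prod[symmetric] by measurable
  show "0 \<le> ?g p" for p using t by simp
  show "\<exists>B. \<forall>p. ?g p \<le> B" using t by (intro exI[of _ t]) (auto simp: indicator_def)
  fix x and \<epsilon> :: real assume "\<epsilon> > 0"
  interpret P: prob_space "L k x" for k using prob_borelD(1)[OF laws] .
  show "\<forall>\<^sub>F k in sequentially. (\<integral>y. exp (real k * ?g (x, y)) \<partial>L k x) \<le> exp (real k * \<epsilon>)"
  proof (cases "upper_rate F x \<le> - ereal t")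
    case False
    then show ?thesis using \<open>\<epsilon> > 0\<close> by (simp add: P.prob_space)
  next
    case True
    also have "- ereal t < ereal (- (t - \<epsilon>/2))" using \<open>\<epsilon> > 0\<close> by simp
    finally have "\<forall>\<^sub>F k in sequentially. ereal (1 / real k) * eln (measure (L k x) F) < ereal (- (t - \<epsilon>/2))"
      unfolding upper_rate_def by (rule Limsup_lessD)
    then show ?thesis
      using eventually_two_exp[OF \<open>\<epsilon> > 0\<close>] eventually_gt_at_top[of 0]
    proof eventually_elim
      case (elim k)
      define p where "p = measure (L k x) F"
      have p: "p \<le> exp (- (real k * (t - \<epsilon>/2)))"
      proof (cases "p \<le> 0")
        case True then show ?thesis by (rule order_trans) simp
      next
        case False
        then have "ln p / real k < - (t - \<epsilon>/2)" using elim(1) by (simp add: eln_def p_def)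
        then have "ln p < - (real k * (t - \<epsilon>/2))" using elim(3) by (simp add: field_simps)
        then have "exp (ln p) < exp (- (real k * (t - \<epsilon>/2)))" by simp
        then show ?thesis using False by simp
      qed
      have "(\<integral>y. exp (real k * ?g (x, y)) \<partial>L k x) = (\<integral>y. 1 + (exp (real k * t) - 1) * indicator F y \<partial>L k x)"
        using True by (intro Bochner_Integration.integral_cong) (auto simp: indicator_def)
      also have "\<dots> = 1 + (exp (real k * t) - 1) * p"
        using F prob_borelD(2)[OF laws, of k x] by (simp add: P.prob_space p_def P.emeasure_eq_measure)
      also have "\<dots> \<le> 1 + exp (real k * t) * p" by (simp add: algebra_simps p_def)
      also have "\<dots> \<le> 1 + exp (real k * t) * exp (- (real k * (t - \<epsilon>/2)))"
        using p by (intro add_left_mono mult_left_mono) auto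
      also have "exp (real k * t) * exp (- (real k * (t - \<epsilon>/2))) = exp (real k * (\<epsilon>/2))"
        by (simp add: algebra_simps flip: exp_add)
      also have "1 + exp (real k * (\<epsilon>/2)) \<le> 2 * exp (real k * (\<epsilon>/2))"
        using \<open>\<epsilon> > 0\<close> by simp
      also have "\<dots> \<le> exp (real k * \<epsilon>)" by (rule elim)
      finally show ?case .
    qed
  qed
qed

text \<open>The variational inequality for \<open>real k * g p\<close>, divided by \<open>k\<close>,
  leaves as correction the \<mu>-integral of \<open>b k\<close>, which does not involve \<rho>. It
  tends to 0 by dominated convergence, so one threshold for \<open>k\<close> serves all \<rho> and
  all \<open>a\<close>.\<close>

lemma admissible_bound:
  assumes g: "admissible g" and "\<epsilon> > 0"
  shows "\<forall>\<^sub>F k in sequentially. \<forall>\<rho> a. prob_borel \<rho> \<longrightarrow> first_marg \<rho> = \<mu> \<longrightarrow>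
    ereal (1 / real k) * rel_entropy \<rho> (ref_meas \<mu> L k) \<le> ereal a \<longrightarrow> (\<integral>p. g p \<partial>\<rho>) \<le> a + \<epsilon>"
proof -
  obtain B where gB: "g \<in> borel_measurable borel" "\<And>p. 0 \<le> g p" "\<And>p. g p \<le> B"
    using g unfolding admissible_def by blast
  have B0: "0 \<le> B" using gB(2)[of undefined] gB(3)[of undefined] by simp
  define Z where "Z k x = (\<integral>y. exp (real k * g (x, y)) \<partial>L k x)" for k x
  have Zm: "Z k \<in> borel_measurable borel" for k
    unfolding Z_def using gB
    by (intro measurable_integral_kernel[OF kernel laws, of "\<lambda>p. exp (real k * g p)" "exp (real k * B)"])
      (auto simp: mult_left_mono)
  have ec: "(\<integral>y. r \<partial>L k x) = r" "integrable (L k x) (\<lambda>y. r)" for k x and r :: real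
  proof -
    interpret prob_space "L k x" using prob_borelD(1)[OF laws] .
    show "(\<integral>y. r \<partial>L k x) = r" "integrable (L k x) (\<lambda>y. r)" by (simp_all add: prob_space)
  qed
  have Z1: "1 \<le> Z k x" for k x
  proof -
    have "(\<integral>y. 1 \<partial>L k x) \<le> Z k x"
      unfolding Z_def using gB(2) by (intro integral_mono integrable_exp[OF gB] ec) auto
    then show ?thesis by (simp only: ec)
  qed
  have ZB: "Z k x \<le> exp (real k * B)" for k x
  proof -
    have "Z k x \<le> (\<integral>y. exp (real k * B) \<partial>L k x)"
      unfolding Z_def using gB(3) by (intro integral_mono integrable_exp[OF gB] ec) (auto simp: mult_left_mono)
    then show ?thesis by (simp only: ec)
  qed
  define b where "b k x = ln (Z k x) / real k" for k x
  have b0: "0 \<le> b k x" for k x unfolding b_def using Z1[of k x] by simp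
  have bB: "b k x \<le> B" for k x
  proof (cases "k = 0")
    case False
    have "ln (Z k x) \<le> ln (exp (real k * B))" using Z1[of k x] ZB[of k x] by (subst ln_le_cancel_iff) auto
    then show ?thesis using False by (simp add: b_def field_simps)
  qed (simp add: b_def B0)
  have blim: "(\<lambda>k. b k x) \<longlonglongrightarrow> 0" for x
  proof (rule tendstoI)
    fix e :: real assume "e > 0"
    then have "e/2 > 0" by simp
    then have "\<forall>\<^sub>F k in sequentially. Z k x \<le> exp (real k * (e/2))"
      using g unfolding admissible_def Z_def by blast
    then show "\<forall>\<^sub>F k in sequentially. dist (b k x) 0 < e"
      using eventually_gt_at_top[of 0]
    proof eventually_elim
      case (elim k)
      have "ln (Z k x) \<le> ln (exp (real k * (e/2)))" using Z1[of k x] elim(1) by (subst ln_le_cancel_iff) auto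
      then have "b k x \<le> e/2" using elim(2) by (simp add: b_def field_simps)
      then show ?case using b0[of k x] \<open>e > 0\<close> by (simp add: dist_real_def)
    qed
  qed
  have bm: "b k \<in> borel_measurable borel" for k unfolding b_def using Zm by simp
  have "(\<lambda>k. \<integral>x. b k x \<partial>\<mu>) \<longlonglongrightarrow> (\<integral>x. 0 \<partial>\<mu>)"
  proof (rule integral_dominated_convergence[where w = "\<lambda>_. B"])
    show "integrable \<mu> (\<lambda>_. B)"
      using prob_borelD[OF mu] by (intro integrable_bounded_measurable[OF mu, of _ "\<bar>B\<bar>"]) auto
    show "b k \<in> borel_measurable \<mu>" for k using bm[of k] prob_borelD(2)[OF mu] by (simp add: measurable_cong_sets[of \<mu> borel])
    show "AE x in \<mu>. norm (b k x) \<le> B" for k using b0 bB by simp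
  qed (use blim in auto)
  then have "\<forall>\<^sub>F k in sequentially. (\<integral>x. b k x \<partial>\<mu>) < \<epsilon>"
    using \<open>\<epsilon> > 0\<close> by (intro order_tendstoD) auto
  then show ?thesis
    using eventually_gt_at_top[of 0]
  proof eventually_elim
    case (elim k)
    show ?case
    proof (intro allI impI)
      fix \<rho> a assume \<rho>: "prob_borel \<rho>" "first_marg \<rho> = \<mu>"
        and a: "ereal (1 / real k) * rel_entropy \<rho> (ref_meas \<mu> L k) \<le> ereal a"
      have gk: "(\<lambda>p. real k * g p) \<in> borel_measurable borel" "\<And>p. \<bar>real k * g p\<bar> \<le> real k * B"
        using gB by (auto simp: abs_mult mult_left_mono)
      have "ereal ((\<integral>p. real k * g p \<partial>\<rho>) - (\<integral>x. ln (Z k x) \<partial>\<mu>)) \<le> rel_entropy \<rho> (ref_meas \<mu> L k)"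
        unfolding Z_def ref_meas_eq by (rule rel_entropy_kernel_variational[OF mu kernel laws \<rho> gk])
      then have "ereal (1 / real k) * ereal ((\<integral>p. real k * g p \<partial>\<rho>) - (\<integral>x. ln (Z k x) \<partial>\<mu>))
          \<le> ereal (1 / real k) * rel_entropy \<rho> (ref_meas \<mu> L k)"
        by (intro ereal_mult_left_mono) auto
      also have "\<dots> \<le> ereal a" by (rule a)
      finally have "1 / real k * ((\<integral>p. real k * g p \<partial>\<rho>) - (\<integral>x. ln (Z k x) \<partial>\<mu>)) \<le> a" by simp
      then have "(\<integral>p. g p \<partial>\<rho>) - (\<integral>x. b k x \<partial>\<mu>) \<le> a"
        using elim(2) by (simp add: b_def field_simps)
      then show "(\<integral>p. g p \<partial>\<rho>) \<le> a + \<epsilon>" using elim(1) by simp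
    qed
  qed
qed

end

section \<open>Compactness and the lower bound\<close>

lemma measure_first_marg:
  assumes "prob_borel \<rho>" "A \<in> sets borel"
  shows "measure (first_marg \<rho>) A = measure \<rho> {p. fst p \<in> A}"
  unfolding first_marg_def using assms
  by (subst measure_distr[OF measurable_fst_borel(1)]) (auto simp: prob_borelD vimage_def)

context ldp_family begin

text \<open>The radius beyond which \<open>c x\<close> stays above a given level depends on
  \<open>x\<close>. Since sublevel sets are compact, the sets \<open>E n\<close> of points for which
  radius \<open>n\<close> is enough increase to the whole space. A large \<open>n\<close> leaves out
  only small \<mu>-mass, and this is also the \<rho>-mass over the omitted set for every \<rho> with
  first marginal \<mu>.\<close>

lemma tight_second_marginal:
  assumes "(e :: real) > 0" "0 \<le> a"
  shows "\<exists>n. \<forall>\<^sub>F k in sequentially. \<forall>\<rho>. prob_borel \<rho> \<longrightarrow> first_marg \<rho> = \<mu> \<longrightarrow>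
    ereal (1 / real k) * rel_entropy \<rho> (ref_meas \<mu> L k) \<le> ereal a \<longrightarrow>
    measure \<rho> {p. real n \<le> norm (snd p)} \<le> e"
proof -
  interpret prob_space \<mu> using prob_borelD(1)[OF mu] .
  \<comment> \<open>\<open>admissible_bound\<close> with tolerance 1 bounds the integral of the atom
    of height \<open>M\<close> by \<open>a + 1\<close>, so its support has mass at most
    \<open>(a + 1) / M = e / 2\<close>.\<close>
  define M where "M = 2 * (a + 1) / e"
  have M: "0 < M" "(a + 1) / M = e / 2" using assms by (auto simp: M_def field_simps)
  define F where "F n = {y :: 'a. real n \<le> norm y}" for n
  have Fc: "closed (F n)" for n unfolding F_def by (intro closed_Collect_le continuous_intros)
  then have Fb: "F n \<in> sets borel" for n by simp
  define E where "E n = {x. upper_rate (F n) x \<le> - ereal M}" for n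
  have Em: "E n \<in> sets borel" for n
  proof -
    have [measurable]: "upper_rate (F n) \<in> borel_measurable borel" by (rule upper_rate_measurable[OF Fb])
    show ?thesis unfolding E_def by measurable
  qed
  have inc: "incseq E"
  proof (rule incseq_SucI)
    fix n
    have "upper_rate (F (Suc n)) x \<le> upper_rate (F n) x" for x
      by (rule upper_rate_mono[OF _ Fb]) (auto simp: F_def)
    then show "E n \<subseteq> E (Suc n)" unfolding E_def using order_trans by blast
  qed
  have UN: "(\<Union>n. E n) = UNIV"
  proof -
    have "\<exists>n. x \<in> E n" for x
    proof -
      have "compact {y. c x y \<le> ennreal M}"
        using ldp[of x] unfolding k_ldp_def good_rate_def by blast
      then have "bounded {y. c x y \<le> ennreal M}" by (rule compact_imp_bounded)
      then obtain B where B: "\<And>y. c x y \<le> ennreal M \<Longrightarrow> norm y \<le> B"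
        by (auto simp: bounded_iff)
      obtain n where n: "B < real n" using reals_Archimedean2 by blast
      have "upper_rate (F n) x \<le> - ereal M"
      proof (rule upper_rate_le[OF Fc])
        fix y assume "y \<in> F n"
        then have "\<not> norm y \<le> B" using n by (simp add: F_def)
        then show "ennreal M \<le> c x y" using B[of y] by (meson linear)
      qed (use M in simp)
      then show ?thesis by (auto simp: E_def)
    qed
    then show ?thesis by blast
  qed
  have "(\<lambda>n. measure \<mu> (E n)) \<longlonglongrightarrow> measure \<mu> (\<Union>n. E n)"
    using Em inc prob_borelD(2)[OF mu] by (intro finite_Lim_measure_incseq) auto
  also have "measure \<mu> (\<Union>n. E n) = 1" using prob_space prob_borelD(3)[OF mu] by (simp add: UN)
  finally have "\<forall>\<^sub>F n in sequentially. 1 - e/2 < measure \<mu> (E n)"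
    using assms(1) by (intro order_tendstoD) auto
  from eventually_happens'[OF sequentially_bot this]
  obtain n where n: "1 - e/2 < measure \<mu> (E n)" by blast
  let ?g = "\<lambda>p. M * indicator {x. upper_rate (F n) x \<le> - ereal M} (fst p) * indicator (F n) (snd p)"
  have adm: "admissible ?g" using M by (intro admissible_atom Fb) auto
  have sub: "measure \<rho> {p. real n \<le> norm (snd p)} \<le> e"
    if \<rho>: "prob_borel \<rho>" "first_marg \<rho> = \<mu>" and g: "(\<integral>p. ?g p \<partial>\<rho>) \<le> a + 1" for \<rho>
  proof -
    interpret R: prob_space \<rho> using prob_borelD(1)[OF \<rho>(1)] .
    note s = prob_borelD(2)[OF \<rho>(1)]
    define X where "X = {p. fst p \<in> E n \<and> snd p \<in> F n}"
    define Y where "Y = {p :: 'a \<times> 'a. fst p \<in> - E n}"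
    have X: "X \<in> sets \<rho>" "Y \<in> sets \<rho>"
    proof -
      have "X = E n \<times> F n" "Y = (- E n) \<times> UNIV" by (auto simp: X_def Y_def)
      then show "X \<in> sets \<rho>" "Y \<in> sets \<rho>" unfolding s using Em[of n] Fb[of n] by (auto intro!: borel_Times)
    qed
    have "(\<integral>p. ?g p \<partial>\<rho>) = (\<integral>p. M * indicator X p \<partial>\<rho>)"
      by (intro Bochner_Integration.integral_cong) (auto simp: X_def E_def indicator_def)
    also have "\<dots> = M * measure \<rho> X" using X by simp
    finally have "measure \<rho> X \<le> (a + 1) / M" using g M(1) by (simp add: field_simps)
    then have 1: "measure \<rho> X \<le> e / 2" by (simp add: M(2))
    have "measure \<rho> Y = measure \<mu> (- E n)"
      using measure_first_marg[OF \<rho>(1), of "- E n"] Em[of n] by (simp add: \<rho>(2) Y_def)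
    also have "\<dots> = 1 - measure \<mu> (E n)"
      using prob_compl[of "E n"] Em[of n] prob_borelD(2,3)[OF mu] by (simp add: Compl_eq_Diff_UNIV)
    finally have 2: "measure \<rho> Y \<le> e / 2" using n by simp
    have "measure \<rho> {p. real n \<le> norm (snd p)} \<le> measure \<rho> (X \<union> Y)"
      using X by (intro R.finite_measure_mono) (auto simp: X_def Y_def F_def)
    also have "\<dots> \<le> measure \<rho> X + measure \<rho> Y" using X by (intro measure_Un_le) auto
    finally show ?thesis using 1 2 by simp
  qed
  show ?thesis
  proof (intro exI[of _ n])
    show "\<forall>\<^sub>F k in sequentially. \<forall>\<rho>. prob_borel \<rho> \<longrightarrow> first_marg \<rho> = \<mu> \<longrightarrow>
      ereal (1 / real k) * rel_entropy \<rho> (ref_meas \<mu> L k) \<le> ereal a \<longrightarrow>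
      measure \<rho> {p. real n \<le> norm (snd p)} \<le> e"
      using admissible_bound[OF adm zero_less_one]
      by eventually_elim (use sub in blast)
  qed
qed

text \<open>An inequality in place of an equality keeps measurability of $c$ out of the argument.\<close>

lemma cost_le_countable_sup:
  obtains g :: "nat \<Rightarrow> 'a \<times> 'a \<Rightarrow> real" where
    "\<And>N. admissible (g N)" "\<And>N. marginally_approximable \<mu> (g N)"
    "\<And>N p. g N p \<le> g (Suc N) p" "\<And>x y. c x y \<le> (SUP N. ennreal (g N (x, y)))"
proof -
  obtain Q :: "'a set" where Q: "countable Q" "\<And>X. open X \<Longrightarrow> X \<noteq> {} \<Longrightarrow> \<exists>d\<in>Q. d \<in> X"
    using countable_dense_setE by blast
  \<comment> \<open>A countable index set for the atoms: centres in a dense set, radii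
    \<open>r n\<close>, rational heights.\<close>
  define I where "I = Q \<times> (UNIV :: nat set) \<times> {t \<in> \<rat>. 0 \<le> (t::real)}"
  have "countable I" unfolding I_def
    using Q(1) countable_rat by (intro countable_SIGMA countable_subset[OF _ countable_rat]) auto
  define r where "r n = 1 / real (Suc n)" for n
  have r0: "0 < r n" for n by (simp add: r_def)
  \<comment> \<open>Equal to 1 within distance \<open>r n\<close> of \<open>q\<close> and 0 beyond
    \<open>2 * r n\<close>; the rate set \<open>E\<close> refers to the larger ball, which carries
    the whole of \<phi>.\<close>
  define \<phi> where "\<phi> q n y = min 1 (max 0 (2 - dist y q / r n))" for q :: 'a and n y
  define E where "E q n t = {x. upper_rate (cball q (2 * r n)) x \<le> - ereal t}" for q n t
  define atom where "atom i p = (case i of (q, n, t) \<Rightarrow> t * indicator (E q n t) (fst p) * \<phi> q n (snd p))"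
    for i and p :: "'a \<times> 'a"
  have \<phi>: "\<phi> q n \<in> bcontfun" "0 \<le> \<phi> q n y" "\<phi> q n y \<le> 1" for q n y
  proof -
    show "\<phi> q n \<in> bcontfun"
    proof (rule bcontfunI)
      show "continuous_on UNIV (\<phi> q n)" unfolding \<phi>_def using r0[of n] by (intro continuous_intros) auto
      show "\<bar>\<phi> q n y\<bar> \<le> 1" for y by (auto simp: \<phi>_def)
    qed
  qed (auto simp: \<phi>_def)
  have \<phi>_le: "\<phi> q n y \<le> indicator (cball q (2 * r n)) y" for q n y
  proof (cases "y \<in> cball q (2 * r n)")
    case False
    then have "2 - dist y q / r n \<le> 0" using r0[of n] by (simp add: field_simps dist_commute)
    then show ?thesis using False by (simp add: \<phi>_def)
  qed (simp add: \<phi>_def)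
  have Em: "E q n t \<in> sets borel" for q n t
  proof -
    have [measurable]: "upper_rate (cball q (2 * r n)) \<in> borel_measurable borel"
      by (rule upper_rate_measurable) simp
    show ?thesis unfolding E_def by measurable
  qed
  have atom: "admissible (atom i)" "marginally_approximable \<mu> (atom i)" if iI: "i \<in> I" for i
  proof -
    obtain q n t where i: "i = (q, n, t)" "0 \<le> t" using iI unfolding I_def by auto
    have ma: "marginally_approximable \<mu> (\<lambda>p. t * indicator (E q n t) (fst p) * \<phi> q n (snd p))"
      by (rule marginally_approximable_atom[OF mu Em i(2) \<phi>])
    then show "marginally_approximable \<mu> (atom i)" by (simp add: atom_def[abs_def] i)
    have "admissible (\<lambda>p. t * indicator (E q n t) (fst p) * \<phi> q n (snd p))"
    proof (rule admissible_mono)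
      show "admissible (\<lambda>p. t * indicator {x. upper_rate (cball q (2 * r n)) x \<le> - ereal t} (fst p) * indicator (cball q (2 * r n)) (snd p))"
        by (rule admissible_atom[OF _ i(2)]) simp
      show "(\<lambda>p. t * indicator (E q n t) (fst p) * \<phi> q n (snd p)) \<in> borel_measurable borel"
        using ma unfolding marginally_approximable_def by blast
      show "0 \<le> t * indicator (E q n t) (fst p) * \<phi> q n (snd p)" for p using i(2) \<phi>(2) by simp
      show "t * indicator (E q n t) (fst p) * \<phi> q n (snd p)
          \<le> t * indicator {x. upper_rate (cball q (2 * r n)) x \<le> - ereal t} (fst p) * indicator (cball q (2 * r n)) (snd p)" for p
        unfolding E_def[symmetric] using i(2) \<phi>_le by (intro mult_left_mono) auto
    qed
    then show "admissible (atom i)" by (simp add: atom_def[abs_def] i)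
  qed
  obtain q0 where "q0 \<in> Q" using Q(2)[of UNIV] by auto
  then have ne: "I \<noteq> {}" unfolding I_def by auto
  define en where "en = from_nat_into I"
  have enI: "en m \<in> I" for m unfolding en_def by (rule from_nat_into[OF ne])
  have en_onto: "\<exists>m. en m = i" if "i \<in> I" for i
    using from_nat_into_surj[OF \<open>countable I\<close> that] unfolding en_def .
  \<comment> \<open>Running maxima starting from 0: admissibility and marginal approximability
    survive, and the sequence is increasing.\<close>
  define g where "g = rec_nat (\<lambda>p. 0) (\<lambda>m h p. max (h p) (atom (en m) p))"
  have g_simps: "g 0 = (\<lambda>p. 0)" "g (Suc m) = (\<lambda>p. max (g m p) (atom (en m) p))" for m
    by (simp_all add: g_def)
  have z: "marginally_approximable \<mu> (\<lambda>_. 0)"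
    using marginally_approximable_atom[OF mu sets.empty_sets order_refl bcontfun_const[of 1]] by simp
  show ?thesis
  proof (rule that[of g])
    show "admissible (g N)" for N
      by (induction N) (simp_all add: g_simps admissible_zero admissible_max atom(1)[OF enI])
    show "marginally_approximable \<mu> (g N)" for N
      by (induction N) (simp_all add: g_simps z marginally_approximable_max[OF mu] atom(2)[OF enI])
    show "g N p \<le> g (Suc N) p" for N p by (simp add: g_simps)
    show "c x y \<le> (SUP N. ennreal (g N (x, y)))" for x y
    proof (rule ccontr)
        assume "\<not> c x y \<le> (SUP N. ennreal (g N (x, y)))"
        then have lt: "(SUP N. ennreal (g N (x, y))) < c x y" by simp
        then obtain s where s: "(SUP N. ennreal (g N (x, y))) < s" "s < c x y" using dense by blast
        then obtain s' where s': "s = ennreal s'" "0 \<le> s'" by (cases s) auto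
        \<comment> \<open>Two intermediate values, finite even if \<open>c x y\<close> is infinite,
          leave room for a rational height \<open>t\<close> strictly between the supremum and the
          cost.\<close>
        obtain u where u: "s < u" "u < c x y" using dense[OF s(2)] by blast
        then obtain u' where u': "u = ennreal u'" "0 \<le> u'" by (cases u) auto
        have "s' < u'" using u(1) by (simp add: s' u' ennreal_less_iff)
        then obtain t where t: "t \<in> \<rat>" "s' < t" "t < u'" using Rats_dense_in_real by blast
        have t0: "0 \<le> t" using s'(2) t(2) by simp
        have "ennreal t < u" using t(3) t0 by (simp add: u' ennreal_less_iff)
        then have tc: "ennreal t < c x y" using u(2) by (rule less_trans)
        have "compact {y. c x y \<le> ennreal t}" using ldp[of x] unfolding k_ldp_def good_rate_def by blast
        then have "open (- {y. c x y \<le> ennreal t})" using compact_imp_closed by blast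
        moreover have "y \<in> - {y. c x y \<le> ennreal t}" using tc by simp
        ultimately obtain d where d: "d > 0" "ball y d \<subseteq> - {y. c x y \<le> ennreal t}"
          unfolding open_contains_ball by blast
        \<comment> \<open>Three radii: \<open>y\<close> lies within \<open>r n\<close> of the centre
          \<open>q\<close>, and the ball of radius \<open>2 * r n\<close> about \<open>q\<close>
          must stay in the ball of radius \<open>d\<close> about \<open>y\<close>, on which
          \<open>c x\<close> exceeds \<open>t\<close>.\<close>
        obtain n where n: "3 / d < real n" using reals_Archimedean2 by blast
        have "3 * r n < d"
        proof -
          have "3 < d * real n" using n d(1) by (simp add: field_simps)
          also have "\<dots> \<le> d * real (Suc n)" using d(1) by simp
          finally show ?thesis by (simp add: r_def field_simps)
        qed
        obtain q where q: "q \<in> Q" "q \<in> ball y (r n)" using Q(2)[of "ball y (r n)"] r0[of n] by auto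
        have cb: "cball q (2 * r n) \<subseteq> ball y d"
        proof
          fix w assume "w \<in> cball q (2 * r n)"
          then have "dist y w \<le> dist y q + 2 * r n" using dist_triangle[of y w q] by simp
          also have "\<dots> < d" using q(2) \<open>3 * r n < d\<close> by simp
          finally show "w \<in> ball y d" by simp
        qed
        have "upper_rate (cball q (2 * r n)) x \<le> - ereal t"
        proof (rule upper_rate_le[OF _ _ t0])
          fix w assume "w \<in> cball q (2 * r n)"
          then have "\<not> c x w \<le> ennreal t" using cb d(2) by blast
          then show "ennreal t \<le> c x w" by simp
        qed simp
        then have "x \<in> E q n t" by (simp add: E_def)
        moreover have "\<phi> q n y = 1"
        proof -
          have "dist y q / r n \<le> 1" using q(2) r0[of n] by (simp add: field_simps)
          then show ?thesis by (simp add: \<phi>_def)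
        qed
        ultimately have val: "atom (q, n, t) (x, y) = t" by (simp add: atom_def)
        have "(q, n, t) \<in> I" using q(1) t(1) t0 by (simp add: I_def)
        then obtain m where m: "en m = (q, n, t)" using en_onto by blast
        have "t \<le> g (Suc m) (x, y)" by (simp add: g_simps m val)
        then have "ennreal t \<le> (SUP N. ennreal (g N (x, y)))"
          by (intro SUP_upper2[of "Suc m"] ennreal_leI) auto
        also have "\<dots> < ennreal s'" using s(1) s'(1) by simp
        finally show False using t(2) t0 s'(2) by (simp add: ennreal_less_iff)
    qed
  qed
qed

text \<open>Equicoercivity and lower semicontinuity in one statement.\<close>

theorem entropy_bound_cluster:
  fixes R :: "'i \<Rightarrow> ('a \<times> 'a) measure" and a :: real
  assumes G: "G \<noteq> bot" and k: "filterlim k sequentially G"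
    and R: "\<And>i. prob_borel (R i)" "\<And>i. first_marg (R i) = \<mu>"
    and S: "\<forall>\<^sub>F i in G. ereal (1 / real (k i)) * rel_entropy (R i) (ref_meas \<mu> L (k i)) \<le> ereal a"
  obtains G' \<rho> where "G' \<noteq> bot" "G' \<le> G" "prob_borel \<rho>" "first_marg \<rho> = \<mu>" "narrow_lim R \<rho> G'"
    "enn2ereal (\<integral>\<^sup>+p. c (fst p) (snd p) \<partial>\<rho>) \<le> ereal a"
proof -
  \<comment> \<open>The tightness lemma asks for a nonnegative bound, while the sign of
    \<open>a\<close> is established only at the end.\<close>
  have S': "\<forall>\<^sub>F i in G. ereal (1 / real (k i)) * rel_entropy (R i) (ref_meas \<mu> L (k i)) \<le> ereal (max a 0)"
    using S by eventually_elim (metis ereal_less_eq(3) max.cobounded1 order_trans)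
  have tight: "\<exists>r. \<forall>\<^sub>F i in G. measure (R i) {p. r < norm p} \<le> e" if "e > 0" for e
  proof -
    have e2: "e/2 > 0" using that by simp
    obtain n where n: "\<forall>\<^sub>F k in sequentially. \<forall>\<rho>. prob_borel \<rho> \<longrightarrow> first_marg \<rho> = \<mu> \<longrightarrow>
      ereal (1 / real k) * rel_entropy \<rho> (ref_meas \<mu> L k) \<le> ereal (max a 0) \<longrightarrow>
      measure \<rho> {p. real n \<le> norm (snd p)} \<le> e/2"
      using tight_second_marginal[OF e2, of "max a 0"] by auto
    have ev: "\<forall>\<^sub>F i in G. \<forall>\<rho>. prob_borel \<rho> \<longrightarrow> first_marg \<rho> = \<mu> \<longrightarrow>
      ereal (1 / real (k i)) * rel_entropy \<rho> (ref_meas \<mu> L (k i)) \<le> ereal (max a 0) \<longrightarrow>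
      measure \<rho> {p. real n \<le> norm (snd p)} \<le> e/2"
      by (rule eventually_compose_filterlim[OF n k])
    interpret prob_space \<mu> using prob_borelD(1)[OF mu] .
    have bm: "ball 0 (real m) \<in> sets \<mu>" for m using prob_borelD(2)[OF mu] by simp
    have "(\<lambda>m. measure \<mu> (ball 0 (real m))) \<longlonglongrightarrow> measure \<mu> (\<Union>m. ball 0 (real m))"
      using bm by (intro finite_Lim_measure_incseq) (auto simp: incseq_def intro: less_le_trans)
    also have "(\<Union>m. ball 0 (real m)) = (UNIV :: 'a set)"
      using reals_Archimedean2 by auto
    also have "measure \<mu> UNIV = 1" using prob_space prob_borelD(3)[OF mu] by simp
    finally have "\<forall>\<^sub>F m in sequentially. 1 - e/2 < measure \<mu> (ball 0 (real m))"
      using that by (intro order_tendstoD) auto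
    from eventually_happens'[OF sequentially_bot this]
    obtain m where m: "1 - e/2 < measure \<mu> (ball 0 (real m))" by blast
    have mc: "measure \<mu> (- ball 0 (real m)) < e/2"
      using prob_compl[OF bm[of m]] m prob_borelD(3)[OF mu] by (simp add: Compl_eq_Diff_UNIV)
    show ?thesis
    proof (intro exI[of _ "real m + real n"])
      show "\<forall>\<^sub>F i in G. measure (R i) {p. real m + real n < norm p} \<le> e"
        using ev S'
      proof eventually_elim
        case (elim i)
        interpret R: prob_space "R i" using prob_borelD(1)[OF R(1)] .
        define X where "X = {p :: 'a \<times> 'a. fst p \<in> - ball 0 (real m)}"
        define Y where "Y = {p :: 'a \<times> 'a. real n \<le> norm (snd p)}"
        have "closed X" "closed Y"
          unfolding X_def Y_def by (simp_all add: dist_norm not_less closed_Collect_le continuous_intros)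
        then have XY: "X \<in> sets (R i)" "Y \<in> sets (R i)" using prob_borelD(2)[OF R(1)] by auto
        have "measure (R i) X = measure \<mu> (- ball 0 (real m))"
          using measure_first_marg[OF R(1), of "- ball 0 (real m)" i] by (simp add: R(2) X_def)
        then have 1: "measure (R i) X \<le> e/2" using mc by simp
        have 2: "measure (R i) Y \<le> e/2" using elim R[of i] by (simp add: Y_def)
        have "{p. real m + real n < norm p} \<subseteq> X \<union> Y"
        proof
          fix p :: "'a \<times> 'a" assume "p \<in> {p. real m + real n < norm p}"
          moreover have "norm p \<le> norm (fst p) + norm (snd p)"
            using norm_Pair_le[of "fst p" "snd p"] by simp
          ultimately show "p \<in> X \<union> Y" by (auto simp: X_def Y_def dist_norm)
        qed
        then have "measure (R i) {p. real m + real n < norm p} \<le> measure (R i) (X \<union> Y)"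
          using XY by (intro R.finite_measure_mono) auto
        also have "\<dots> \<le> measure (R i) X + measure (R i) Y" using XY by (intro measure_Un_le) auto
        finally show ?case using 1 2 by simp
      qed
    qed
  qed
  obtain G' \<rho> where G': "G' \<noteq> bot" "G' \<le> G" "prob_borel \<rho>" "narrow_lim R \<rho> G'"
    by (rule tight_cluster_measure[OF G R(1) tight], assumption) (rule that)
  \<comment> \<open>The first marginals are constantly \<mu> along the filter and converge to that
    of \<rho>; uniqueness of narrow limits identifies the two.\<close>
  have fm: "first_marg \<rho> = \<mu>"
    by (rule narrow_lim_unique[OF G'(1) narrow_lim_marg(1)[OF G'(4) R(1) G'(3)] _ prob_borel_marg(1)[OF G'(3)] mu])
      (simp add: R(2) narrow_lim_const)
  obtain g :: "nat \<Rightarrow> 'a \<times> 'a \<Rightarrow> real" where g: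
    "\<And>N. admissible (g N)" "\<And>N. marginally_approximable \<mu> (g N)"
    "\<And>N p. g N p \<le> g (Suc N) p" "\<And>x y. c x y \<le> (SUP N. ennreal (g N (x, y)))"
    by (rule cost_le_countable_sup) (rule that)
  have gN: "(\<integral>p. g N p \<partial>\<rho>) \<le> a" for N
  proof (rule field_le_epsilon)
    fix e :: real assume "e > 0"
    have ev: "\<forall>\<^sub>F i in G. \<forall>\<rho> a. prob_borel \<rho> \<longrightarrow> first_marg \<rho> = \<mu> \<longrightarrow>
      ereal (1 / real (k i)) * rel_entropy \<rho> (ref_meas \<mu> L (k i)) \<le> ereal a \<longrightarrow> (\<integral>p. g N p \<partial>\<rho>) \<le> a + e"
      by (rule eventually_compose_filterlim[OF admissible_bound[OF g(1) \<open>e > 0\<close>] k])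
    have "\<forall>\<^sub>F i in G. (\<integral>p. g N p \<partial>R i) \<le> a + e"
      using ev S by eventually_elim (use R in blast)
    then have "\<forall>\<^sub>F i in G'. (\<integral>p. g N p \<partial>R i) \<le> a + e" by (rule filter_leD[OF G'(2)])
    then show "(\<integral>p. g N p \<partial>\<rho>) \<le> a + e"
      using narrow_lim_marginally_approximable[OF mu g(2) R G'(3) fm G'(4), of N]
      by (intro tendsto_upperbound[OF _ _ G'(1)])
  qed
  have gm: "g N \<in> borel_measurable \<rho>" and gi: "integrable \<rho> (g N)" and g0: "0 \<le> g N p" for N p
  proof -
    obtain B where B: "g N \<in> borel_measurable borel" "\<And>p. 0 \<le> g N p" "\<And>p. g N p \<le> B"
      using g(1)[of N] unfolding admissible_def by blast
    show "g N \<in> borel_measurable \<rho>" using B(1) prob_borelD(2)[OF G'(3)] by (simp add: measurable_cong_sets[of \<rho> borel])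
    show "integrable \<rho> (g N)" using B by (intro integrable_bounded_measurable[OF G'(3), of _ B]) auto
    show "0 \<le> g N p" by (rule B(2))
  qed
  \<comment> \<open>The nonnegative integral is a supremum over simple functions below the
    integrand, hence monotone even for nonmeasurable integrands; monotone convergence is applied
    only to the measurable \<open>g N\<close>.\<close>
  have "(\<integral>\<^sup>+p. c (fst p) (snd p) \<partial>\<rho>) \<le> (\<integral>\<^sup>+p. (SUP N. ennreal (g N p)) \<partial>\<rho>)"
    by (intro nn_integral_mono) (metis g(4) prod.collapse)
  also have "\<dots> = (SUP N. \<integral>\<^sup>+p. ennreal (g N p) \<partial>\<rho>)"
    using gm g(3) by (intro nn_integral_monotone_convergence_SUP incseq_SucI le_funI ennreal_leI) auto
  also have "\<dots> \<le> ennreal a"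
  proof (rule SUP_least)
    fix N
    have "(\<integral>\<^sup>+p. ennreal (g N p) \<partial>\<rho>) = ennreal (\<integral>p. g N p \<partial>\<rho>)"
      using g0 by (intro nn_integral_eq_integral gi) auto
    then show "(\<integral>\<^sup>+p. ennreal (g N p) \<partial>\<rho>) \<le> ennreal a" using gN by (simp add: ennreal_leI)
  qed
  finally have "(\<integral>\<^sup>+p. c (fst p) (snd p) \<partial>\<rho>) \<le> ennreal a" .
  \<comment> \<open>Rules out that \<open>ennreal a\<close> has truncated a negative
    \<open>a\<close>.\<close>
  moreover have "0 \<le> a"
    using gN[of 0] Bochner_Integration.integral_nonneg[of \<rho> "g 0", OF g0] by linarith
  ultimately have "enn2ereal (\<integral>\<^sup>+p. c (fst p) (snd p) \<partial>\<rho>) \<le> ereal a"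
    by (simp add: less_eq_ennreal.rep_eq)
  then show ?thesis using G' fm by (intro that)
qed

end

section \<open>Conditioned mixtures\<close>

text \<open>Jensen's inequality for \<open>t * ln t\<close>, the missing weight being placed at
  \<open>t = 1\<close>, where this function vanishes. The proof sums the tangent inequality at
  \<open>D\<close>, which is the Fenchel-Young inequality with \<open>b = ln D\<close>; for
  \<open>D = 0\<close> there is no tangent, but all terms vanish.\<close>

lemma mult_ln_convex_sum:
  fixes u t :: "nat \<Rightarrow> real"
  assumes u: "\<And>j. 0 \<le> u j" "(\<Sum>j<J. u j) \<le> 1" and t: "\<And>j. 0 \<le> t j"
  defines "D \<equiv> (1 - (\<Sum>j<J. u j)) + (\<Sum>j<J. u j * t j)"
  shows "D * ln D \<le> (\<Sum>j<J. u j * (t j * ln (t j)))"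
proof -
  have ut: "0 \<le> u j * t j" for j using u t by simp
  have s0: "0 \<le> (\<Sum>j<J. u j * t j)" by (intro sum_nonneg ut)
  have D0: "0 \<le> D" using s0 u(2) by (simp add: D_def)
  show ?thesis
  proof (cases "D = 0")
    case True
    then have "(\<Sum>j<J. u j * t j) = 0" using s0 u(2) by (simp add: D_def)
    then have "u j * t j = 0" if "j < J" for j
      using that ut by (subst (asm) sum_nonneg_eq_0_iff) auto
    then have "(\<Sum>j<J. u j * (t j * ln (t j))) = 0" by (intro sum.neutral) auto
    then show ?thesis by (simp add: True)
  next
    case False
    then have D: "D > 0" using D0 by simp
    have y: "a * ln D + a - D \<le> a * ln a" if "0 \<le> a" for a
      using young_ln_exp[OF that, of "ln D"] D by simp
    have "D * ln D = D * (ln D + 1) - (1 - (\<Sum>j<J. u j)) * D - (\<Sum>j<J. u j) * D"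
      by (simp add: algebra_simps)
    also have "\<dots> = (1 - (\<Sum>j<J. u j)) * (1 * ln D + 1 - D) + (\<Sum>j<J. u j * (t j * ln D + t j - D))"
    proof -
      have "(\<Sum>j<J. u j * (t j * ln D + t j - D)) = (\<Sum>j<J. (u j * t j) * (ln D + 1)) - (\<Sum>j<J. u j * D)"
        by (subst sum_subtractf[symmetric]) (simp add: algebra_simps)
      also have "\<dots> = (\<Sum>j<J. u j * t j) * (ln D + 1) - (\<Sum>j<J. u j) * D"
        by (simp only: sum_distrib_right)
      finally have *: "(\<Sum>j<J. u j * (t j * ln D + t j - D)) = (\<Sum>j<J. u j * t j) * (ln D + 1) - (\<Sum>j<J. u j) * D" .
      have "D * (ln D + 1) = (1 - (\<Sum>j<J. u j)) * (ln D + 1) + (\<Sum>j<J. u j * t j) * (ln D + 1)"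
        unfolding D_def by (simp only: distrib_right)
      then show ?thesis unfolding * by (simp add: algebra_simps)
    qed
    also have "\<dots> \<le> (1 - (\<Sum>j<J. u j)) * 0 + (\<Sum>j<J. u j * (t j * ln (t j)))"
    proof (intro add_mono sum_mono mult_left_mono y t u(1))
      show "1 * ln D + 1 - D \<le> 0" using y[of 1] by simp
    qed (use u(2) in simp)
    finally show ?thesis by simp
  qed
qed

text \<open>\<open>w x\<close> plays the role of the conditional probability that the second
  coordinate lies in \<open>A\<close>, given that the first is \<open>x\<close>. It is the
  Radon-Nikodym density of the first marginal of \<rho> restricted to that event, so no
  disintegration of \<rho> is called for.\<close>

lemma conditional_density:
  fixes \<rho> :: "('a::euclidean_space \<times> 'a) measure"
  assumes \<rho>: "prob_borel \<rho>" and A: "A \<in> sets borel"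
  obtains w :: "'a \<Rightarrow> real" where "w \<in> borel_measurable borel" "\<And>x. 0 \<le> w x"
    "\<And>u :: 'a \<Rightarrow> ennreal. u \<in> borel_measurable borel \<Longrightarrow>
      (\<integral>\<^sup>+x. ennreal (w x) * u x \<partial>first_marg \<rho>) = (\<integral>\<^sup>+p. indicator A (snd p) * u (fst p) \<partial>\<rho>)"
proof -
  define \<mu> where "\<mu> = first_marg \<rho>"
  have mu: "prob_borel \<mu>" unfolding \<mu>_def by (rule prob_borel_marg(1)[OF \<rho>])
  interpret M: prob_space \<mu> using prob_borelD(1)[OF mu] .
  interpret R: prob_space \<rho> using prob_borelD(1)[OF \<rho>] .
  note ms = prob_borelD(2)[OF mu]
  note fs = measurable_fst_borel[OF \<rho>]
  have ind: "(\<lambda>p. indicator A (snd p) :: ennreal) \<in> borel_measurable \<rho>"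
    using measurable_compose[OF fs(2), of "indicator A :: 'a \<Rightarrow> ennreal" borel] A by simp
  define \<kappa> where "\<kappa> = distr (density \<rho> (\<lambda>p. indicator A (snd p))) borel fst"
  have fd: "fst \<in> density \<rho> (\<lambda>p. indicator A (snd p)) \<rightarrow>\<^sub>M borel" using fs(1) by simp
  have int: "(\<integral>\<^sup>+x. u x \<partial>\<kappa>) = (\<integral>\<^sup>+p. indicator A (snd p) * u (fst p) \<partial>\<rho>)"
    if u: "u \<in> borel_measurable borel" for u :: "'a \<Rightarrow> ennreal"
  proof -
    have uf: "(\<lambda>p. u (fst p)) \<in> borel_measurable \<rho>" by (rule measurable_compose[OF fs(1) u])
    have "(\<integral>\<^sup>+x. u x \<partial>\<kappa>) = (\<integral>\<^sup>+p. u (fst p) \<partial>density \<rho> (\<lambda>p. indicator A (snd p)))"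
      unfolding \<kappa>_def using u by (intro nn_integral_distr[OF fd]) simp
    also have "\<dots> = (\<integral>\<^sup>+p. indicator A (snd p) * u (fst p) \<partial>\<rho>)"
      by (rule nn_integral_density[OF ind uf])
    finally show ?thesis .
  qed
  have int\<mu>: "(\<integral>\<^sup>+x. u x \<partial>\<mu>) = (\<integral>\<^sup>+p. u (fst p) \<partial>\<rho>)"
    if u: "u \<in> borel_measurable borel" for u :: "'a \<Rightarrow> ennreal"
    unfolding \<mu>_def first_marg_def using u by (intro nn_integral_distr[OF fs(1)]) simp
  have le: "emeasure \<kappa> N \<le> emeasure \<mu> N" if N: "N \<in> sets borel" for N
  proof -
    have "emeasure \<kappa> N = (\<integral>\<^sup>+x. indicator N x \<partial>\<kappa>)" using N by (simp add: \<kappa>_def)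
    also have "\<dots> = (\<integral>\<^sup>+p. indicator A (snd p) * indicator N (fst p) \<partial>\<rho>)"
      by (rule int) (use N in simp)
    also have "\<dots> \<le> (\<integral>\<^sup>+p. indicator N (fst p) \<partial>\<rho>)"
      by (intro nn_integral_mono) (auto simp: indicator_def)
    also have "\<dots> = (\<integral>\<^sup>+x. indicator N x \<partial>\<mu>)" by (rule int\<mu>[symmetric]) (use N in simp)
    also have "\<dots> = emeasure \<mu> N" using N ms by simp
    finally show ?thesis .
  qed
  have \<kappa>s: "sets \<kappa> = sets \<mu>" by (simp add: \<kappa>_def ms)
  have ac: "absolutely_continuous \<mu> \<kappa>"
    unfolding absolutely_continuous_def
  proof
    fix N assume "N \<in> null_sets \<mu>"
    then show "N \<in> null_sets \<kappa>" using le[of N] by (simp add: null_sets_def \<kappa>s ms)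
  qed
  have fin: "finite_measure \<kappa>"
  proof
    have "emeasure \<kappa> (space \<kappa>) \<le> emeasure \<mu> UNIV" using le[of UNIV] by (simp add: \<kappa>_def)
    also have "\<dots> = 1" using M.emeasure_space_1 prob_borelD(3)[OF mu] by simp
    finally show "emeasure \<kappa> (space \<kappa>) \<noteq> \<infinity>" by (auto simp: top_unique)
  qed
  obtain w where w: "w \<in> borel_measurable \<mu>" "AE x in \<mu>. RN_deriv \<mu> \<kappa> x = ennreal (w x)" "\<And>x. 0 \<le> w x"
    by (rule M.real_RN_deriv[OF fin ac \<kappa>s]) (rule that)
  have dens: "density \<mu> (\<lambda>x. ennreal (w x)) = \<kappa>"
  proof -
    have "density \<mu> (\<lambda>x. ennreal (w x)) = density \<mu> (RN_deriv \<mu> \<kappa>)"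
      using w by (intro density_cong) auto
    then show ?thesis using M.density_RN_deriv[OF ac \<kappa>s] by simp
  qed
  show ?thesis
  proof (rule that[of w])
    show "w \<in> borel_measurable borel" using w(1) ms by (simp add: measurable_cong_sets[of \<mu> borel])
    show "0 \<le> w x" for x by (rule w(3))
    fix u :: "'a \<Rightarrow> ennreal" assume u: "u \<in> borel_measurable borel"
    have "(\<integral>\<^sup>+x. ennreal (w x) * u x \<partial>\<mu>) = (\<integral>\<^sup>+x. u x \<partial>\<kappa>)"
      unfolding dens[symmetric] using w(1) u ms
      by (intro nn_integral_density[symmetric]) (auto simp: measurable_cong_sets[of \<mu> borel])
    then show "(\<integral>\<^sup>+x. ennreal (w x) * u x \<partial>first_marg \<rho>) = (\<integral>\<^sup>+p. indicator A (snd p) * u (fst p) \<partial>\<rho>)"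
      using int[OF u] by (simp add: \<mu>_def)
  qed
qed

text \<open>Conditional probabilities are determined only almost everywhere, whereas the mixture
  needs total weight at most 1 at every \<open>x\<close>; the weights are set to 0 on the null set
  where this fails.\<close>

lemma conditional_weights:
  fixes \<rho> :: "('a::euclidean_space \<times> 'a) measure"
  assumes \<rho>: "prob_borel \<rho>" and A: "\<And>j::nat. A j \<in> sets borel" "disjoint_family A"
  obtains w :: "nat \<Rightarrow> 'a \<Rightarrow> real" where "\<And>j. w j \<in> borel_measurable borel" "\<And>j x. 0 \<le> w j x"
    "\<And>x. (\<Sum>j<J. w j x) \<le> 1"
    "\<And>j u. (u :: 'a \<Rightarrow> ennreal) \<in> borel_measurable borel \<Longrightarrow>
      (\<integral>\<^sup>+x. ennreal (w j x) * u x \<partial>first_marg \<rho>) = (\<integral>\<^sup>+p. indicator (A j) (snd p) * u (fst p) \<partial>\<rho>)"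
proof -
  define \<mu> where "\<mu> = first_marg \<rho>"
  have mu: "prob_borel \<mu>" unfolding \<mu>_def by (rule prob_borel_marg(1)[OF \<rho>])
  interpret M: prob_space \<mu> using prob_borelD(1)[OF mu] .
  note ms = prob_borelD(2)[OF mu]
  note fs = measurable_fst_borel[OF \<rho>]
  have "\<exists>w :: 'a \<Rightarrow> real. w \<in> borel_measurable borel \<and> (\<forall>x. 0 \<le> w x) \<and> (\<forall>u :: 'a \<Rightarrow> ennreal. u \<in> borel_measurable borel \<longrightarrow>
      (\<integral>\<^sup>+x. ennreal (w x) * u x \<partial>\<mu>) = (\<integral>\<^sup>+p. indicator (A j) (snd p) * u (fst p) \<partial>\<rho>))" for j
    unfolding \<mu>_def by (rule conditional_density[OF \<rho> A(1)[of j]]) blast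
  then obtain w :: "nat \<Rightarrow> 'a \<Rightarrow> real" where w: "\<And>j. w j \<in> borel_measurable borel" "\<And>j x. 0 \<le> w j x"
    "\<And>j u. (u :: 'a \<Rightarrow> ennreal) \<in> borel_measurable borel \<Longrightarrow>
      (\<integral>\<^sup>+x. ennreal (w j x) * u x \<partial>\<mu>) = (\<integral>\<^sup>+p. indicator (A j) (snd p) * u (fst p) \<partial>\<rho>)"
    by metis
  note [measurable] = w(1)
  define s where "s x = (\<Sum>j<J. w j x)" for x
  have sm [measurable]: "s \<in> borel_measurable borel" unfolding s_def by measurable
  have s0: "0 \<le> s x" for x unfolding s_def by (intro sum_nonneg w(2))
  \<comment> \<open>On \<open>N\<close> the sum exceeds 1, yet its integral over \<open>N\<close> is
    at most the measure of \<open>N\<close> because the cells are disjoint; hence \<open>N\<close>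
    is null.\<close>
  define N where "N = {x. 1 < s x}"
  have Nm [measurable]: "N \<in> sets borel" unfolding N_def by measurable
  have m\<mu>: "f \<in> borel_measurable borel \<Longrightarrow> f \<in> borel_measurable \<mu>" for f :: "'a \<Rightarrow> ennreal"
    using ms by (simp add: measurable_cong_sets[of \<mu> borel])
  have "(\<integral>\<^sup>+x. ennreal (s x) * indicator N x \<partial>\<mu>) = (\<Sum>j<J. \<integral>\<^sup>+x. ennreal (w j x) * indicator N x \<partial>\<mu>)"
  proof -
    have *: "ennreal (s x) * indicator N x = (\<Sum>j<J. ennreal (w j x) * indicator N x)" for x
      unfolding s_def using w(2) by (simp add: sum_distrib_right flip: sum_ennreal)
    show ?thesis
      unfolding * by (rule nn_integral_sum) (rule m\<mu>, measurable)
  qed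
  also have "\<dots> = (\<Sum>j<J. \<integral>\<^sup>+p. indicator (A j) (snd p) * indicator N (fst p) \<partial>\<rho>)"
    by (intro sum.cong refl w(3)) measurable
  also have "\<dots> = (\<integral>\<^sup>+p. (\<Sum>j<J. indicator (A j) (snd p) * indicator N (fst p)) \<partial>\<rho>)"
  proof (rule nn_integral_sum[symmetric])
    fix j
    have 1: "(\<lambda>p. indicator (A j) (snd p) :: ennreal) \<in> borel_measurable \<rho>"
      using measurable_compose[OF fs(2), of "indicator (A j) :: 'a \<Rightarrow> ennreal" borel] A(1) by simp
    have 2: "(\<lambda>p. indicator N (fst p) :: ennreal) \<in> borel_measurable \<rho>"
      using measurable_compose[OF fs(1), of "indicator N :: 'a \<Rightarrow> ennreal" borel] by simp
    show "(\<lambda>p. indicator (A j) (snd p) * indicator N (fst p) :: ennreal) \<in> borel_measurable \<rho>"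
      using 1 2 by simp
  qed
  also have "\<dots> \<le> (\<integral>\<^sup>+p. indicator N (fst p) \<partial>\<rho>)"
  proof (rule nn_integral_mono)
    fix p :: "'a \<times> 'a"
    have "(\<Sum>j<J. indicator (A j) (snd p) :: ennreal) = indicator (\<Union>j<J. A j) (snd p)"
      using A(2) by (subst indicator_UN_disjoint) (auto intro: disjoint_family_on_mono)
    also have "\<dots> \<le> 1" by (simp add: indicator_def)
    finally have "(\<Sum>j<J. indicator (A j) (snd p) :: ennreal) * indicator N (fst p) \<le> 1 * indicator N (fst p)"
      by (rule mult_right_mono) simp
    then show "(\<Sum>j<J. indicator (A j) (snd p) * indicator N (fst p) :: ennreal) \<le> indicator N (fst p)"
      by (simp add: sum_distrib_right)
  qed
  also have "\<dots> = (\<integral>\<^sup>+x. indicator N x \<partial>\<mu>)"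
    unfolding \<mu>_def first_marg_def by (intro nn_integral_distr[OF fs(1), symmetric]) simp
  finally have le: "(\<integral>\<^sup>+x. ennreal (s x) * indicator N x \<partial>\<mu>) \<le> (\<integral>\<^sup>+x. indicator N x \<partial>\<mu>)" .
  have "ennreal (s x) * indicator N x = indicator N x + ennreal (s x - 1) * indicator N x" for x
  proof (cases "x \<in> N")
    case True
    have "ennreal (s x) = ennreal (1 + (s x - 1))" by simp
    also have "\<dots> = 1 + ennreal (s x - 1)"
      using True by (subst ennreal_plus) (auto simp: N_def)
    finally show ?thesis using True by simp
  qed simp
  then have "(\<integral>\<^sup>+x. ennreal (s x) * indicator N x \<partial>\<mu>) = (\<integral>\<^sup>+x. indicator N x \<partial>\<mu>) + (\<integral>\<^sup>+x. ennreal (s x - 1) * indicator N x \<partial>\<mu>)"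
    by (simp add: nn_integral_add m\<mu> del: nn_integral_indicator)
  moreover have "(\<integral>\<^sup>+x. indicator N x \<partial>\<mu>) \<noteq> \<infinity>"
    using ms by (simp add: M.emeasure_eq_measure)
  ultimately have "(\<integral>\<^sup>+x. ennreal (s x - 1) * indicator N x \<partial>\<mu>) = 0"
    using le by (cases "(\<integral>\<^sup>+x. ennreal (s x - 1) * indicator N x \<partial>\<mu>)"; cases "(\<integral>\<^sup>+x. indicator N x \<partial>\<mu>)")
      (auto simp: top_unique simp flip: ennreal_plus)
  then have "AE x in \<mu>. ennreal (s x - 1) * indicator N x = 0"
    by (subst (asm) nn_integral_0_iff_AE) (simp_all add: m\<mu>)
  then have AE: "AE x in \<mu>. s x \<le> 1"
    by eventually_elim (auto simp: N_def indicator_def not_less ennreal_eq_0_iff split: if_splits)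
  define w' where "w' j x = w j x * indicator {x. s x \<le> 1} x" for j x
  show ?thesis
  proof (rule that[of w'])
    show "w' j \<in> borel_measurable borel" for j unfolding w'_def by measurable
    show "0 \<le> w' j x" for j x using w(2) by (simp add: w'_def)
    show "(\<Sum>j<J. w' j x) \<le> 1" for x
      unfolding w'_def sum_distrib_right[symmetric] s_def[symmetric] by (simp add: indicator_def)
    fix j and u :: "'a \<Rightarrow> ennreal" assume u: "u \<in> borel_measurable borel"
    have "(\<integral>\<^sup>+x. ennreal (w' j x) * u x \<partial>\<mu>) = (\<integral>\<^sup>+x. ennreal (w j x) * u x \<partial>\<mu>)"
      by (rule nn_integral_cong_AE) (use AE in eventually_elim, simp add: w'_def)
    then show "(\<integral>\<^sup>+x. ennreal (w' j x) * u x \<partial>first_marg \<rho>) = (\<integral>\<^sup>+p. indicator (A j) (snd p) * u (fst p) \<partial>\<rho>)"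
      using w(3)[OF u] by (simp add: \<mu>_def)
  qed
qed

text \<open>The law obtained by moving, at $x$, the mass $u_j(x)$ to $K_x$ conditioned on $C_j$ and
  leaving the remaining mass distributed as $K_x$.\<close>

lemma conditioned_mixture:
  fixes \<mu> :: "'a::euclidean_space measure" and u :: "nat \<Rightarrow> 'a \<Rightarrow> real"
  assumes mu: "prob_borel \<mu>" and K: "K \<in> borel \<rightarrow>\<^sub>M subprob_algebra borel" and P: "\<And>x. prob_borel (K x)"
    and C: "\<And>j. C j \<in> sets borel"
    and u: "\<And>j. u j \<in> borel_measurable borel" "\<And>j x. 0 \<le> u j x" "\<And>x. (\<Sum>j<J. u j x) \<le> 1"
    and pos: "\<And>j x. u j x \<noteq> 0 \<Longrightarrow> 0 < measure (K x) (C j)"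
  obtains \<sigma> where "prob_borel \<sigma>" "first_marg \<sigma> = \<mu>"
    "rel_entropy \<sigma> (kernel_prod \<mu> K) \<le> enn2ereal (\<integral>\<^sup>+x. (\<Sum>j<J. ennreal (u j x * - ln (measure (K x) (C j)))) \<partial>\<mu>)"
    "\<And>F :: 'a \<times> 'a \<Rightarrow> ennreal. F \<in> borel_measurable borel \<Longrightarrow> (\<integral>\<^sup>+p. F p \<partial>\<sigma>) =
      (\<integral>\<^sup>+x. ennreal (1 - (\<Sum>j<J. u j x)) * (\<integral>\<^sup>+y. F (x, y) \<partial>K x)
        + (\<Sum>j<J. ennreal (u j x) * (\<integral>\<^sup>+y. ennreal (indicator (C j) y / measure (K x) (C j)) * F (x, y) \<partial>K x)) \<partial>\<mu>)"
proof -
  define pr where "pr j x = measure (K x) (C j)" for j x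
  have prm [measurable]: "pr j \<in> borel_measurable borel" for j
    unfolding pr_def using measurable_compose[OF K measurable_measure_subprob_algebra] C by simp
  note [measurable] = u(1) C
  define \<pi> where "\<pi> = kernel_prod \<mu> K"
  have \<pi>: "prob_borel \<pi>" unfolding \<pi>_def by (rule prob_borel_kernel_prod[OF mu K P])
  define v where "v x = 1 - (\<Sum>j<J. u j x)" for x
  have v0: "0 \<le> v x" for x using u(3)[of x] by (simp add: v_def)
  have vm [measurable]: "v \<in> borel_measurable borel" unfolding v_def by measurable
  \<comment> \<open>The density with respect to \<open>K x\<close> of its conditioning on
    \<open>C j\<close>. If \<open>pr j x = 0\<close> the quotient is 0 by convention, and
    \<open>pos\<close> makes the weight \<open>u j x\<close> vanish there.\<close>
  define t where "t j p = indicator (C j) (snd p) / pr j (fst p)" for j and p :: "'a \<times> 'a"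
  have t0: "0 \<le> t j p" for j p by (simp add: t_def pr_def)
  have tm: "t j \<in> borel_measurable borel" for j
    unfolding t_def[abs_def] borel_prod[symmetric] by measurable
  \<comment> \<open>Density of the mixture with respect to \<open>kernel_prod \<mu> K\<close>, in
    the shape that \<open>mult_ln_convex_sum\<close> treats: the unmoved mass \<open>v\<close> sits
    at density 1.\<close>
  define D where "D p = v (fst p) + (\<Sum>j<J. u j (fst p) * t j p)" for p
  have D0: "0 \<le> D p" for p unfolding D_def using v0 u(2) t0 by (intro add_nonneg_nonneg sum_nonneg) auto
  have um: "(\<lambda>p. u j (fst p)) \<in> borel_measurable (borel :: ('a \<times> 'a) measure)" for j
    unfolding borel_prod[symmetric] by measurable
  have vfm: "(\<lambda>p. v (fst p)) \<in> borel_measurable (borel :: ('a \<times> 'a) measure)"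
    unfolding borel_prod[symmetric] by measurable
  have Dm: "D \<in> borel_measurable borel"
    unfolding D_def[abs_def] using um vfm tm by (intro borel_measurable_add borel_measurable_sum borel_measurable_times)
  have \<pi>m: "f \<in> borel_measurable borel \<Longrightarrow> f \<in> borel_measurable \<pi>" for f :: "'a \<times> 'a \<Rightarrow> real"
    using prob_borelD(2)[OF \<pi>] by (simp add: measurable_cong_sets[of \<pi> borel])
  have Km: "f \<in> borel_measurable borel \<Longrightarrow> f \<in> borel_measurable (K x)" for f :: "'a \<Rightarrow> ennreal" and x
    using prob_borelD(2)[OF P] by (simp add: measurable_cong_sets[of "K x" borel])
  have sec: "(\<lambda>y. f (x, y)) \<in> borel_measurable borel" if "f \<in> borel_measurable borel"
    for f :: "'a \<times> 'a \<Rightarrow> ennreal" and x using that by (simp flip: borel_prod)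
  define \<sigma> where "\<sigma> = density \<pi> (\<lambda>p. ennreal (D p))"
  have \<sigma>s: "sets \<sigma> = sets borel" using prob_borelD(2)[OF \<pi>] by (simp add: \<sigma>_def)
  have Deq: "ennreal (D (x, y)) = ennreal (v x) + (\<Sum>j<J. ennreal (u j x) * ennreal (t j (x, y)))" for x y
    unfolding D_def using v0 u(2) t0
    by (simp add: ennreal_plus sum_nonneg ennreal_mult flip: sum_ennreal)
  have int: "(\<integral>\<^sup>+p. F p \<partial>\<sigma>) = (\<integral>\<^sup>+x. ennreal (v x) * (\<integral>\<^sup>+y. F (x, y) \<partial>K x)
        + (\<Sum>j<J. ennreal (u j x) * (\<integral>\<^sup>+y. ennreal (t j (x, y)) * F (x, y) \<partial>K x)) \<partial>\<mu>)"
    if F: "F \<in> borel_measurable borel" for F :: "'a \<times> 'a \<Rightarrow> ennreal"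
  proof -
    have tF: "(\<lambda>y. ennreal (t j (x, y)) * F (x, y)) \<in> borel_measurable borel" for j x
      using tm[of j] F sec[of "\<lambda>p. ennreal (t j p) * F p" x] by simp
    have "(\<integral>\<^sup>+p. F p \<partial>\<sigma>) = (\<integral>\<^sup>+p. ennreal (D p) * F p \<partial>\<pi>)"
      unfolding \<sigma>_def using Dm F prob_borelD(2)[OF \<pi>]
      by (intro nn_integral_density) (auto simp: measurable_cong_sets[of \<pi> borel])
    also have "\<dots> = (\<integral>\<^sup>+x. \<integral>\<^sup>+y. ennreal (D (x, y)) * F (x, y) \<partial>K x \<partial>\<mu>)"
      unfolding \<pi>_def using Dm F by (intro nn_integral_kernel_prod[OF mu K]) auto
    also have "\<dots> = (\<integral>\<^sup>+x. ennreal (v x) * (\<integral>\<^sup>+y. F (x, y) \<partial>K x)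
        + (\<Sum>j<J. ennreal (u j x) * (\<integral>\<^sup>+y. ennreal (t j (x, y)) * F (x, y) \<partial>K x)) \<partial>\<mu>)"
    proof (rule nn_integral_cong)
      fix x
      have m1: "(\<lambda>y. ennreal (v x) * F (x, y)) \<in> borel_measurable (K x)"
        by (rule borel_measurable_times_ennreal[OF borel_measurable_const Km[OF sec[OF F]]])
      have m2: "(\<lambda>y. ennreal (u j x) * (ennreal (t j (x, y)) * F (x, y))) \<in> borel_measurable (K x)" for j
        by (rule borel_measurable_times_ennreal[OF borel_measurable_const Km[OF tF]])
      have "(\<integral>\<^sup>+y. ennreal (D (x, y)) * F (x, y) \<partial>K x)
          = (\<integral>\<^sup>+y. ennreal (v x) * F (x, y) + (\<Sum>j<J. ennreal (u j x) * (ennreal (t j (x, y)) * F (x, y))) \<partial>K x)"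
        unfolding Deq by (simp add: distrib_right sum_distrib_right mult.assoc)
      also have "\<dots> = (\<integral>\<^sup>+y. ennreal (v x) * F (x, y) \<partial>K x)
          + (\<integral>\<^sup>+y. (\<Sum>j<J. ennreal (u j x) * (ennreal (t j (x, y)) * F (x, y))) \<partial>K x)"
        by (rule nn_integral_add[OF m1 borel_measurable_sum[OF m2]])
      also have "(\<integral>\<^sup>+y. (\<Sum>j<J. ennreal (u j x) * (ennreal (t j (x, y)) * F (x, y))) \<partial>K x)
          = (\<Sum>j<J. \<integral>\<^sup>+y. ennreal (u j x) * (ennreal (t j (x, y)) * F (x, y)) \<partial>K x)"
        by (rule nn_integral_sum[OF m2])
      finally show "(\<integral>\<^sup>+y. ennreal (D (x, y)) * F (x, y) \<partial>K x) = ennreal (v x) * (\<integral>\<^sup>+y. F (x, y) \<partial>K x)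
        + (\<Sum>j<J. ennreal (u j x) * (\<integral>\<^sup>+y. ennreal (t j (x, y)) * F (x, y) \<partial>K x))"
        using Km[OF sec[OF F]] Km[OF tF] by (simp add: nn_integral_cmult)
    qed
    finally show ?thesis .
  qed
  have t1: "ennreal (u j x) * (\<integral>\<^sup>+y. ennreal (t j (x, y)) \<partial>K x) = ennreal (u j x)" for j x
  proof (cases "u j x = 0")
    case False
    then have p: "0 < pr j x" unfolding pr_def by (rule pos)
    interpret prob_space "K x" using prob_borelD(1)[OF P] .
    have "(\<integral>\<^sup>+y. ennreal (t j (x, y)) \<partial>K x) = (\<integral>\<^sup>+y. ennreal (1 / pr j x) * indicator (C j) y \<partial>K x)"
      by (intro nn_integral_cong) (auto simp: t_def indicator_def)
    also have "\<dots> = ennreal (1 / pr j x) * emeasure (K x) (C j)"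
      using C prob_borelD(2)[OF P] by (intro nn_integral_cmult_indicator) auto
    also have "\<dots> = 1" using p by (simp add: emeasure_eq_measure pr_def flip: ennreal_mult)
    finally show ?thesis by simp
  qed simp
  have ek: "emeasure (K x) (space (K x)) = 1" for x
    using prob_space.emeasure_space_1[OF prob_borelD(1)[OF P]] .
  have fmint: "(\<integral>\<^sup>+p. indicator A (fst p) \<partial>\<sigma>) = (\<integral>\<^sup>+x. indicator A x \<partial>\<mu>)" if A: "A \<in> sets borel" for A
  proof -
    have "(\<lambda>p. indicator A (fst p) :: ennreal) \<in> borel_measurable (borel :: ('a \<times> 'a) measure)"
      using A unfolding borel_prod[symmetric] by simp
    then have "(\<integral>\<^sup>+p. indicator A (fst p) \<partial>\<sigma>) = (\<integral>\<^sup>+x. ennreal (v x) * (\<integral>\<^sup>+y. indicator A x \<partial>K x)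
        + (\<Sum>j<J. ennreal (u j x) * (\<integral>\<^sup>+y. ennreal (t j (x, y)) * indicator A x \<partial>K x)) \<partial>\<mu>)"
      using int[of "\<lambda>p. indicator A (fst p)"] by simp
    also have "\<dots> = (\<integral>\<^sup>+x. indicator A x \<partial>\<mu>)"
    proof (rule nn_integral_cong)
      fix x
      show "ennreal (v x) * (\<integral>\<^sup>+y. indicator A x \<partial>K x)
        + (\<Sum>j<J. ennreal (u j x) * (\<integral>\<^sup>+y. ennreal (t j (x, y)) * indicator A x \<partial>K x)) = indicator A x"
      proof (cases "x \<in> A")
        case True
        have "ennreal (v x) + (\<Sum>j<J. ennreal (u j x)) = ennreal (v x + (\<Sum>j<J. u j x))"
          using v0 u(2) by (simp add: ennreal_plus sum_nonneg)
        also have "\<dots> = 1" by (simp add: v_def)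
        finally show ?thesis using True by (simp add: ek t1)
      qed simp
    qed
    finally show ?thesis .
  qed
  have "emeasure \<sigma> (space \<sigma>) = (\<integral>\<^sup>+p. indicator UNIV (fst p) \<partial>\<sigma>)" by simp
  also have "\<dots> = 1" using fmint[of UNIV] prob_space.emeasure_space_1[OF prob_borelD(1)[OF mu]] by simp
  finally have ps: "prob_space \<sigma>" by (rule prob_spaceI)
  then have \<sigma>: "prob_borel \<sigma>" by (simp add: prob_borel_def \<sigma>s)
  have fm: "first_marg \<sigma> = \<mu>"
  proof (rule measure_eqI)
    show "sets (first_marg \<sigma>) = sets \<mu>" using prob_borelD(2)[OF mu] by (simp add: first_marg_def)
    fix A assume "A \<in> sets (first_marg \<sigma>)"
    then have A: "A \<in> sets borel" by (simp add: first_marg_def)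
    have "emeasure (first_marg \<sigma>) A = (\<integral>\<^sup>+x. indicator A x \<partial>first_marg \<sigma>)" using A by (simp add: first_marg_def)
    also have "\<dots> = (\<integral>\<^sup>+p. indicator A (fst p) \<partial>\<sigma>)"
      unfolding first_marg_def using A by (intro nn_integral_distr measurable_fst_borel(1)[OF \<sigma>]) simp
    also have "\<dots> = emeasure \<mu> A" using fmint[OF A] A prob_borelD(2)[OF mu] by simp
    finally show "emeasure (first_marg \<sigma>) A = emeasure \<mu> A" .
  qed
  have pr1: "pr j x \<le> 1" for j x
    unfolding pr_def using prob_space.prob_le_1[OF prob_borelD(1)[OF P]] .
  define U where "U p = (\<Sum>j<J. u j (fst p) * (t j p * ln (t j p)))" for p
  have DU: "D p * ln (D p) \<le> U p" for p
    unfolding D_def v_def U_def by (rule mult_ln_convex_sum[OF u(2) u(3) t0])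
  have "rel_entropy \<sigma> \<pi> \<le> enn2ereal (\<integral>\<^sup>+p. ennreal (U p) \<partial>\<pi>)"
    unfolding \<sigma>_def using ps
    by (intro rel_entropy_density_le[OF prob_borelD(1)[OF \<pi>] \<pi>m[OF Dm] D0 _ DU]) (simp add: \<sigma>_def)
  also have "(\<integral>\<^sup>+p. ennreal (U p) \<partial>\<pi>) \<le> (\<integral>\<^sup>+x. (\<Sum>j<J. ennreal (u j x * - ln (pr j x))) \<partial>\<mu>)"
  proof -
    \<comment> \<open>\<open>t j\<close> takes only the values 0 and \<open>1 / pr j x\<close>, so
      \<open>t * ln t\<close> is \<open>t\<close> times \<open>- ln (pr j x)\<close>, and
      integration over \<open>K x\<close> leaves the conditioning cost.\<close>
    have Ueq: "U (x, y) = (\<Sum>j<J. (u j x * - ln (pr j x)) * t j (x, y))" for x y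
      unfolding U_def
    proof (intro sum.cong refl)
      fix j
      show "u j (fst (x, y)) * (t j (x, y) * ln (t j (x, y))) = (u j x * - ln (pr j x)) * t j (x, y)"
        by (cases "y \<in> C j"; cases "pr j x = 0")
          (auto simp: t_def ln_div pr_def zero_less_measure_iff less_le)
    qed
    have nn: "0 \<le> u j x * - ln (pr j x)" for j x
    proof (cases "u j x = 0")
      case False
      then have "0 < pr j x" unfolding pr_def by (rule pos)
      then have "ln (pr j x) \<le> 0" using pr1[of j x] by simp
      then show ?thesis using u(2)[of j x] by (simp add: mult_nonneg_nonpos)
    qed simp
    have Um: "U \<in> borel_measurable borel"
      unfolding U_def[abs_def] using um tm by simp
    have "(\<integral>\<^sup>+p. ennreal (U p) \<partial>\<pi>) = (\<integral>\<^sup>+x. \<integral>\<^sup>+y. ennreal (U (x, y)) \<partial>K x \<partial>\<mu>)"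
      unfolding \<pi>_def using Um by (intro nn_integral_kernel_prod[OF mu K]) auto
    also have "\<dots> \<le> (\<integral>\<^sup>+x. (\<Sum>j<J. ennreal (u j x * - ln (pr j x))) \<partial>\<mu>)"
    proof (rule nn_integral_mono)
      fix x
      have tK: "(\<lambda>y. ennreal (t j (x, y))) \<in> borel_measurable (K x)" for j
        using Km[OF sec[of "\<lambda>p. ennreal (t j p)" x]] tm[of j] by simp
      have "(\<integral>\<^sup>+y. ennreal (U (x, y)) \<partial>K x) = (\<integral>\<^sup>+y. (\<Sum>j<J. ennreal (u j x * - ln (pr j x)) * ennreal (t j (x, y))) \<partial>K x)"
      proof (rule nn_integral_cong)
        fix y
        have "ennreal (U (x, y)) = (\<Sum>j<J. ennreal ((u j x * - ln (pr j x)) * t j (x, y)))"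
          unfolding Ueq by (rule sum_ennreal[symmetric]) (rule mult_nonneg_nonneg[OF nn t0])
        also have "\<dots> = (\<Sum>j<J. ennreal (u j x * - ln (pr j x)) * ennreal (t j (x, y)))"
          by (intro sum.cong refl ennreal_mult nn t0)
        finally show "ennreal (U (x, y)) = (\<Sum>j<J. ennreal (u j x * - ln (pr j x)) * ennreal (t j (x, y)))" .
      qed
      also have "\<dots> = (\<Sum>j<J. ennreal (u j x * - ln (pr j x)) * (\<integral>\<^sup>+y. ennreal (t j (x, y)) \<partial>K x))"
        by (subst nn_integral_sum) (intro borel_measurable_times_ennreal borel_measurable_const tK sum.cong refl nn_integral_cmult)+
      also have "\<dots> \<le> (\<Sum>j<J. ennreal (u j x * - ln (pr j x)))"
      proof (rule sum_mono)
        fix j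
        show "ennreal (u j x * - ln (pr j x)) * (\<integral>\<^sup>+y. ennreal (t j (x, y)) \<partial>K x) \<le> ennreal (u j x * - ln (pr j x))"
        proof (cases "u j x = 0")
          case False
          then have "0 < pr j x" unfolding pr_def by (rule pos)
          then have l: "0 \<le> - ln (pr j x)" using pr1[of j x] by simp
          have "ennreal (u j x * - ln (pr j x)) * (\<integral>\<^sup>+y. ennreal (t j (x, y)) \<partial>K x)
              = ennreal (- ln (pr j x)) * (ennreal (u j x) * (\<integral>\<^sup>+y. ennreal (t j (x, y)) \<partial>K x))"
            unfolding ennreal_mult[OF u(2) l] by (simp only: mult_ac)
          also have "\<dots> = ennreal (u j x * - ln (pr j x))"
            unfolding t1 ennreal_mult[OF u(2) l] by (simp only: mult_ac)
          finally show ?thesis by simp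
        qed simp
      qed
      finally show "(\<integral>\<^sup>+y. ennreal (U (x, y)) \<partial>K x) \<le> (\<Sum>j<J. ennreal (u j x * - ln (pr j x)))" .
    qed
    finally show ?thesis .
  qed
  finally have "rel_entropy \<sigma> \<pi> \<le> enn2ereal (\<integral>\<^sup>+x. (\<Sum>j<J. ennreal (u j x * - ln (pr j x))) \<partial>\<mu>)"
    by (simp add: less_eq_ennreal.rep_eq)
  with \<sigma> fm int show ?thesis
    by (intro that[of \<sigma>]) (simp_all add: pr_def \<pi>_def v_def t_def)
qed

section \<open>The upper bound\<close>

context ldp_family begin

text \<open>A substitute, Borel in \<open>x\<close>, for the infimum of \<open>c x\<close> over
  \<open>C\<close>; for open \<open>C\<close> it is at most that infimum, by the large deviation
  lower bound. Log-probabilities are nonpositive, so the conversion to \<open>ennreal\<close>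
  truncates nothing.\<close>

definition lower_rate :: "'a set \<Rightarrow> 'a \<Rightarrow> ennreal" where
  "lower_rate C x = e2ennreal (- liminf (\<lambda>k. ereal (1 / real k) * eln (measure (L k x) C)))"

lemma lower_rate_measurable: "C \<in> sets borel \<Longrightarrow> lower_rate C \<in> borel_measurable borel"
proof -
  assume "C \<in> sets borel"
  then have [measurable]: "(\<lambda>x. measure (L k x) C) \<in> borel_measurable borel" for k by (rule measurable_law)
  have "(\<lambda>x. ereal (1 / real k) * eln (measure (L k x) C)) \<in> borel_measurable borel" for k by measurable
  then show ?thesis unfolding lower_rate_def[abs_def]
    by (intro measurable_compose[OF _ measurable_e2ennreal] borel_measurable_uminus_ereal borel_measurable_liminf)
qed

lemma lower_rate_le:
  assumes "open C" "y \<in> C"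
  shows "lower_rate C x \<le> c x y"
proof -
  have "- (INF y\<in>C. enn2ereal (c x y)) \<le> liminf (\<lambda>k. ereal (1 / real k) * eln (measure (L k x) C))"
    using ldp[of x] assms(1) unfolding k_ldp_def by blast
  then have "- liminf (\<lambda>k. ereal (1 / real k) * eln (measure (L k x) C)) \<le> (INF y\<in>C. enn2ereal (c x y))"
    by (metis ereal_minus_le_minus ereal_uminus_uminus)
  also have "\<dots> \<le> enn2ereal (c x y)" using assms(2) by (rule INF_lower)
  finally have "lower_rate C x \<le> e2ennreal (enn2ereal (c x y))"
    unfolding lower_rate_def by (rule e2ennreal_mono)
  then show ?thesis by simp
qed

text \<open>A finite rate excludes probability zero for large \<open>k\<close>, since the scaled
  logarithm would then be \<open>-\<infinity>\<close>.\<close>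

lemma lower_rate_eventually:
  assumes fin: "lower_rate C x \<noteq> \<infinity>" and "(r :: real) > 0"
  shows "\<forall>\<^sub>F k in sequentially. 0 < measure (L k x) C \<and> ennreal (- ln (measure (L k x) C) / real k) \<le> lower_rate C x + ennreal r"
proof -
  define l where "l = liminf (\<lambda>k. ereal (1 / real k) * eln (measure (L k x) C))"
  obtain b where b: "lower_rate C x = ennreal b" "0 \<le> b" using fin by (cases "lower_rate C x") auto
  have "- l \<le> enn2ereal (e2ennreal (- l))"
    by (cases "0 \<le> - l") (auto simp: enn2ereal_e2ennreal intro: order_trans[OF _ enn2ereal_nonneg])
  also have "\<dots> = ereal b" using b by (simp add: lower_rate_def l_def)
  finally have "- ereal b \<le> l" by (simp only: ereal_uminus_le_reorder)
  moreover have "ereal (- (b + r)) < - ereal b" using \<open>r > 0\<close> by simp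
  ultimately have "ereal (- (b + r)) < l" by (rule less_le_trans[rotated])
  then have "\<forall>\<^sub>F k in sequentially. ereal (- (b + r)) < ereal (1 / real k) * eln (measure (L k x) C)"
    unfolding l_def by (rule less_LiminfD)
  then show ?thesis
    using eventually_gt_at_top[of 0]
  proof eventually_elim
    case (elim k)
    have p: "0 < measure (L k x) C"
    proof (rule ccontr)
      assume "\<not> 0 < measure (L k x) C"
      then have "eln (measure (L k x) C) = - \<infinity>" by (simp add: eln_def)
      then show False using elim by simp
    qed
    then have "- (b + r) < ln (measure (L k x) C) / real k" using elim(1) by (simp add: eln_def)
    then have "- ln (measure (L k x) C) / real k \<le> b + r" by simp
    then have "ennreal (- ln (measure (L k x) C) / real k) \<le> ennreal (b + r)" by (rule ennreal_leI)
    then show ?case using p b \<open>r > 0\<close> by (simp add: b(1))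
  qed
qed

text \<open>The large deviation lower bound holds from some \<open>k\<close> on that depends on
  \<open>x\<close>. For fixed \<open>k\<close> the weights are therefore cut down to the sets
  \<open>Gd k j\<close> where it already holds up to \<open>r\<close>; the mass so released,
  together with that outside the first \<open>J\<close> cells, has \<mu>-integral below
  \<open>r\<close> for large \<open>k\<close>. It stays with the law at \<open>x\<close> and adds
  nothing to the entropy bound. Uniformity over test functions in the conclusion is what the later
  diagonal choice uses.\<close>

theorem recovery_measure:
  assumes \<rho>: "prob_borel \<rho>" "first_marg \<rho> = \<mu>"
    and fin: "(\<integral>\<^sup>+p. c (fst p) (snd p) \<partial>\<rho>) \<noteq> \<infinity>" and \<delta>: "(\<delta> :: real) > 0"
  shows "\<forall>\<^sub>F k in sequentially. \<exists>\<sigma>. prob_borel \<sigma> \<and> first_marg \<sigma> = \<mu> \<and>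
    ereal (1 / real k) * rel_entropy \<sigma> (ref_meas \<mu> L k) \<le> enn2ereal (\<integral>\<^sup>+p. c (fst p) (snd p) \<partial>\<rho>) + ereal \<delta> \<and>
    (\<forall>f. (\<forall>p. \<bar>f p\<bar> \<le> 1) \<longrightarrow> (\<forall>p q. \<bar>f p - f q\<bar> \<le> dist p q) \<longrightarrow> \<bar>(\<integral>p. f p \<partial>\<sigma>) - (\<integral>p. f p \<partial>\<rho>)\<bar> \<le> \<delta>)"
proof -
  interpret M: prob_space \<mu> using prob_borelD(1)[OF mu] .
  interpret R: prob_space \<rho> using prob_borelD(1)[OF \<rho>(1)] .
  note ms = prob_borelD(2)[OF mu]
  note rs = prob_borelD(2)[OF \<rho>(1)]
  have m\<mu>: "f \<in> borel_measurable borel \<Longrightarrow> f \<in> borel_measurable \<mu>" for f :: "'a \<Rightarrow> ennreal"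
    using ms by (simp add: measurable_cong_sets[of \<mu> borel])
  have m\<mu>r: "f \<in> borel_measurable borel \<Longrightarrow> f \<in> borel_measurable \<mu>" for f :: "'a \<Rightarrow> real"
    using ms by (simp add: measurable_cong_sets[of \<mu> borel])
  have m\<rho>: "f \<in> borel_measurable borel \<Longrightarrow> f \<in> borel_measurable \<rho>" for f :: "'a \<times> 'a \<Rightarrow> ennreal"
    using rs by (simp add: measurable_cong_sets[of \<rho> borel])
  \<comment> \<open>The entropy bound overshoots by \<open>r\<close>, and a test function with
    values in [0, 2] errs by at most \<open>4 * r\<close>: twice the unmoved mass, plus
    \<open>r\<close> from a conditioned law to the centre \<open>q j\<close>, plus \<open>r\<close>
    from the centre back to the cell.\<close>
  define r where "r = \<delta> / 8"
  have r: "r > 0" using \<delta> by (simp add: r_def)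
  obtain Q :: "'a set" where Q: "countable Q" "\<And>X. open X \<Longrightarrow> X \<noteq> {} \<Longrightarrow> \<exists>d\<in>Q. d \<in> X"
    using countable_dense_setE by blast
  define q where "q = from_nat_into Q"
  define C where "C j = ball (q j) r" for j
  have Co: "open (C j)" and Cb [measurable]: "C j \<in> sets borel" for j by (simp_all add: C_def)
  \<comment> \<open>The disjoint cells \<open>A j\<close> carry the weights, so that these add up to
    at most 1. Conditioning is on the balls \<open>C j\<close>, because the large deviation lower
    bound concerns open sets.\<close>
  define A where "A = disjointed C"
  have AC: "A j \<subseteq> C j" for j unfolding A_def by (rule disjointed_subset)
  have Ad: "disjoint_family A" unfolding A_def by (rule disjoint_family_disjointed)
  have Ab [measurable]: "A j \<in> sets borel" for j
    unfolding A_def using sets.range_disjointed_sets[of C borel] Cb by blast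
  have AU: "(\<Union>j. A j) = UNIV"
  proof -
    have "\<exists>j. y \<in> C j" for y
    proof -
      obtain d where d: "d \<in> Q" "d \<in> ball y r" using Q(2)[of "ball y r"] r by auto
      then obtain j where "q j = d" using from_nat_into_surj[OF Q(1)] unfolding q_def by blast
      then show ?thesis using d by (auto simp: C_def dist_commute)
    qed
    then show ?thesis unfolding A_def UN_disjointed_eq by blast
  qed
  \<comment> \<open>The event of landing in the first \<open>J\<close> cells. Finitely many cells
    capture all but mass \<open>r\<close>, and with finitely many a single large \<open>k\<close>
    can serve all cells at a given \<open>x\<close>.\<close>
  define X where "X J = {p :: 'a \<times> 'a. snd p \<in> (\<Union>j<J. A j)}" for J
  have Xb: "X J \<in> sets \<rho>" for J
  proof -
    have "X J = UNIV \<times> (\<Union>j<J. A j)" by (auto simp: X_def)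
    then show ?thesis unfolding rs by (auto intro!: borel_Times)
  qed
  have "(\<lambda>J. measure \<rho> (X J)) \<longlonglongrightarrow> measure \<rho> (\<Union>J. X J)"
    using Xb by (intro R.finite_Lim_measure_incseq) (auto simp: X_def incseq_def intro: less_le_trans)
  also have "(\<Union>J. X J) = UNIV"
  proof -
    have "p \<in> (\<Union>J. X J)" for p
    proof -
      obtain j where "snd p \<in> A j" using AU by blast
      then have "p \<in> X (Suc j)" by (auto simp: X_def)
      then show ?thesis by blast
    qed
    then show ?thesis by blast
  qed
  also have "measure \<rho> UNIV = 1" using R.prob_space prob_borelD(3)[OF \<rho>(1)] by simp
  finally have "\<forall>\<^sub>F J in sequentially. 1 - r < measure \<rho> (X J)" using r by (intro order_tendstoD) auto
  from eventually_happens'[OF sequentially_bot this]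
  obtain J where J: "1 - r < measure \<rho> (X J)" by blast
  have sumA: "(\<Sum>j<J. indicator (A j) y :: ennreal) = indicator (\<Union>j<J. A j) y" for y
    using Ad by (subst indicator_UN_disjoint) (auto intro: disjoint_family_on_mono)
  obtain w :: "nat \<Rightarrow> 'a \<Rightarrow> real" where w: "\<And>j. w j \<in> borel_measurable borel" "\<And>j x. 0 \<le> w j x"
    "\<And>x. (\<Sum>j<J. w j x) \<le> 1"
    "\<And>j u. (u :: 'a \<Rightarrow> ennreal) \<in> borel_measurable borel \<Longrightarrow>
      (\<integral>\<^sup>+x. ennreal (w j x) * u x \<partial>\<mu>) = (\<integral>\<^sup>+p. indicator (A j) (snd p) * u (fst p) \<partial>\<rho>)"
    by (rule conditional_weights[OF \<rho>(1) Ab Ad, unfolded \<rho>(2)]) (rule that)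
  note [measurable] = w(1)
  define B where "B j = lower_rate (C j)" for j
  have Bm [measurable]: "B j \<in> borel_measurable borel" for j
    unfolding B_def by (rule lower_rate_measurable[OF Cb])
  have Bc: "B j x \<le> c x y" if "y \<in> A j" for j x y
    unfolding B_def using AC that by (intro lower_rate_le[OF Co]) auto
  have mfs: "(\<lambda>p. indicator (A j) (snd p) * g (fst p)) \<in> borel_measurable \<rho>"
    if [measurable]: "g \<in> borel_measurable borel" for j and g :: "'a \<Rightarrow> ennreal"
  proof (rule m\<rho>)
    show "(\<lambda>p. indicator (A j) (snd p) * g (fst p)) \<in> borel_measurable borel"
      unfolding borel_prod[symmetric] by measurable
  qed
  define Cst where "Cst = (\<integral>\<^sup>+p. c (fst p) (snd p) \<partial>\<rho>)"
  \<comment> \<open>For \<open>y\<close> in \<open>A j\<close>, a subset of \<open>C j\<close>, the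
    rate \<open>B j x\<close> is at most \<open>c x y\<close>; the expected rate under the weights
    is thus at most the transport cost.\<close>
  have cost: "(\<Sum>j<J. \<integral>\<^sup>+x. ennreal (w j x) * B j x \<partial>\<mu>) \<le> Cst"
  proof -
    have "(\<Sum>j<J. \<integral>\<^sup>+x. ennreal (w j x) * B j x \<partial>\<mu>) = (\<Sum>j<J. \<integral>\<^sup>+p. indicator (A j) (snd p) * B j (fst p) \<partial>\<rho>)"
      by (intro sum.cong refl w(4) Bm)
    also have "\<dots> = (\<integral>\<^sup>+p. (\<Sum>j<J. indicator (A j) (snd p) * B j (fst p)) \<partial>\<rho>)"
      by (rule nn_integral_sum[symmetric]) (rule mfs[OF Bm])
    also have "\<dots> \<le> Cst"
      unfolding Cst_def
    proof (rule nn_integral_mono)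
      fix p :: "'a \<times> 'a"
      have "(\<Sum>j<J. indicator (A j) (snd p) * B j (fst p)) \<le> (\<Sum>j<J. indicator (A j) (snd p) * c (fst p) (snd p))"
        using Bc by (intro sum_mono) (auto simp: indicator_def)
      also have "\<dots> = (\<Sum>j<J. indicator (A j) (snd p)) * c (fst p) (snd p)" by (rule sum_distrib_right[symmetric])
      also have "\<dots> \<le> 1 * c (fst p) (snd p)"
        unfolding sumA by (intro mult_right_mono) (auto simp: indicator_def)
      finally show "(\<Sum>j<J. indicator (A j) (snd p) * B j (fst p)) \<le> c (fst p) (snd p)" by simp
    qed
    finally show ?thesis .
  qed
  \<comment> \<open>Finite cost forces finite rates almost everywhere that a weight is positive, so
    that such an \<open>x\<close> enters \<open>Gd k j\<close> for large \<open>k\<close>.\<close>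
  have Bfin: "AE x in \<mu>. \<forall>j<J. w j x = 0 \<or> B j x \<noteq> \<infinity>"
  proof -
    have "AE x in \<mu>. w j x = 0 \<or> B j x \<noteq> \<infinity>" if "j < J" for j
    proof -
      have "(\<integral>\<^sup>+x. ennreal (w j x) * B j x \<partial>\<mu>) \<le> (\<Sum>j<J. \<integral>\<^sup>+x. ennreal (w j x) * B j x \<partial>\<mu>)"
        using that by (intro member_le_sum) auto
      also note cost
      finally have "(\<integral>\<^sup>+x. ennreal (w j x) * B j x \<partial>\<mu>) \<noteq> \<infinity>"
        using fin unfolding Cst_def[symmetric] by (metis infinity_ennreal_def top_unique)
      then have "AE x in \<mu>. ennreal (w j x) * B j x \<noteq> \<infinity>"
        by (intro nn_integral_noteq_infinite m\<mu>) measurable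
      then show ?thesis
        by eventually_elim (use w(2) in \<open>auto simp: ennreal_mult_eq_top_iff ennreal_eq_0_iff intro: antisym\<close>)
    qed
    then have "AE x in \<mu>. \<forall>j\<in>{..<J}. w j x = 0 \<or> B j x \<noteq> \<infinity>"
      by (intro AE_finite_allI) auto
    then show ?thesis by eventually_elim auto
  qed
  define pr where "pr k j x = measure (L k x) (C j)" for k j x
  have prm [measurable]: "pr k j \<in> borel_measurable borel" for k j
    unfolding pr_def by (rule measurable_law[OF Cb])
  define Gd where "Gd k j = {x. 0 < pr k j x \<and> ennreal (- ln (pr k j x) / real k) \<le> B j x + ennreal r}" for k j
  have Gm [measurable]: "Gd k j \<in> sets borel" for k j unfolding Gd_def by measurable
  define u where "u k j x = w j x * indicator (Gd k j) x" for k j x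
  have u: "u k j \<in> borel_measurable borel" "0 \<le> u k j x" "u k j x \<le> w j x" for k j x
  proof -
    show "u k j \<in> borel_measurable borel" unfolding u_def by measurable
  qed (use w(2) in \<open>auto simp: u_def indicator_def\<close>)
  note [measurable] = u(1)
  have u1: "(\<Sum>j<J. u k j x) \<le> 1" for k x
    using sum_mono[of "{..<J}" "\<lambda>j. u k j x" "\<lambda>j. w j x"] u(3) w(3)[of x] by auto
  define v where "v k x = 1 - (\<Sum>j<J. u k j x)" for k x
  have v: "0 \<le> v k x" "v k x \<le> 1" for k x
    using u1[of k x] u(2) by (auto simp: v_def sum_nonneg)
  have vm [measurable]: "v k \<in> borel_measurable borel" for k unfolding v_def by measurable
  have iv: "integrable \<mu> (v k)" for k
    using v by (intro integrable_bounded_measurable[OF mu vm, of _ 1]) auto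
  have intw: "(\<integral>x. 1 - (\<Sum>j<J. w j x) \<partial>\<mu>) < r"
  proof -
    have s0: "0 \<le> (\<Sum>j<J. w j x)" for x by (intro sum_nonneg w(2))
    have isum: "integrable \<mu> (\<lambda>x. \<Sum>j<J. w j x)"
      using s0 w(3) by (intro integrable_bounded_measurable[OF mu, of _ 1]) auto
    have "ennreal (\<integral>x. (\<Sum>j<J. w j x) \<partial>\<mu>) = (\<integral>\<^sup>+x. ennreal (\<Sum>j<J. w j x) \<partial>\<mu>)"
      using s0 by (intro nn_integral_eq_integral[symmetric] isum) auto
    also have "\<dots> = (\<integral>\<^sup>+x. (\<Sum>j<J. ennreal (w j x) * 1) \<partial>\<mu>)"
      using w(2) by simp
    also have "\<dots> = (\<Sum>j<J. \<integral>\<^sup>+x. ennreal (w j x) * 1 \<partial>\<mu>)"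
      by (rule nn_integral_sum) (rule m\<mu>, measurable)
    also have "\<dots> = (\<Sum>j<J. \<integral>\<^sup>+p. indicator (A j) (snd p) * 1 \<partial>\<rho>)"
      by (intro sum.cong refl w(4)) simp
    also have "\<dots> = (\<integral>\<^sup>+p. (\<Sum>j<J. indicator (A j) (snd p) * 1) \<partial>\<rho>)"
      by (rule nn_integral_sum[symmetric]) (rule mfs, simp)
    also have "\<dots> = (\<integral>\<^sup>+p. indicator (X J) p \<partial>\<rho>)"
    proof (rule nn_integral_cong)
      fix p :: "'a \<times> 'a"
      show "(\<Sum>j<J. indicator (A j) (snd p) * 1 :: ennreal) = indicator (X J) p"
        unfolding mult_1_right sumA by (simp add: X_def indicator_def)
    qed
    also have "\<dots> = ennreal (measure \<rho> (X J))" using Xb by (simp add: R.emeasure_eq_measure)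
    finally have "(\<integral>x. (\<Sum>j<J. w j x) \<partial>\<mu>) = measure \<rho> (X J)"
      using s0 by (subst (asm) ennreal_inj) (auto intro: Bochner_Integration.integral_nonneg)
    then show ?thesis using J isum by (simp add: M.prob_space)
  qed
  \<comment> \<open>Almost every \<open>x\<close> eventually lies in \<open>Gd k j\<close> for all
    \<open>j < J\<close> of positive weight, so the cut weights converge to the full ones.\<close>
  have "(\<lambda>k. \<integral>x. v k x \<partial>\<mu>) \<longlonglongrightarrow> (\<integral>x. 1 - (\<Sum>j<J. w j x) \<partial>\<mu>)"
  proof (rule integral_dominated_convergence[where w = "\<lambda>_. 1"])
    show "AE x in \<mu>. (\<lambda>k. v k x) \<longlonglongrightarrow> 1 - (\<Sum>j<J. w j x)"
      using Bfin
    proof eventually_elim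
      case (elim x)
      have "(\<lambda>k. u k j x) \<longlonglongrightarrow> w j x" if "j < J" for j
      proof (cases "w j x = 0")
        case True then show ?thesis by (simp add: u_def)
      next
        case False
        then have "lower_rate (C j) x \<noteq> \<infinity>" using elim that by (auto simp: B_def)
        from lower_rate_eventually[OF this r] have "\<forall>\<^sub>F k in sequentially. u k j x = w j x"
          by eventually_elim (auto simp: u_def Gd_def pr_def B_def)
        then show ?thesis by (rule tendsto_eventually)
      qed
      then show ?case unfolding v_def by (intro tendsto_intros) auto
    qed
    show "(\<lambda>x. 1 - (\<Sum>j<J. w j x)) \<in> borel_measurable \<mu>" by (rule m\<mu>r) measurable
    show "v k \<in> borel_measurable \<mu>" for k by (rule m\<mu>r) measurable
    show "AE x in \<mu>. norm (v k x) \<le> 1" for k using v by simp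
  qed simp
  then have "\<forall>\<^sub>F k in sequentially. (\<integral>x. v k x \<partial>\<mu>) < r" using intw by (rule order_tendstoD)
  then show ?thesis
    using eventually_gt_at_top[of 0]
  proof eventually_elim
    case (elim k)
    have pos: "0 < measure (L k x) (C j)" if "u k j x \<noteq> 0" for j x
      using that by (auto simp: u_def Gd_def pr_def indicator_def split: if_splits)
    obtain \<sigma> where \<sigma>: "prob_borel \<sigma>" "first_marg \<sigma> = \<mu>"
      and ent: "rel_entropy \<sigma> (kernel_prod \<mu> (L k)) \<le> enn2ereal (\<integral>\<^sup>+x. (\<Sum>j<J. ennreal (u k j x * - ln (measure (L k x) (C j)))) \<partial>\<mu>)"
      and int\<sigma>: "\<And>F :: 'a \<times> 'a \<Rightarrow> ennreal. F \<in> borel_measurable borel \<Longrightarrow> (\<integral>\<^sup>+p. F p \<partial>\<sigma>) =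
        (\<integral>\<^sup>+x. ennreal (1 - (\<Sum>j<J. u k j x)) * (\<integral>\<^sup>+y. F (x, y) \<partial>L k x)
        + (\<Sum>j<J. ennreal (u k j x) * (\<integral>\<^sup>+y. ennreal (indicator (C j) y / measure (L k x) (C j)) * F (x, y) \<partial>L k x)) \<partial>\<mu>)"
      by (rule conditioned_mixture[OF mu kernel laws Cb u(1) u(2) u1 pos]) (assumption | rule that)+
    have "(\<integral>\<^sup>+x. (\<Sum>j<J. ennreal (u k j x * - ln (measure (L k x) (C j)))) \<partial>\<mu>)
        \<le> (\<integral>\<^sup>+x. (\<Sum>j<J. ennreal (real k) * (ennreal (w j x) * B j x + ennreal r * ennreal (w j x))) \<partial>\<mu>)"
    proof (intro nn_integral_mono sum_mono)
      fix x j
      show "ennreal (u k j x * - ln (measure (L k x) (C j))) \<le> ennreal (real k) * (ennreal (w j x) * B j x + ennreal r * ennreal (w j x))"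
      proof (cases "x \<in> Gd k j")
        case True
        then have g: "0 < pr k j x" "ennreal (- ln (pr k j x) / real k) \<le> B j x + ennreal r" by (auto simp: Gd_def)
        have "pr k j x \<le> 1" unfolding pr_def using prob_space.prob_le_1[OF prob_borelD(1)[OF laws]] .
        then have l: "0 \<le> - ln (pr k j x)" using g(1) by simp
        have "ennreal (u k j x * - ln (measure (L k x) (C j))) = ennreal (w j x * (real k * (- ln (pr k j x) / real k)))"
          using True elim(2) by (simp add: u_def pr_def)
        also have "\<dots> = ennreal (w j x) * (ennreal (real k) * ennreal (- ln (pr k j x) / real k))"
        proof -
          have "0 \<le> - ln (pr k j x) / real k" using l by (rule divide_nonneg_nonneg) simp
          then show ?thesis by (simp only: ennreal_mult w(2) of_nat_0_le_iff mult_nonneg_nonneg)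
        qed
        also have "\<dots> \<le> ennreal (w j x) * (ennreal (real k) * (B j x + ennreal r))"
          by (intro mult_left_mono g(2)) auto
        also have "\<dots> = ennreal (real k) * (ennreal (w j x) * B j x + ennreal r * ennreal (w j x))"
          by (simp only: distrib_left mult_ac)
        finally show ?thesis .
      qed (simp add: u_def)
    qed
    also have "\<dots> = (\<Sum>j<J. \<integral>\<^sup>+x. ennreal (real k) * (ennreal (w j x) * B j x + ennreal r * ennreal (w j x)) \<partial>\<mu>)"
      by (rule nn_integral_sum) (rule m\<mu>, measurable)
    also have "\<dots> = (\<Sum>j<J. ennreal (real k) * ((\<integral>\<^sup>+x. ennreal (w j x) * B j x \<partial>\<mu>) + ennreal r * (\<integral>\<^sup>+x. ennreal (w j x) \<partial>\<mu>)))"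
    proof (intro sum.cong refl)
      fix j
      have 1: "(\<lambda>x. ennreal (w j x) * B j x) \<in> borel_measurable \<mu>" by (rule m\<mu>) measurable
      have 2: "(\<lambda>x. ennreal (w j x)) \<in> borel_measurable \<mu>" by (rule m\<mu>) measurable
      show "(\<integral>\<^sup>+x. ennreal (real k) * (ennreal (w j x) * B j x + ennreal r * ennreal (w j x)) \<partial>\<mu>)
        = ennreal (real k) * ((\<integral>\<^sup>+x. ennreal (w j x) * B j x \<partial>\<mu>) + ennreal r * (\<integral>\<^sup>+x. ennreal (w j x) \<partial>\<mu>))"
        using 1 2 by (simp add: nn_integral_cmult nn_integral_add)
    qed
    also have "\<dots> = ennreal (real k) * ((\<Sum>j<J. \<integral>\<^sup>+x. ennreal (w j x) * B j x \<partial>\<mu>) + ennreal r * (\<Sum>j<J. \<integral>\<^sup>+x. ennreal (w j x) \<partial>\<mu>))"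
      by (simp only: sum.distrib sum_distrib_left[symmetric])
    also have "\<dots> \<le> ennreal (real k) * (Cst + ennreal r * 1)"
    proof (intro mult_left_mono add_mono cost)
      have "(\<Sum>j<J. \<integral>\<^sup>+x. ennreal (w j x) \<partial>\<mu>) = (\<integral>\<^sup>+x. (\<Sum>j<J. ennreal (w j x)) \<partial>\<mu>)"
        by (rule nn_integral_sum[symmetric]) (rule m\<mu>, measurable)
      also have "\<dots> \<le> (\<integral>\<^sup>+x. 1 \<partial>\<mu>)"
      proof (rule nn_integral_mono)
        fix x
        have "(\<Sum>j<J. ennreal (w j x)) = ennreal (\<Sum>j<J. w j x)" by (rule sum_ennreal) (rule w(2))
        also have "\<dots> \<le> ennreal 1" by (rule ennreal_leI) (rule w(3))
        finally show "(\<Sum>j<J. ennreal (w j x)) \<le> 1" by simp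
      qed
      finally show "(\<Sum>j<J. \<integral>\<^sup>+x. ennreal (w j x) \<partial>\<mu>) \<le> 1" by (simp add: M.emeasure_space_1)
    qed auto
    finally have ent': "rel_entropy \<sigma> (ref_meas \<mu> L k) \<le> enn2ereal (ennreal (real k) * (Cst + ennreal r))"
      using ent unfolding ref_meas_eq less_eq_ennreal.rep_eq by simp
    obtain C0 where C0: "Cst = ennreal C0" "0 \<le> C0" using fin unfolding Cst_def[symmetric] by (cases Cst) auto
    have "ereal (1 / real k) * rel_entropy \<sigma> (ref_meas \<mu> L k) \<le> ereal (1 / real k) * ereal (real k * (C0 + r))"
    proof (rule ereal_mult_left_mono)
      have "enn2ereal (ennreal (real k) * (Cst + ennreal r)) = ereal (real k * (C0 + r))"
      proof -
        have "ennreal (real k) * (Cst + ennreal r) = ennreal (real k * (C0 + r))"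
          unfolding C0(1) using C0(2) r by (simp only: ennreal_plus[symmetric] ennreal_mult less_imp_le of_nat_0_le_iff add_nonneg_nonneg)
        then show ?thesis using C0(2) r by simp
      qed
      then show "rel_entropy \<sigma> (ref_meas \<mu> L k) \<le> ereal (real k * (C0 + r))" using ent' by simp
    qed simp
    also have "\<dots> = ereal (C0 + r)" using elim(2) by simp
    also have "\<dots> \<le> enn2ereal Cst + ereal \<delta>" using C0 \<delta> by (simp add: r_def)
    finally have S: "ereal (1 / real k) * rel_entropy \<sigma> (ref_meas \<mu> L k) \<le> enn2ereal Cst + ereal \<delta>" .
    \<comment> \<open>One side suffices: \<open>1 + f p\<close> and \<open>1 - f p\<close> both
      range in [0, 2], and nonnegativity makes the formula for integrals against \<sigma>
      applicable.\<close>
    have one_sided: "(\<integral>p. F p \<partial>\<sigma>) \<le> (\<integral>p. F p \<partial>\<rho>) + \<delta>"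
      if F: "\<And>p. 0 \<le> F p" "\<And>p. F p \<le> 2" "\<And>p q. \<bar>F p - F q\<bar> \<le> dist p q" for F :: "'a \<times> 'a \<Rightarrow> real"
    proof -
      have "1-lipschitz_on UNIV F" using F(3) by (intro lipschitz_onI) (auto simp: dist_real_def)
      then have Fc: "continuous_on UNIV F" by (rule lipschitz_on_continuous_on)
      have Fm [measurable]: "F \<in> borel_measurable borel" using Fc by (rule borel_measurable_continuous_onI)
      have Fj [measurable]: "(\<lambda>x. F (x, q j)) \<in> borel_measurable borel" for j
        by (intro borel_measurable_continuous_onI continuous_on_compose2[OF Fc] continuous_intros) auto
      have Fy: "F (x, y) \<le> F (x, y') + dist y y'" for x y y'
        using F(3)[of "(x, y)" "(x, y')"] by (simp add: dist_Pair_Pair abs_le_iff)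
      have iF: "integrable \<tau> F" if "prob_borel \<tau>" for \<tau>
        using F by (intro integrable_bounded_measurable[OF that Fm, of 2]) auto
      have "(\<integral>\<^sup>+p. ennreal (F p) \<partial>\<sigma>) \<le> (\<integral>\<^sup>+x. ennreal (v k x) * 2 + (\<Sum>j<J. ennreal (w j x) * ennreal (F (x, q j) + r)) \<partial>\<mu>)"
        unfolding int\<sigma>[of "\<lambda>p. ennreal (F p)", OF measurable_compose[OF Fm measurable_ennreal]] v_def[symmetric]
      proof (intro nn_integral_mono add_mono sum_mono mult_left_mono)
        fix x
        interpret Lx: prob_space "L k x" using prob_borelD(1)[OF laws] .
        have "(\<integral>\<^sup>+y. ennreal (F (x, y)) \<partial>L k x) \<le> (\<integral>\<^sup>+y. ennreal 2 \<partial>L k x)"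
          using F(2) by (intro nn_integral_mono ennreal_leI)
        then show "(\<integral>\<^sup>+y. ennreal (F (x, y)) \<partial>L k x) \<le> 2" by (simp add: Lx.emeasure_space_1)
        fix j
        show "ennreal (u k j x) * (\<integral>\<^sup>+y. ennreal (indicator (C j) y / measure (L k x) (C j)) * ennreal (F (x, y)) \<partial>L k x)
          \<le> ennreal (w j x) * ennreal (F (x, q j) + r)"
        proof (cases "u k j x = 0")
          case False
          then have p: "0 < measure (L k x) (C j)" by (rule pos)
          have "(\<integral>\<^sup>+y. ennreal (indicator (C j) y / measure (L k x) (C j)) * ennreal (F (x, y)) \<partial>L k x)
              \<le> (\<integral>\<^sup>+y. ennreal (F (x, q j) + r) * ennreal (1 / measure (L k x) (C j)) * indicator (C j) y \<partial>L k x)"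
          proof (rule nn_integral_mono)
            fix y
            show "ennreal (indicator (C j) y / measure (L k x) (C j)) * ennreal (F (x, y))
              \<le> ennreal (F (x, q j) + r) * ennreal (1 / measure (L k x) (C j)) * indicator (C j) y"
            proof (cases "y \<in> C j")
              case True
              then have "F (x, y) \<le> F (x, q j) + r" using Fy[of x y "q j"] by (simp add: C_def dist_commute)
              then have "ennreal (1 / measure (L k x) (C j)) * ennreal (F (x, y)) \<le> ennreal (1 / measure (L k x) (C j)) * ennreal (F (x, q j) + r)"
                by (intro mult_left_mono ennreal_leI) auto
              then show ?thesis using True by (simp add: mult.commute)
            qed simp
          qed
          also have "\<dots> = ennreal (F (x, q j) + r) * ennreal (1 / measure (L k x) (C j)) * emeasure (L k x) (C j)"
            using Cb prob_borelD(2)[OF laws] by (intro nn_integral_cmult_indicator) auto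
          also have "\<dots> = ennreal (F (x, q j) + r)"
          proof -
            have "ennreal (1 / measure (L k x) (C j)) * emeasure (L k x) (C j) = 1"
              using p by (simp add: Lx.emeasure_eq_measure flip: ennreal_mult)
            then show ?thesis by (simp add: mult.assoc)
          qed
          finally show ?thesis using u(3) by (intro mult_mono ennreal_leI) auto
        qed simp
      qed auto
      also have "\<dots> = (\<integral>\<^sup>+x. ennreal (v k x) * 2 \<partial>\<mu>) + (\<integral>\<^sup>+x. (\<Sum>j<J. ennreal (w j x) * ennreal (F (x, q j) + r)) \<partial>\<mu>)"
      proof (rule nn_integral_add)
        show "(\<lambda>x. ennreal (v k x) * 2) \<in> borel_measurable \<mu>" by (rule m\<mu>) measurable
        show "(\<lambda>x. \<Sum>j<J. ennreal (w j x) * ennreal (F (x, q j) + r)) \<in> borel_measurable \<mu>" by (rule m\<mu>) measurable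
      qed
      also have "(\<integral>\<^sup>+x. ennreal (v k x) * 2 \<partial>\<mu>) = ennreal (\<integral>x. v k x \<partial>\<mu>) * 2"
      proof -
        have "(\<integral>\<^sup>+x. ennreal (v k x) * 2 \<partial>\<mu>) = (\<integral>\<^sup>+x. ennreal (v k x) \<partial>\<mu>) * 2"
          by (rule nn_integral_multc) (rule m\<mu>, measurable)
        then show ?thesis using nn_integral_eq_integral[OF iv] v(1) by simp
      qed
      also have "\<dots> \<le> ennreal (2 * r)"
      proof -
        have "ennreal (\<integral>x. v k x \<partial>\<mu>) * 2 \<le> ennreal r * 2" using elim(1) by (intro mult_right_mono ennreal_leI) auto
        also have "\<dots> = ennreal (2 * r)" using r by (simp add: ennreal_mult mult.commute)
        finally show ?thesis .
      qed
      also have "(\<integral>\<^sup>+x. (\<Sum>j<J. ennreal (w j x) * ennreal (F (x, q j) + r)) \<partial>\<mu>)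
          = (\<Sum>j<J. \<integral>\<^sup>+x. ennreal (w j x) * ennreal (F (x, q j) + r) \<partial>\<mu>)"
        by (rule nn_integral_sum) (rule m\<mu>, measurable)
      also have "\<dots> = (\<Sum>j<J. \<integral>\<^sup>+p. indicator (A j) (snd p) * ennreal (F (fst p, q j) + r) \<partial>\<rho>)"
        by (intro sum.cong refl w(4)) measurable
      also have "\<dots> = (\<integral>\<^sup>+p. (\<Sum>j<J. indicator (A j) (snd p) * ennreal (F (fst p, q j) + r)) \<partial>\<rho>)"
      proof (rule nn_integral_sum[symmetric])
        fix j
        show "(\<lambda>p. indicator (A j) (snd p) * ennreal (F (fst p, q j) + r)) \<in> borel_measurable \<rho>"
          using mfs[of "\<lambda>x. ennreal (F (x, q j) + r)" j] by measurable
      qed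
      also have "\<dots> \<le> (\<integral>\<^sup>+p. ennreal (F p + 2 * r) \<partial>\<rho>)"
      proof (rule nn_integral_mono)
        fix p :: "'a \<times> 'a"
        have "(\<Sum>j<J. indicator (A j) (snd p) * ennreal (F (fst p, q j) + r)) \<le> (\<Sum>j<J. indicator (A j) (snd p) * ennreal (F p + 2 * r))"
        proof (rule sum_mono)
          fix j
          show "indicator (A j) (snd p) * ennreal (F (fst p, q j) + r) \<le> indicator (A j) (snd p) * ennreal (F p + 2 * r)"
          proof (cases "snd p \<in> A j")
            case True
            then have "snd p \<in> C j" using AC by blast
            then have "F (fst p, q j) + r \<le> F p + 2 * r"
              using Fy[of "fst p" "q j" "snd p"] by (simp add: C_def)
            then show ?thesis by (intro mult_left_mono ennreal_leI) auto
          qed simp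
        qed
        also have "\<dots> = (\<Sum>j<J. indicator (A j) (snd p)) * ennreal (F p + 2 * r)" by (rule sum_distrib_right[symmetric])
        also have "\<dots> \<le> 1 * ennreal (F p + 2 * r)"
          unfolding sumA by (intro mult_right_mono) (auto simp: indicator_def)
        finally show "(\<Sum>j<J. indicator (A j) (snd p) * ennreal (F (fst p, q j) + r)) \<le> ennreal (F p + 2 * r)" by simp
      qed
      also have "\<dots> = ennreal ((\<integral>p. F p \<partial>\<rho>) + 2 * r)"
      proof -
        have "(\<integral>\<^sup>+p. ennreal (F p + 2 * r) \<partial>\<rho>) = ennreal (\<integral>p. F p + 2 * r \<partial>\<rho>)"
          using iF[OF \<rho>(1)] F(1) r by (intro nn_integral_eq_integral) auto
        also have "(\<integral>p. F p + 2 * r \<partial>\<rho>) = (\<integral>p. F p \<partial>\<rho>) + 2 * r"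
          using iF[OF \<rho>(1)] by (simp add: R.prob_space)
        finally show ?thesis .
      qed
      finally have "(\<integral>\<^sup>+p. ennreal (F p) \<partial>\<sigma>) \<le> ennreal (2 * r) + ennreal ((\<integral>p. F p \<partial>\<rho>) + 2 * r)"
        by (simp add: add_mono)
      moreover have "(\<integral>\<^sup>+p. ennreal (F p) \<partial>\<sigma>) = ennreal (\<integral>p. F p \<partial>\<sigma>)"
        using iF[OF \<sigma>(1)] F(1) by (intro nn_integral_eq_integral) auto
      moreover have F0: "0 \<le> (\<integral>p. F p \<partial>\<rho>)" using F(1) by (intro Bochner_Integration.integral_nonneg) auto
      ultimately have "ennreal (\<integral>p. F p \<partial>\<sigma>) \<le> ennreal ((\<integral>p. F p \<partial>\<rho>) + 4 * r)"
        using r by (simp flip: ennreal_plus)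
      then have "(\<integral>p. F p \<partial>\<sigma>) \<le> (\<integral>p. F p \<partial>\<rho>) + 4 * r"
        using F0 r by (subst (asm) ennreal_le_iff) auto
      then show ?thesis using \<delta> by (simp add: r_def)
    qed
    show ?case
    proof (intro exI[of _ \<sigma>] conjI allI impI \<sigma>)
      show "ereal (1 / real k) * rel_entropy \<sigma> (ref_meas \<mu> L k) \<le> enn2ereal (\<integral>\<^sup>+p. c (fst p) (snd p) \<partial>\<rho>) + ereal \<delta>"
        using S by (simp add: Cst_def)
      fix f :: "'a \<times> 'a \<Rightarrow> real"
      assume f1: "\<forall>p. \<bar>f p\<bar> \<le> 1" and f2: "\<forall>p q. \<bar>f p - f q\<bar> \<le> dist p q"
      have f: "-1 \<le> f p" "f p \<le> 1" "\<bar>f p - f p'\<bar> \<le> dist p p'" for p p'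
        using f1[THEN spec, of p] f2[THEN spec, THEN spec, of p p'] by linarith+
      have "1-lipschitz_on UNIV f" using f(3) by (intro lipschitz_onI) (auto simp: dist_real_def)
      then have fm: "f \<in> borel_measurable borel"
        by (intro borel_measurable_continuous_onI lipschitz_on_continuous_on)
      have if1: "integrable \<tau> f" if "prob_borel \<tau>" for \<tau>
        by (rule integrable_bounded_measurable[OF that fm f1[rule_format]])
      interpret S: prob_space \<sigma> using prob_borelD(1)[OF \<sigma>(1)] .
      have "(\<integral>p. 1 + f p \<partial>\<sigma>) \<le> (\<integral>p. 1 + f p \<partial>\<rho>) + \<delta>"
      proof (rule one_sided)
        show "0 \<le> 1 + f p" "1 + f p \<le> 2" "\<bar>(1 + f p) - (1 + f p')\<bar> \<le> dist p p'" for p p'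
          using f(1)[of p] f(2)[of p] f(3)[of p p'] by linarith+
      qed
      moreover have "(\<integral>p. 1 - f p \<partial>\<sigma>) \<le> (\<integral>p. 1 - f p \<partial>\<rho>) + \<delta>"
      proof (rule one_sided)
        show "0 \<le> 1 - f p" "1 - f p \<le> 2" "\<bar>(1 - f p) - (1 - f p')\<bar> \<le> dist p p'" for p p'
          using f(1)[of p] f(2)[of p] f(3)[of p p'] by linarith+
      qed
      ultimately show "\<bar>(\<integral>p. f p \<partial>\<sigma>) - (\<integral>p. f p \<partial>\<rho>)\<bar> \<le> \<delta>"
        using if1[OF \<sigma>(1)] if1[OF \<rho>(1)] by (simp add: S.prob_space R.prob_space abs_le_iff)
    qed
  qed
qed

end

section \<open>Gamma-limits from cluster points and recovery sequences\<close>

text \<open>If the filter were improper, some neighbourhood \<open>V\<close> of \<open>x\<close>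
  would satisfy \<open>a \<le> F k y\<close> for all \<open>y\<close> in \<open>V\<close> and all
  large \<open>k\<close>, which pushes the lower limit up to \<open>a\<close>. A filter on pairs
  \<open>(k, y)\<close> takes the place of a sequence, which need not exist without first
  countability.\<close>

lemma gamma_liminf_less_filter:
  fixes F :: "nat \<Rightarrow> 'b \<Rightarrow> ereal"
  assumes x: "x \<in> topspace X" and less: "gamma_liminf X F x < a"
  obtains E where "E \<noteq> bot" "filterlim fst sequentially E" "filterlim snd (nhdsin X x) E"
    "\<forall>\<^sub>F i in E. F (fst i) (snd i) < a"
proof -
  define E where "E = inf (sequentially \<times>\<^sub>F nhdsin X x) (principal {i. F (fst i) (snd i) < a})"
  have le: "E \<le> sequentially \<times>\<^sub>F nhdsin X x" by (simp add: E_def)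
  have "E \<noteq> bot"
  proof
    assume "E = bot"
    then have "\<forall>\<^sub>F i in sequentially \<times>\<^sub>F nhdsin X x. \<not> F (fst i) (snd i) < a"
      unfolding E_def trivial_limit_def eventually_inf_principal by simp
    then obtain P Q where PQ: "eventually P sequentially" "eventually Q (nhdsin X x)"
      "\<And>k y. P k \<Longrightarrow> Q y \<Longrightarrow> \<not> F k y < a"
      unfolding eventually_prod_filter by auto
    obtain V where V: "openin X V" "x \<in> V" "\<And>y. y \<in> V \<Longrightarrow> Q y"
      using PQ(2) x unfolding eventually_nhdsin by blast
    have "a \<le> liminf (\<lambda>k. INF y\<in>V. F k y)"
    proof (rule Liminf_bounded)
      show "\<forall>\<^sub>F k in sequentially. a \<le> (INF y\<in>V. F k y)"
        using PQ(1) by eventually_elim (use PQ(3) V(3) in \<open>auto intro!: INF_greatest simp: not_less\<close>)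
    qed
    also have "\<dots> \<le> gamma_liminf X F x"
      unfolding gamma_liminf_def using V by (intro SUP_upper) auto
    finally show False using less by simp
  qed
  moreover have "filterlim fst sequentially E"
    using filterlim_fst le by (rule filterlim_mono[OF _ order_refl])
  moreover have "filterlim snd (nhdsin X x) E"
    using filterlim_snd le by (rule filterlim_mono[OF _ order_refl])
  moreover have "\<forall>\<^sub>F i in E. F (fst i) (snd i) < a"
    unfolding E_def eventually_inf_principal by simp
  ultimately show ?thesis by (rule that)
qed

lemma gamma_liminf_le_sequence:
  assumes "\<And>V. openin X V \<Longrightarrow> x \<in> V \<Longrightarrow> \<forall>\<^sub>F k in sequentially. y k \<in> V"
  shows "gamma_liminf X F x \<le> liminf (\<lambda>k. F k (y k))"
  unfolding gamma_liminf_def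
proof (rule SUP_least)
  fix V assume "V \<in> {V. openin X V \<and> x \<in> V}"
  then have "\<forall>\<^sub>F k in sequentially. y k \<in> V" using assms by blast
  then have "\<forall>\<^sub>F k in sequentially. (INF y\<in>V. F k y) \<le> F k (y k)"
    by eventually_elim (rule INF_lower)
  then show "liminf (\<lambda>k. INF y\<in>V. F k y) \<le> liminf (\<lambda>k. F k (y k))" by (rule Liminf_mono)
qed

lemma gamma_limsup_le_sequence:
  assumes "\<And>V. openin X V \<Longrightarrow> x \<in> V \<Longrightarrow> \<forall>\<^sub>F k in sequentially. y k \<in> V"
  shows "gamma_limsup X F x \<le> limsup (\<lambda>k. F k (y k))"
  unfolding gamma_limsup_def
proof (rule SUP_least)
  fix V assume "V \<in> {V. openin X V \<and> x \<in> V}"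
  then have "\<forall>\<^sub>F k in sequentially. y k \<in> V" using assms by blast
  then have "\<forall>\<^sub>F k in sequentially. (INF y\<in>V. F k y) \<le> F k (y k)"
    by eventually_elim (rule INF_lower)
  then show "limsup (\<lambda>k. INF y\<in>V. F k y) \<le> limsup (\<lambda>k. F k (y k))" by (rule Limsup_mono)
qed

lemma gamma_liminf_le_limsup: "gamma_liminf X F x \<le> gamma_limsup X F x"
  unfolding gamma_liminf_def gamma_limsup_def by (rule SUP_mono, rule bexI[rotated], assumption) (rule Liminf_le_Limsup, simp)

lemma gamma_limI:
  assumes "\<And>x. x \<in> topspace X \<Longrightarrow> G x \<le> gamma_liminf X F x"
    and "\<And>x. x \<in> topspace X \<Longrightarrow> gamma_limsup X F x \<le> G x"
  shows "gamma_lim X F G"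
  unfolding gamma_lim_def
proof (intro ballI)
  fix x assume "x \<in> topspace X"
  from assms(1)[OF this] assms(2)[OF this] gamma_liminf_le_limsup[of X F x]
  show "gamma_liminf X F x = G x \<and> gamma_limsup X F x = G x"
    by (meson antisym order_trans)
qed

text \<open>Convergence in a generated topology is decided on the subbasis, by induction over
  intersections and unions.\<close>

lemma eventually_in_generated_topology:
  assumes V: "openin (topology_generated_by S) V" "x \<in> V"
    and basis: "\<And>U. U \<in> S \<Longrightarrow> x \<in> U \<Longrightarrow> \<forall>\<^sub>F i in E. y i \<in> U"
  shows "\<forall>\<^sub>F i in E. y i \<in> V"
proof -
  have "generate_topology_on S V" using V(1) by (simp add: openin_topology_generated_by_iff)
  then show ?thesis using V(2)
  proof induction
    case (Int A B)
    then show ?case by (auto intro: eventually_conj)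
  next
    case (UN K)
    then obtain A where A: "A \<in> K" "x \<in> A" by blast
    then have "\<forall>\<^sub>F i in E. y i \<in> A" using UN by blast
    then show ?case by eventually_elim (use A in blast)
  qed (use basis in auto)
qed

section \<open>Convergence along filters in the narrow and weak star topologies\<close>

lemma narrow_lim_eventually_open:
  fixes R :: "'i \<Rightarrow> 'b::topological_space measure"
  assumes R: "\<And>i. prob_borel (R i)" and lim: "narrow_lim R \<rho> E"
    and V: "openin narrow_top V" "\<rho> \<in> V"
  shows "\<forall>\<^sub>F i in E. R i \<in> V"
  using V unfolding narrow_top_def
proof (rule eventually_in_generated_topology)
  fix W assume "W \<in> {{\<rho>. prob_borel \<rho> \<and> (\<integral>x. apply_bcontfun f x \<partial>\<rho>) \<in> U} | f U. open (U :: real set)}" and "\<rho> \<in> W"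
  then obtain f :: "'b \<Rightarrow>\<^sub>C real" and U where W: "W = {\<rho>. prob_borel \<rho> \<and> (\<integral>x. apply_bcontfun f x \<partial>\<rho>) \<in> U}" "open U"
    "(\<integral>x. apply_bcontfun f x \<partial>\<rho>) \<in> U" by auto
  have "((\<lambda>i. \<integral>x. apply_bcontfun f x \<partial>R i) \<longlongrightarrow> (\<integral>x. apply_bcontfun f x \<partial>\<rho>)) E"
    using lim apply_bcontfun[of f] unfolding narrow_lim_def by blast
  from topological_tendstoD[OF this W(2,3)] show "\<forall>\<^sub>F i in E. R i \<in> W"
    by eventually_elim (use R W in auto)
qed

lemma filterlim_nhdsin_narrow_top:
  fixes \<rho> :: "'b::topological_space measure"
  assumes \<rho>: "prob_borel \<rho>" and lim: "filterlim R (nhdsin narrow_top \<rho>) E"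
  shows "narrow_lim R \<rho> E" "\<forall>\<^sub>F i in E. prob_borel (R i)"
proof -
  have ev: "\<forall>\<^sub>F i in E. prob_borel (R i) \<and> (\<integral>x. apply_bcontfun f x \<partial>R i) \<in> U"
    if "open U" "(\<integral>x. apply_bcontfun f x \<partial>\<rho>) \<in> U" for f :: "'b \<Rightarrow>\<^sub>C real" and U
  proof -
    let ?W = "{\<rho>. prob_borel \<rho> \<and> (\<integral>x. apply_bcontfun f x \<partial>\<rho>) \<in> U}"
    have "openin narrow_top ?W"
      unfolding narrow_top_def using that(1) by (intro topology_generated_by_Basis) blast
    then have "\<forall>\<^sub>F \<sigma> in nhdsin narrow_top \<rho>. \<sigma> \<in> ?W"
      unfolding eventually_nhdsin using \<rho> that(2) by blast
    from eventually_compose_filterlim[OF this lim] show ?thesis by simp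
  qed
  \<comment> \<open>The subbasic set given by the zero function and the whole line is P(X)
    itself.\<close>
  show "\<forall>\<^sub>F i in E. prob_borel (R i)"
    using ev[OF open_UNIV UNIV_I, of "const_bcontfun 0"] by eventually_elim simp
  show "narrow_lim R \<rho> E"
    unfolding narrow_lim_def
  proof (intro allI impI)
    fix f :: "'b \<Rightarrow> real" assume "f \<in> bcontfun"
    then obtain g where g: "f = apply_bcontfun g" by (rule bcontfunE)
    show "((\<lambda>i. \<integral>x. f x \<partial>R i) \<longlongrightarrow> (\<integral>x. f x \<partial>\<rho>)) E"
    proof (rule topological_tendstoI)
      fix U :: "real set" assume "open U" "(\<integral>x. f x \<partial>\<rho>) \<in> U"
      then show "\<forall>\<^sub>F i in E. (\<integral>x. f x \<partial>R i) \<in> U"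
        using ev[of U g] unfolding g by (auto elim: eventually_mono)
    qed
  qed
qed

lemma filterlim_nhdsin_weak_star_top:
  fixes l :: "('b::topological_space \<Rightarrow>\<^sub>C real) \<Rightarrow>\<^sub>L real"
  assumes lim: "filterlim h (nhdsin weak_star_top l) E"
  shows "((\<lambda>i. blinfun_apply (h i) f) \<longlongrightarrow> blinfun_apply l f) E"
proof (rule topological_tendstoI)
  fix U assume U: "open U" "blinfun_apply l f \<in> U"
  have "openin weak_star_top {l. blinfun_apply l f \<in> U}"
    unfolding weak_star_top_def using U(1) by (intro topology_generated_by_Basis) blast
  then have "\<forall>\<^sub>F m in nhdsin weak_star_top l. m \<in> {l. blinfun_apply l f \<in> U}"
    unfolding eventually_nhdsin using U(2) by blast
  from eventually_compose_filterlim[OF this lim]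
  show "\<forall>\<^sub>F i in E. blinfun_apply (h i) f \<in> U" by simp
qed

definition represents :: "'b::topological_space measure \<Rightarrow> (('b \<Rightarrow>\<^sub>C real) \<Rightarrow>\<^sub>L real) \<Rightarrow> bool" where
  "represents \<rho> l \<longleftrightarrow> prob_borel \<rho> \<and> (\<forall>f. blinfun_apply l f = (\<integral>x. apply_bcontfun f x \<partial>\<rho>))"

lemma lift_dual_eq: "lift_dual G l = (INF \<rho>\<in>{\<rho>. represents \<rho> l}. G \<rho>)"
  by (simp add: lift_dual_def represents_def)

lemma represents_exists:
  fixes \<rho> :: "'b::topological_space measure"
  assumes \<rho>: "prob_borel \<rho>"
  shows "\<exists>l. represents \<rho> l"
proof -
  have i: "integrable \<rho> (apply_bcontfun f)" for f :: "'b \<Rightarrow>\<^sub>C real"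
    by (rule integrable_bcontfun[OF \<rho> apply_bcontfun])
  have "bounded_linear (\<lambda>f :: 'b \<Rightarrow>\<^sub>C real. \<integral>x. apply_bcontfun f x \<partial>\<rho>)"
  proof (rule bounded_linear_intro[where K = 1])
    fix f g :: "'b \<Rightarrow>\<^sub>C real" and r :: real
    show "(\<integral>x. apply_bcontfun (f + g) x \<partial>\<rho>) = (\<integral>x. apply_bcontfun f x \<partial>\<rho>) + (\<integral>x. apply_bcontfun g x \<partial>\<rho>)"
      using i by (simp add: plus_bcontfun.rep_eq)
    show "(\<integral>x. apply_bcontfun (r *\<^sub>R f) x \<partial>\<rho>) = r *\<^sub>R (\<integral>x. apply_bcontfun f x \<partial>\<rho>)"
      by (simp add: scaleR_bcontfun.rep_eq)
    have "\<bar>\<integral>x. apply_bcontfun f x \<partial>\<rho>\<bar> \<le> norm f"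
      using norm_bounded[of f] by (intro abs_integral_le[OF \<rho> bcontfun_measurable[OF apply_bcontfun]]) simp
    then show "norm (\<integral>x. apply_bcontfun f x \<partial>\<rho>) \<le> norm f * 1" by simp
  qed
  then show ?thesis
    using \<rho> by (intro exI[of _ "Blinfun (\<lambda>f. \<integral>x. apply_bcontfun f x \<partial>\<rho>)"])
      (simp add: represents_def bounded_linear_Blinfun_apply)
qed

section \<open>Clustering and recovery, and their consequences in both topologies\<close>

lemma narrow_lim_mono: "narrow_lim R \<rho> E \<Longrightarrow> E' \<le> E \<Longrightarrow> narrow_lim R \<rho> E'"
  unfolding narrow_lim_def using tendsto_mono by blast

lemma narrow_lim_cong:
  assumes "\<forall>\<^sub>F i in E. R i = R' i"
  shows "narrow_lim R \<rho> E \<longleftrightarrow> narrow_lim R' \<rho> E"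
proof -
  have "((\<lambda>i. \<integral>x. f x \<partial>R i) \<longlongrightarrow> r) E \<longleftrightarrow> ((\<lambda>i. \<integral>x. f x \<partial>R' i) \<longlongrightarrow> r) E" for f :: "'b \<Rightarrow> real" and r
    by (intro tendsto_cong eventually_mono[OF assms]) simp
  then show ?thesis by (simp add: narrow_lim_def)
qed

text \<open>One sequence of measures serves both topologies, because narrow convergence is exactly
  what the weak star topology tests on represented functionals. Only the upper limit is bounded; the
  lower one follows from clustering.\<close>

definition recoverable :: "(nat \<Rightarrow> 'b::topological_space measure \<Rightarrow> ereal) \<Rightarrow> ('b measure \<Rightarrow> ereal) \<Rightarrow> bool" where
  "recoverable F G \<longleftrightarrow> (\<forall>\<rho>. prob_borel \<rho> \<longrightarrow>
    (\<exists>\<rho>s. (\<forall>k. prob_borel (\<rho>s k)) \<and> narrow_lim \<rho>s \<rho> sequentially \<and> limsup (\<lambda>k. F k (\<rho>s k)) \<le> G \<rho>))"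

text \<open>Equicoercivity combined with the lower bound. No limit is prescribed, so a limiting
  functional in the dual need not be known beforehand to come from a measure, and the index varies
  along the filter, so no subsequence has to be extracted.\<close>

definition clustering :: "(nat \<Rightarrow> 'b::topological_space measure \<Rightarrow> ereal) \<Rightarrow> ('b measure \<Rightarrow> ereal) \<Rightarrow> bool" where
  "clustering F G \<longleftrightarrow> (\<forall>E (a::real). E \<noteq> bot \<longrightarrow> filterlim fst sequentially E \<longrightarrow>
    (\<forall>\<^sub>F i in E. prob_borel (snd i) \<and> F (fst i) (snd i) < ereal a) \<longrightarrow>
    (\<exists>E' \<rho>. E' \<noteq> bot \<and> E' \<le> E \<and> prob_borel \<rho> \<and> narrow_lim snd \<rho> E' \<and> G \<rho> \<le> ereal a))"

lemma clusteringD: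
  assumes "clustering F G" "E \<noteq> bot" "filterlim fst sequentially E"
    "\<forall>\<^sub>F i in E. prob_borel (snd i) \<and> F (fst i) (snd i) < ereal a"
  obtains E' \<rho> where "E' \<noteq> bot" "E' \<le> E" "prob_borel \<rho>" "narrow_lim snd \<rho> E'" "G \<rho> \<le> ereal a"
  using assms unfolding clustering_def by meson

lemma topspace_narrow_top: "\<rho> \<in> topspace narrow_top \<Longrightarrow> prob_borel \<rho>"
  unfolding narrow_top_def topology_generated_by_topspace by blast

text \<open>A filter converging to \<rho> with energies below \<open>a\<close> would have a cluster
  measure of energy at most \<open>a\<close>; narrow limits being unique, that measure is \<rho>
  itself.\<close>

lemma gamma_liminf_narrow_top:
  fixes G :: "'b::metric_space measure \<Rightarrow> ereal"
  assumes cl: "clustering F G" and x: "\<rho> \<in> topspace narrow_top"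
  shows "G \<rho> \<le> gamma_liminf narrow_top F \<rho>"
proof (rule ccontr)
  assume "\<not> G \<rho> \<le> gamma_liminf narrow_top F \<rho>"
  then obtain a where a: "gamma_liminf narrow_top F \<rho> < ereal a" "ereal a < G \<rho>"
    using ereal_dense2 by (metis not_le)
  have \<rho>: "prob_borel \<rho>" by (rule topspace_narrow_top[OF x])
  obtain E where E: "E \<noteq> bot" "filterlim fst sequentially E" "filterlim snd (nhdsin narrow_top \<rho>) E"
    "\<forall>\<^sub>F i in E. F (fst i) (snd i) < ereal a"
    by (rule gamma_liminf_less_filter[OF x a(1)]) (rule that)
  note n = filterlim_nhdsin_narrow_top[OF \<rho> E(3)]
  obtain E' \<sigma> where E': "E' \<noteq> bot" "E' \<le> E" "prob_borel \<sigma>" "narrow_lim snd \<sigma> E'" "G \<sigma> \<le> ereal a"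
    by (rule clusteringD[OF cl E(1,2) eventually_conj[OF n(2) E(4)]]) (rule that)
  have "\<sigma> = \<rho>" by (rule narrow_lim_unique[OF E'(1,4) narrow_lim_mono[OF n(1) E'(2)] E'(3) \<rho>])
  with E'(5) a(2) show False by simp
qed

lemma gamma_lim_narrow_top:
  fixes G :: "'b::metric_space measure \<Rightarrow> ereal"
  assumes cl: "clustering F G" and rec: "recoverable F G"
  shows "gamma_lim narrow_top F G"
proof (rule gamma_limI)
  fix \<rho> :: "'b measure" assume x: "\<rho> \<in> topspace narrow_top"
  show "G \<rho> \<le> gamma_liminf narrow_top F \<rho>" by (rule gamma_liminf_narrow_top[OF cl x])
  obtain \<rho>s where \<rho>s: "\<And>k. prob_borel (\<rho>s k)" "narrow_lim \<rho>s \<rho> sequentially" "limsup (\<lambda>k. F k (\<rho>s k)) \<le> G \<rho>"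
    using rec topspace_narrow_top[OF x] unfolding recoverable_def by blast
  have "gamma_limsup narrow_top F \<rho> \<le> limsup (\<lambda>k. F k (\<rho>s k))"
    by (rule gamma_limsup_le_sequence) (rule narrow_lim_eventually_open[OF \<rho>s(1,2)])
  then show "gamma_limsup narrow_top F \<rho> \<le> G \<rho>" using \<rho>s(3) by (rule order_trans)
qed

text \<open>A functional in $C_b'$ that is a limit of represented ones with bounded energy is itself
  represented, by the cluster measure.\<close>

lemma gamma_lim_weak_star_top:
  fixes G :: "'b::metric_space measure \<Rightarrow> ereal"
  assumes cl: "clustering F G" and rec: "recoverable F G"
  shows "gamma_lim weak_star_top (\<lambda>k. lift_dual (F k)) (lift_dual G)"
proof (rule gamma_limI)
  fix l :: "('b \<Rightarrow>\<^sub>C real) \<Rightarrow>\<^sub>L real" assume x: "l \<in> topspace weak_star_top"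
  show "lift_dual G l \<le> gamma_liminf weak_star_top (\<lambda>k. lift_dual (F k)) l"
  proof (rule ccontr)
    assume "\<not> lift_dual G l \<le> gamma_liminf weak_star_top (\<lambda>k. lift_dual (F k)) l"
    then obtain a where a: "gamma_liminf weak_star_top (\<lambda>k. lift_dual (F k)) l < ereal a" "ereal a < lift_dual G l"
      using ereal_dense2 by (metis not_le)
    obtain E where E: "E \<noteq> bot" "filterlim fst sequentially E" "filterlim snd (nhdsin weak_star_top l) E"
      "\<forall>\<^sub>F i in E. lift_dual (F (fst i)) (snd i) < ereal a"
      by (rule gamma_liminf_less_filter[OF x a(1)]) (rule that)
    \<comment> \<open>Each functional with lifted energy below \<open>a\<close> is traded for a
      representing measure with energy below \<open>a\<close>; the filter is pushed forward along
      this choice with its index unchanged.\<close>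
    define P where "P i \<rho> \<longleftrightarrow> represents \<rho> (snd i) \<and> F (fst i) \<rho> < ereal a" for i \<rho>
    define h where "h i = (fst i, SOME \<rho>. P i \<rho>)" for i
    have hf: "fst (h i) = fst i" for i by (simp add: h_def)
    have P: "\<forall>\<^sub>F i in E. P i (snd (h i))"
      using E(4)
    proof eventually_elim
      case (elim i)
      then have "\<exists>\<rho>. P i \<rho>" unfolding lift_dual_eq INF_less_iff P_def by blast
      then show ?case unfolding h_def snd_conv by (rule someI_ex)
    qed
    define E2 where "E2 = filtermap h E"
    have E2: "E2 \<noteq> bot" using E(1) by (simp add: E2_def filtermap_bot_iff)
    have fst2: "filterlim fst sequentially E2"
      using E(2) by (simp add: E2_def filterlim_filtermap h_def)
    have ev2: "\<forall>\<^sub>F i in E2. prob_borel (snd i) \<and> F (fst i) (snd i) < ereal a"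
      unfolding E2_def eventually_filtermap using P by eventually_elim (simp add: P_def represents_def hf)
    obtain E' \<sigma> where E': "E' \<noteq> bot" "E' \<le> E2" "prob_borel \<sigma>" "narrow_lim snd \<sigma> E'" "G \<sigma> \<le> ereal a"
      by (rule clusteringD[OF cl E2 fst2 ev2]) (rule that)
    have "blinfun_apply l f = (\<integral>x. apply_bcontfun f x \<partial>\<sigma>)" for f
    proof (rule tendsto_unique[OF E'(1)])
      have ev: "\<forall>\<^sub>F i in E. blinfun_apply (snd i) f = (\<integral>x. apply_bcontfun f x \<partial>snd (h i))"
        using P by eventually_elim (simp add: P_def represents_def)
      have "((\<lambda>i. \<integral>x. apply_bcontfun f x \<partial>snd (h i)) \<longlongrightarrow> blinfun_apply l f) E"
        using filterlim_nhdsin_weak_star_top[OF E(3), of f] tendsto_cong[OF ev] by simp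
      then have "((\<lambda>i. \<integral>x. apply_bcontfun f x \<partial>snd i) \<longlongrightarrow> blinfun_apply l f) E2"
        unfolding E2_def by (simp add: filterlim_filtermap)
      then show "((\<lambda>i. \<integral>x. apply_bcontfun f x \<partial>snd i) \<longlongrightarrow> blinfun_apply l f) E'"
        by (rule tendsto_mono[OF E'(2)])
      show "((\<lambda>i. \<integral>x. apply_bcontfun f x \<partial>snd i) \<longlongrightarrow> (\<integral>x. apply_bcontfun f x \<partial>\<sigma>)) E'"
        using E'(4) apply_bcontfun[of f] unfolding narrow_lim_def by blast
    qed
    then have "lift_dual G l \<le> G \<sigma>"
      unfolding lift_dual_eq using E'(3) by (intro INF_lower) (simp add: represents_def)
    with E'(5) a(2) show False by simp
  qed
  \<comment> \<open>Without a representing measure the infimum on the right is infinite, so only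
    represented functionals call for a recovery sequence.\<close>
  show "gamma_limsup weak_star_top (\<lambda>k. lift_dual (F k)) l \<le> lift_dual G l"
    unfolding lift_dual_eq[of G]
  proof (rule INF_greatest)
    fix \<rho> assume "\<rho> \<in> {\<rho>. represents \<rho> l}"
    then have \<rho>: "represents \<rho> l" by simp
    obtain \<rho>s where \<rho>s: "\<And>k. prob_borel (\<rho>s k)" "narrow_lim \<rho>s \<rho> sequentially" "limsup (\<lambda>k. F k (\<rho>s k)) \<le> G \<rho>"
      using rec \<rho> unfolding recoverable_def represents_def by blast
    obtain ls where ls: "\<And>k. represents (\<rho>s k) (ls k)"
      using represents_exists[OF \<rho>s(1)] by metis
    have "gamma_limsup weak_star_top (\<lambda>k. lift_dual (F k)) l \<le> limsup (\<lambda>k. lift_dual (F k) (ls k))"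
    proof (rule gamma_limsup_le_sequence)
      fix V assume V: "openin weak_star_top V" "l \<in> V"
      then show "\<forall>\<^sub>F k in sequentially. ls k \<in> V"
        unfolding weak_star_top_def
      proof (rule eventually_in_generated_topology)
        fix W assume "W \<in> {{l. blinfun_apply l f \<in> U} | f U. open (U :: real set)}" "l \<in> W"
        then obtain f U where W: "W = {l. blinfun_apply l f \<in> U}" "open U" "blinfun_apply l f \<in> U" by auto
        have "(\<lambda>k. \<integral>x. apply_bcontfun f x \<partial>\<rho>s k) \<longlonglongrightarrow> (\<integral>x. apply_bcontfun f x \<partial>\<rho>)"
          using \<rho>s(2) apply_bcontfun[of f] unfolding narrow_lim_def by blast
        then have "(\<lambda>k. blinfun_apply (ls k) f) \<longlonglongrightarrow> blinfun_apply l f"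
          using ls \<rho> by (simp add: represents_def)
        from topological_tendstoD[OF this W(2,3)] show "\<forall>\<^sub>F k in sequentially. ls k \<in> W"
          by (simp add: W(1))
      qed
    qed
    also have "\<dots> \<le> limsup (\<lambda>k. F k (\<rho>s k))"
      using ls by (intro Limsup_mono always_eventually allI) (auto simp: lift_dual_eq intro!: INF_lower)
    also have "\<dots> \<le> G \<rho>" by (rule \<rho>s(3))
    finally show "gamma_limsup weak_star_top (\<lambda>k. lift_dual (F k)) l \<le> G \<rho>" .
  qed
qed

text \<open>A recovery sequence has the right upper limit; as it converges narrowly, the Gamma lower
  limit bounds its lower limit from below, and the two meet at \<open>G \<rho>\<close>.\<close>

lemma recovery_sequence_exact:
  fixes G :: "'b::metric_space measure \<Rightarrow> ereal"
  assumes cl: "clustering F G" and rec: "recoverable F G" and \<rho>: "prob_borel \<rho>"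
  obtains \<rho>s where "\<And>k. prob_borel (\<rho>s k)" "narrow_lim \<rho>s \<rho> sequentially" "(\<lambda>k. F k (\<rho>s k)) \<longlonglongrightarrow> G \<rho>"
proof -
  obtain \<rho>s where \<rho>s: "\<And>k. prob_borel (\<rho>s k)" "narrow_lim \<rho>s \<rho> sequentially" "limsup (\<lambda>k. F k (\<rho>s k)) \<le> G \<rho>"
    using rec \<rho> unfolding recoverable_def by blast
  have "openin narrow_top {\<rho> :: 'b measure. prob_borel \<rho> \<and> (\<integral>x. apply_bcontfun (const_bcontfun 0) x \<partial>\<rho>) \<in> (UNIV :: real set)}"
    unfolding narrow_top_def by (intro topology_generated_by_Basis) blast
  then have "\<rho> \<in> topspace narrow_top" using \<rho> openin_subset by fastforce
  then have "G \<rho> \<le> gamma_liminf narrow_top F \<rho>" by (rule gamma_liminf_narrow_top[OF cl])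
  also have "\<dots> \<le> liminf (\<lambda>k. F k (\<rho>s k))"
    by (rule gamma_liminf_le_sequence) (rule narrow_lim_eventually_open[OF \<rho>s(1,2)])
  finally have "G \<rho> \<le> liminf (\<lambda>k. F k (\<rho>s k))" .
  moreover have "liminf (\<lambda>k. F k (\<rho>s k)) \<le> limsup (\<lambda>k. F k (\<rho>s k))"
    by (rule Liminf_le_Limsup) simp
  ultimately have "(\<lambda>k. F k (\<rho>s k)) \<longlonglongrightarrow> G \<rho>"
    using \<rho>s(3) by (intro Liminf_eq_Limsup) auto
  with \<rho>s(1,2) show ?thesis by (rule that)
qed

section \<open>The Gamma-limits of the entropic costs\<close>

text \<open>Diagonal argument: measures of accuracy \<open>1 / real (Suc n)\<close> exist from some
  index on, and the accuracy is improved slowly enough along \<open>k\<close>. Where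
  \<open>G \<rho>\<close> is infinite the constant sequence does.\<close>

lemma recoverableI:
  fixes G :: "'b::metric_space measure \<Rightarrow> ereal"
  assumes close: "\<And>\<rho> (\<delta>::real). prob_borel \<rho> \<Longrightarrow> G \<rho> \<noteq> \<infinity> \<Longrightarrow> \<delta> > 0 \<Longrightarrow>
    \<forall>\<^sub>F k in sequentially. \<exists>\<sigma>. prob_borel \<sigma> \<and> F k \<sigma> \<le> G \<rho> + ereal \<delta> \<and>
      (\<forall>f. (\<forall>x. \<bar>f x\<bar> \<le> 1) \<longrightarrow> (\<forall>x y. \<bar>f x - f y\<bar> \<le> dist x y) \<longrightarrow> \<bar>(\<integral>x. f x \<partial>\<sigma>) - (\<integral>x. f x \<partial>\<rho>)\<bar> \<le> \<delta>)"
  shows "recoverable F G"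
  unfolding recoverable_def
proof (intro allI impI)
  fix \<rho> :: "'b measure" assume \<rho>: "prob_borel \<rho>"
  show "\<exists>\<rho>s. (\<forall>k. prob_borel (\<rho>s k)) \<and> narrow_lim \<rho>s \<rho> sequentially \<and> limsup (\<lambda>k. F k (\<rho>s k)) \<le> G \<rho>"
  proof (cases "G \<rho> = \<infinity>")
    case True
    then show ?thesis using \<rho> by (intro exI[of _ "\<lambda>_. \<rho>"]) (simp add: narrow_lim_const)
  next
    case False
    define d where "d n = 1 / real (Suc n)" for n
    have d: "d n > 0" for n by (simp add: d_def)
    have d_anti: "d n \<le> d m" if "m \<le> n" for m n using that by (simp add: d_def field_simps)
    define P where "P n k \<sigma> \<longleftrightarrow> prob_borel \<sigma> \<and> F k \<sigma> \<le> G \<rho> + ereal (d n) \<and>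
      (\<forall>f. (\<forall>x. \<bar>f x\<bar> \<le> 1) \<longrightarrow> (\<forall>x y. \<bar>f x - f y\<bar> \<le> dist x y) \<longrightarrow> \<bar>(\<integral>x. f x \<partial>\<sigma>) - (\<integral>x. f x \<partial>\<rho>)\<bar> \<le> d n)"
      for n k \<sigma>
    have "\<exists>K. \<forall>k\<ge>K. \<exists>\<sigma>. P n k \<sigma>" for n
      using close[OF \<rho> False d[of n]] unfolding P_def eventually_sequentially .
    then obtain K where K: "\<And>n k. k \<ge> K n \<Longrightarrow> \<exists>\<sigma>. P n k \<sigma>" by metis
    \<comment> \<open>The best accuracy level already available at \<open>k\<close>, capped by
      \<open>k\<close> so that the set is finite. The inserted 0 keeps it nonempty; this default is
      justified once \<open>K 0 \<le> k\<close>.\<close>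
    define N where "N k = Max (insert 0 {n. n \<le> k \<and> K n \<le> k})" for k
    have fin: "finite {n. n \<le> k \<and> K n \<le> k}" for k
      by (rule finite_subset[of _ "{..k}"]) auto
    have N_ge: "n \<le> N k" if "n \<le> k" "K n \<le> k" for n k
      unfolding N_def using that fin by (intro Max_ge) auto
    have N_K: "K (N k) \<le> k" if "K 0 \<le> k" for k
    proof -
      have "N k \<in> insert 0 {n. n \<le> k \<and> K n \<le> k}"
        unfolding N_def using fin by (intro Max_in) auto
      then show ?thesis using that by auto
    qed
    define \<sigma> where "\<sigma> k = (if \<exists>\<sigma>. P (N k) k \<sigma> then SOME \<sigma>. P (N k) k \<sigma> else \<rho>)" for k
    have ev: "\<forall>\<^sub>F k in sequentially. P (N k) k (\<sigma> k)"
      using eventually_ge_at_top[of "K 0"]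
    proof eventually_elim
      case (elim k)
      then have "\<exists>\<sigma>. P (N k) k \<sigma>" by (intro K N_K)
      then show ?case unfolding \<sigma>_def by (simp add: someI_ex)
    qed
    have prob: "prob_borel (\<sigma> k)" for k
    proof (cases "\<exists>\<sigma>. P (N k) k \<sigma>")
      case True
      then have "P (N k) k (\<sigma> k)" unfolding \<sigma>_def by (simp add: someI_ex)
      then show ?thesis by (simp add: P_def)
    qed (simp add: \<sigma>_def \<rho>)
    have large: "\<forall>\<^sub>F k in sequentially. d (N k) \<le> d n" for n
      using eventually_ge_at_top[of "max n (K n)"] by eventually_elim (auto intro!: d_anti N_ge)
    have small: "\<exists>n. d n < e" if "e > 0" for e
      using reals_Archimedean[OF that] by (simp add: d_def inverse_eq_divide)
    have "(\<lambda>k. d (N k)) \<longlonglongrightarrow> 0"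
    proof (rule tendstoI)
      fix e :: real assume "e > 0"
      then obtain n where n: "d n < e" using small by blast
      show "\<forall>\<^sub>F k in sequentially. dist (d (N k)) 0 < e"
        using large[of n] by eventually_elim (use n d in \<open>simp add: less_imp_le\<close>)
    qed
    moreover have "\<forall>\<^sub>F k in sequentially. \<forall>f. (\<forall>x. \<bar>f x\<bar> \<le> 1) \<longrightarrow> (\<forall>x y. \<bar>f x - f y\<bar> \<le> dist x y)
       \<longrightarrow> \<bar>(\<integral>x. f x \<partial>\<sigma> k) - (\<integral>x. f x \<partial>\<rho>)\<bar> \<le> d (N k)"
      using ev unfolding P_def by eventually_elim blast
    ultimately have lim: "narrow_lim \<sigma> \<rho> sequentially"
      by (intro narrow_lim_lipschitzI[OF prob \<rho>])
    have "limsup (\<lambda>k. F k (\<sigma> k)) \<le> G \<rho>"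
    proof (rule ereal_le_epsilon2)
      fix e :: real assume "0 < e"
      then obtain n where n: "d n < e" using small by blast
      show "limsup (\<lambda>k. F k (\<sigma> k)) \<le> G \<rho> + ereal e"
      proof (rule Limsup_bounded)
        show "\<forall>\<^sub>F k in sequentially. F k (\<sigma> k) \<le> G \<rho> + ereal e"
          using ev large[of n]
        proof eventually_elim
          case (elim k)
          have "F k (\<sigma> k) \<le> G \<rho> + ereal (d (N k))" using elim(1) by (simp add: P_def)
          also have "\<dots> \<le> G \<rho> + ereal e" using elim(2) n by (intro add_left_mono) simp
          finally show ?case .
        qed
      qed
    qed
    with prob lim show ?thesis by blast
  qed
qed

context ldp_family begin

lemma clustering_S: "clustering (S_k \<mu> L) (S_lim \<mu> c)"
  unfolding clustering_def
proof (intro allI impI)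
  fix E :: "(nat \<times> ('a \<times> 'a) measure) filter" and a :: real
  assume E: "E \<noteq> bot" "filterlim fst sequentially E"
    "\<forall>\<^sub>F i in E. prob_borel (snd i) \<and> S_k \<mu> L (fst i) (snd i) < ereal a"
  define P where "P \<rho> \<longleftrightarrow> prob_borel \<rho> \<and> first_marg \<rho> = \<mu>" for \<rho> :: "('a \<times> 'a) measure"
  have ev: "\<forall>\<^sub>F i in E. P (snd i) \<and> ereal (1 / real (fst i)) * rel_entropy (snd i) (ref_meas \<mu> L (fst i)) \<le> ereal a"
    using E(3) by eventually_elim (auto simp: S_k_def P_def split: if_splits)
  obtain \<rho>0 where \<rho>0: "P \<rho>0" using eventually_happens'[OF E(1) ev] by blast
  \<comment> \<open>The cluster theorem asks for probabilities with first marginal \<mu> at every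
    index, while the energy bound gives them only eventually; the remaining indices receive the
    fixed measure \<open>\<rho>0\<close>.\<close>
  define R where "R i = (if P (snd i) then snd i else \<rho>0)" for i :: "nat \<times> ('a \<times> 'a) measure"
  have R: "P (R i)" for i using \<rho>0 by (simp add: R_def)
  have eq: "\<forall>\<^sub>F i in E. R i = snd i" using ev by eventually_elim (simp add: R_def)
  have RD: "prob_borel (R i)" "first_marg (R i) = \<mu>" for i using R by (auto simp: P_def)
  have bound: "\<forall>\<^sub>F i in E. ereal (1 / real (fst i)) * rel_entropy (R i) (ref_meas \<mu> L (fst i)) \<le> ereal a"
    using ev eq by eventually_elim simp
  obtain E' \<rho> where E': "E' \<noteq> bot" "E' \<le> E" "prob_borel \<rho>" "first_marg \<rho> = \<mu>" "narrow_lim R \<rho> E'"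
    "enn2ereal (\<integral>\<^sup>+p. c (fst p) (snd p) \<partial>\<rho>) \<le> ereal a"
    by (rule entropy_bound_cluster[OF E(1,2) RD bound]) (rule that)
  have "narrow_lim snd \<rho> E'" using E'(5) narrow_lim_cong[OF filter_leD[OF E'(2) eq]] by simp
  with E' show "\<exists>E' \<rho>. E' \<noteq> bot \<and> E' \<le> E \<and> prob_borel \<rho> \<and> narrow_lim snd \<rho> E' \<and> S_lim \<mu> c \<rho> \<le> ereal a"
    by (intro exI[of _ E'] exI[of _ \<rho>]) (simp add: S_lim_def)
qed

text \<open>Couplings of scaled entropy below \<open>a\<close> are chosen and clustered. Second
  marginals pass to the narrow limit, so the cluster coupling competes in \<open>T_lim\<close> at
  the limiting measure: compactness of the couplings is what lets limit and infimum be
  interchanged.\<close>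

lemma clustering_T: "clustering (T_k \<mu> L) (T_lim \<mu> c)"
  unfolding clustering_def
proof (intro allI impI)
  fix E :: "(nat \<times> 'a measure) filter" and a :: real
  assume E: "E \<noteq> bot" "filterlim fst sequentially E"
    "\<forall>\<^sub>F i in E. prob_borel (snd i) \<and> T_k \<mu> L (fst i) (snd i) < ereal a"
  define P where "P i \<rho> \<longleftrightarrow> \<rho> \<in> couplings \<mu> (snd i) \<and>
    ereal (1 / real (fst i)) * rel_entropy \<rho> (ref_meas \<mu> L (fst i)) < ereal a" for i \<rho>
  have ev: "\<forall>\<^sub>F i in E. \<exists>\<rho>. P i \<rho>"
    using E(3) by eventually_elim (auto simp: T_k_def INF_less_iff P_def)
  obtain i0 \<rho>0 where \<rho>0: "P i0 \<rho>0" using eventually_happens'[OF E(1) ev] by blast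
  define R where "R i = (if \<exists>\<rho>. P i \<rho> then SOME \<rho>. P i \<rho> else \<rho>0)" for i
  have PR: "\<forall>\<^sub>F i in E. P i (R i)" using ev by eventually_elim (simp add: R_def someI_ex)
  have R: "prob_borel (R i)" "first_marg (R i) = \<mu>" for i
  proof -
    have "\<exists>i'. P i' (R i)"
    proof (cases "\<exists>\<rho>. P i \<rho>")
      case True
      then have "P i (R i)" by (simp add: R_def someI_ex)
      then show ?thesis by blast
    next
      case False
      then have "R i = \<rho>0" by (simp add: R_def)
      then show ?thesis using \<rho>0 by blast
    qed
    then show "prob_borel (R i)" "first_marg (R i) = \<mu>" by (auto simp: P_def couplings_def)
  qed
  have bound: "\<forall>\<^sub>F i in E. ereal (1 / real (fst i)) * rel_entropy (R i) (ref_meas \<mu> L (fst i)) \<le> ereal a"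
    using PR by eventually_elim (unfold P_def, rule less_imp_le, rule conjunct2)
  obtain E' \<rho> where E': "E' \<noteq> bot" "E' \<le> E" "prob_borel \<rho>" "first_marg \<rho> = \<mu>" "narrow_lim R \<rho> E'"
    "enn2ereal (\<integral>\<^sup>+p. c (fst p) (snd p) \<partial>\<rho>) \<le> ereal a"
    by (rule entropy_bound_cluster[OF E(1,2) R bound]) (rule that)
  have eq: "\<forall>\<^sub>F i in E. second_marg (R i) = snd i"
    using PR by eventually_elim (simp add: P_def couplings_def)
  have "narrow_lim snd (second_marg \<rho>) E'"
    using narrow_lim_marg(2)[OF E'(5) R(1) E'(3)] narrow_lim_cong[OF filter_leD[OF E'(2) eq]] by simp
  moreover have "T_lim \<mu> c (second_marg \<rho>) \<le> ereal a"
    unfolding T_lim_def using E'(3,4,6) by (intro INF_lower2[of \<rho>]) (simp_all add: couplings_def)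
  ultimately show "\<exists>E' \<nu>. E' \<noteq> bot \<and> E' \<le> E \<and> prob_borel \<nu> \<and> narrow_lim snd \<nu> E' \<and> T_lim \<mu> c \<nu> \<le> ereal a"
    using E'(1,2) prob_borel_marg(2)[OF E'(3)] by blast
qed

lemma recoverable_S: "recoverable (S_k \<mu> L) (S_lim \<mu> c)"
proof (rule recoverableI)
  fix \<rho> :: "('a \<times> 'a) measure" and \<delta> :: real
  assume \<rho>: "prob_borel \<rho>" and fin: "S_lim \<mu> c \<rho> \<noteq> \<infinity>" and \<delta>: "\<delta> > 0"
  have fm: "first_marg \<rho> = \<mu>" using fin by (auto simp: S_lim_def split: if_splits)
  have "(\<integral>\<^sup>+p. c (fst p) (snd p) \<partial>\<rho>) \<noteq> \<infinity>" using fin by (auto simp: S_lim_def fm)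
  from recovery_measure[OF \<rho> fm this \<delta>]
  show "\<forall>\<^sub>F k in sequentially. \<exists>\<sigma>. prob_borel \<sigma> \<and> S_k \<mu> L k \<sigma> \<le> S_lim \<mu> c \<rho> + ereal \<delta> \<and>
      (\<forall>f. (\<forall>x. \<bar>f x\<bar> \<le> 1) \<longrightarrow> (\<forall>x y. \<bar>f x - f y\<bar> \<le> dist x y) \<longrightarrow> \<bar>(\<integral>x. f x \<partial>\<sigma>) - (\<integral>x. f x \<partial>\<rho>)\<bar> \<le> \<delta>)"
  proof eventually_elim
    case (elim k)
    then obtain \<sigma> where \<sigma>: "prob_borel \<sigma>" "first_marg \<sigma> = \<mu>"
      "ereal (1 / real k) * rel_entropy \<sigma> (ref_meas \<mu> L k) \<le> enn2ereal (\<integral>\<^sup>+p. c (fst p) (snd p) \<partial>\<rho>) + ereal \<delta>"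
      "\<forall>f. (\<forall>p. \<bar>f p\<bar> \<le> 1) \<longrightarrow> (\<forall>p q. \<bar>f p - f q\<bar> \<le> dist p q) \<longrightarrow> \<bar>(\<integral>p. f p \<partial>\<sigma>) - (\<integral>p. f p \<partial>\<rho>)\<bar> \<le> \<delta>"
      by blast
    have "S_k \<mu> L k \<sigma> \<le> S_lim \<mu> c \<rho> + ereal \<delta>" using \<sigma>(2,3) by (simp add: S_k_def S_lim_def fm)
    with \<sigma>(1,4) show ?case by blast
  qed
qed

text \<open>A nearly optimal coupling is recovered and projected to the second coordinate; the
  projection is 1-Lipschitz, so closeness of couplings passes to the marginals. The second marginal
  of \<sigma> only approximates \<nu>, which is harmless since a recovery sequence may move.\<close>

lemma recoverable_T: "recoverable (T_k \<mu> L) (T_lim \<mu> c)"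
proof (rule recoverableI)
  fix \<nu> :: "'a measure" and \<delta> :: real
  assume \<nu>: "prob_borel \<nu>" and fin: "T_lim \<mu> c \<nu> \<noteq> \<infinity>" and \<delta>: "\<delta> > 0"
  have "0 \<le> T_lim \<mu> c \<nu>" unfolding T_lim_def by (rule INF_greatest) simp
  then obtain t where t: "T_lim \<mu> c \<nu> = ereal t" using fin by (cases "T_lim \<mu> c \<nu>") auto
  \<comment> \<open>Half of \<delta> goes to the choice of the coupling and half to its
    recovery.\<close>
  have "T_lim \<mu> c \<nu> < ereal (t + \<delta>/2)" using \<delta> by (simp add: t)
  then obtain \<rho> where \<rho>: "\<rho> \<in> couplings \<mu> \<nu>" "enn2ereal (\<integral>\<^sup>+p. c (fst p) (snd p) \<partial>\<rho>) < ereal (t + \<delta>/2)"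
    unfolding T_lim_def INF_less_iff by blast
  then have r: "prob_borel \<rho>" "first_marg \<rho> = \<mu>" "second_marg \<rho> = \<nu>" by (auto simp: couplings_def)
  have cfin: "(\<integral>\<^sup>+p. c (fst p) (snd p) \<partial>\<rho>) \<noteq> \<infinity>" using \<rho>(2) by auto
  have d2: "\<delta>/2 > 0" using \<delta> by simp
  from recovery_measure[OF r(1,2) cfin d2]
  show "\<forall>\<^sub>F k in sequentially. \<exists>\<sigma>. prob_borel \<sigma> \<and> T_k \<mu> L k \<sigma> \<le> T_lim \<mu> c \<nu> + ereal \<delta> \<and>
      (\<forall>f. (\<forall>x. \<bar>f x\<bar> \<le> 1) \<longrightarrow> (\<forall>x y. \<bar>f x - f y\<bar> \<le> dist x y) \<longrightarrow> \<bar>(\<integral>x. f x \<partial>\<sigma>) - (\<integral>x. f x \<partial>\<nu>)\<bar> \<le> \<delta>)"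
  proof eventually_elim
    case (elim k)
    then obtain \<sigma> where \<sigma>: "prob_borel \<sigma>" "first_marg \<sigma> = \<mu>"
      "ereal (1 / real k) * rel_entropy \<sigma> (ref_meas \<mu> L k) \<le> enn2ereal (\<integral>\<^sup>+p. c (fst p) (snd p) \<partial>\<rho>) + ereal (\<delta>/2)"
      "\<forall>f. (\<forall>p. \<bar>f p\<bar> \<le> 1) \<longrightarrow> (\<forall>p q. \<bar>f p - f q\<bar> \<le> dist p q) \<longrightarrow> \<bar>(\<integral>p. f p \<partial>\<sigma>) - (\<integral>p. f p \<partial>\<rho>)\<bar> \<le> \<delta>/2"
      by blast
    have "T_k \<mu> L k (second_marg \<sigma>) \<le> ereal (1 / real k) * rel_entropy \<sigma> (ref_meas \<mu> L k)"
      unfolding T_k_def using \<sigma>(1,2) by (intro INF_lower) (simp add: couplings_def)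
    also note \<sigma>(3)
    also have "enn2ereal (\<integral>\<^sup>+p. c (fst p) (snd p) \<partial>\<rho>) + ereal (\<delta>/2) \<le> ereal (t + \<delta>/2) + ereal (\<delta>/2)"
      using \<rho>(2) by (intro add_right_mono) simp
    also have "\<dots> = T_lim \<mu> c \<nu> + ereal \<delta>" by (simp add: t)
    finally have 1: "T_k \<mu> L k (second_marg \<sigma>) \<le> T_lim \<mu> c \<nu> + ereal \<delta>" .
    have 2: "\<bar>(\<integral>x. f x \<partial>second_marg \<sigma>) - (\<integral>x. f x \<partial>\<nu>)\<bar> \<le> \<delta>"
      if f: "\<forall>x. \<bar>f x\<bar> \<le> 1" "\<forall>x y. \<bar>f x - f y\<bar> \<le> dist x y" for f :: "'a \<Rightarrow> real"
    proof -
      have "1-lipschitz_on UNIV f" using f(2) by (intro lipschitz_onI) (auto simp: dist_real_def)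
      then have fm: "f \<in> borel_measurable borel"
        by (intro borel_measurable_continuous_onI lipschitz_on_continuous_on)
      have "\<forall>p. \<bar>f (snd p)\<bar> \<le> 1" using f(1) by blast
      moreover have "\<forall>p q. \<bar>f (snd p) - f (snd q)\<bar> \<le> dist p q"
        using f(2) dist_snd_le order_trans by blast
      ultimately have "\<bar>(\<integral>p. f (snd p) \<partial>\<sigma>) - (\<integral>p. f (snd p) \<partial>\<rho>)\<bar> \<le> \<delta>/2"
        using \<sigma>(4)[THEN spec, of "\<lambda>p. f (snd p)"] by blast
      then show ?thesis
        using integral_second_marg[OF \<sigma>(1) fm] integral_second_marg[OF r(1) fm] \<delta> by (simp add: r(3))
    qed
    show ?case using 1 2 prob_borel_marg(2)[OF \<sigma>(1)] by blast
  qed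
qed

end

theorem mainTheorem4:
  fixes \<mu> :: "'a::euclidean_space measure"
    and L :: "nat \<Rightarrow> 'a \<Rightarrow> 'a measure"
    and c :: "'a \<Rightarrow> 'a \<Rightarrow> ennreal"
    and z :: "nat \<Rightarrow> nat \<Rightarrow> 'a"
  assumes mu: "prob_borel \<mu>"
    and laws: "\<And>k x. prob_borel (L k x)"
    and feller: "\<And>k (f :: 'a \<Rightarrow>\<^sub>C real).
                   continuous_on UNIV (\<lambda>x. \<integral>y. apply_bcontfun f y \<partial>(L k x))"
    and ldp: "\<And>x. k_ldp (\<lambda>k. L k x) (c x)"
    and array: "\<And>f :: 'a \<Rightarrow>\<^sub>C real.
                   (\<lambda>n. (\<Sum>i=1..n. apply_bcontfun f (z n i)) / real n)
                     \<longlonglongrightarrow> (\<integral>x. apply_bcontfun f x \<partial>\<mu>)"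
  shows "gamma_lim weak_star_top (\<lambda>k. lift_dual (S_k \<mu> L k)) (lift_dual (S_lim \<mu> c))
       \<and> gamma_lim narrow_top (\<lambda>k. S_k \<mu> L k) (S_lim \<mu> c)
       \<and> gamma_lim weak_star_top (\<lambda>k. lift_dual (T_k \<mu> L k)) (lift_dual (T_lim \<mu> c))
       \<and> gamma_lim narrow_top (\<lambda>k. T_k \<mu> L k) (T_lim \<mu> c)
       \<and> (\<forall>\<nu>. prob_borel \<nu> \<longrightarrow>
            (\<exists>\<nu>s :: nat \<Rightarrow> 'a measure.
               (\<forall>k. prob_borel (\<nu>s k))
             \<and> (\<forall>f :: 'a \<Rightarrow>\<^sub>C real.
                  (\<lambda>k. \<integral>x. apply_bcontfun f x \<partial>(\<nu>s k)) \<longlonglongrightarrow> (\<integral>x. apply_bcontfun f x \<partial>\<nu>))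
             \<and> (\<lambda>k. T_k \<mu> L k (\<nu>s k)) \<longlonglongrightarrow> T_lim \<mu> c \<nu>))"
proof -
  \<comment> \<open>Continuity in \<open>x\<close> of the integrals of bounded continuous functions
    makes each \<open>L k\<close> a measurable kernel, the form that the locale asks for.\<close>
  have "L k \<in> borel \<rightarrow>\<^sub>M subprob_algebra borel" for k
  proof (rule feller_kernel_measurable[OF laws])
    fix f :: "'a \<Rightarrow> real" assume "f \<in> bcontfun"
    then obtain g where "f = apply_bcontfun g" by (rule bcontfunE)
    then show "continuous_on UNIV (\<lambda>x. \<integral>y. f y \<partial>L k x)" using feller[of k g] by simp
  qed
  then interpret ldp_family \<mu> L c
    using mu laws ldp by unfold_locales
  show ?thesis
  proof (intro conjI allI impI)
    show "gamma_lim weak_star_top (\<lambda>k. lift_dual (S_k \<mu> L k)) (lift_dual (S_lim \<mu> c))"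
      by (rule gamma_lim_weak_star_top[OF clustering_S recoverable_S])
    show "gamma_lim narrow_top (\<lambda>k. S_k \<mu> L k) (S_lim \<mu> c)"
      by (rule gamma_lim_narrow_top[OF clustering_S recoverable_S])
    show "gamma_lim weak_star_top (\<lambda>k. lift_dual (T_k \<mu> L k)) (lift_dual (T_lim \<mu> c))"
      by (rule gamma_lim_weak_star_top[OF clustering_T recoverable_T])
    show "gamma_lim narrow_top (\<lambda>k. T_k \<mu> L k) (T_lim \<mu> c)"
      by (rule gamma_lim_narrow_top[OF clustering_T recoverable_T])
    fix \<nu> :: "'a measure" assume "prob_borel \<nu>"
    then obtain \<nu>s where \<nu>s: "\<And>k. prob_borel (\<nu>s k)" "narrow_lim \<nu>s \<nu> sequentially"
      "(\<lambda>k. T_k \<mu> L k (\<nu>s k)) \<longlonglongrightarrow> T_lim \<mu> c \<nu>"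
      by (rule recovery_sequence_exact[OF clustering_T recoverable_T]) (rule that)
    have "(\<lambda>k. \<integral>x. apply_bcontfun f x \<partial>\<nu>s k) \<longlonglongrightarrow> (\<integral>x. apply_bcontfun f x \<partial>\<nu>)" for f :: "'a \<Rightarrow>\<^sub>C real"
      using \<nu>s(2) apply_bcontfun[of f] unfolding narrow_lim_def by blast
    with \<nu>s(1,3) show "\<exists>\<nu>s. (\<forall>k. prob_borel (\<nu>s k))
        \<and> (\<forall>f :: 'a \<Rightarrow>\<^sub>C real. (\<lambda>k. \<integral>x. apply_bcontfun f x \<partial>\<nu>s k) \<longlonglongrightarrow> (\<integral>x. apply_bcontfun f x \<partial>\<nu>))
        \<and> (\<lambda>k. T_k \<mu> L k (\<nu>s k)) \<longlonglongrightarrow> T_lim \<mu> c \<nu>"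
      by blast
  qed
qed

end
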